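(* Let $\mathbb{G}$ be a stratified group with Lie algebra $\mathcal{G}=V_1\oplus\cdots\oplus V_\iota$, let $\mathbb{M}$ be a graded group of step $\upsilon$ with Lie algebra $\mathcal{M}=W_1\oplus\cdots\oplus W_\upsilon$, let $\Omega\subset\mathbb{G}$ be open and let $f:\Omega\to\mathbb{M}$. Write $f=\exp\circ F$ with $F=\sum_{j=1}^\upsilon F_j$, $F_j=\pi_j\circ F:\Omega\to W_j$. The following statements are equivalent: (i) $f$ is continuously P-differentiable; (ii) each $F_j:\Omega\to W_j$ is continuously P-differentiable and, for every $x\in\Omega$, every $h\in\mathcal{G}$ and every $j=2,\ldots,\upsilon$, $$\pi_1\circ df(x)=dF_1(x),\qquad dF_j(x)(h)=\sum_{n=2}^{\upsilon}\frac{(-1)^n}{n!}\,\pi_j\big([F(x),dF(x)(h)]_{n-1}\big),$$ where $dF(x)=\sum_j dF_j(x)$; (iii) $f$ is continuously h-differentiable and contact.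
   Context: A graded group is a connected, simply connected real Lie group whose Lie algebra decomposes as a direct sum of subspaces (layers) $V_1\oplus\cdots\oplus V_\iota$ with $[V_i,V_j]\subset V_{i+j}$ (where $V_k=0$ for $k>\iota$); $\iota$ is its step. It is stratified if moreover $[V_i,V_j]=V_{i+j}$. The exponential map $\exp$ is a global diffeomorphism. Dilations are the Lie algebra automorphisms $\delta_rX=r^iX$ for $X\in V_i$, $r>0$, also read on the group through $\exp$. A homogeneous distance is a continuous left invariant distance $d$ with $d(\delta_rx,\delta_ry)=r\,d(x,y)$; write $d(x)=d(x,e)$. Fix homogeneous distances $d$ on $\mathbb{G}$ and $\rho$ on $\mathbb{M}$. An h-homomorphism is a group homomorphism commuting with dilations. $f$ is P-differentiable at $x$ if there is an h-homomorphism $L:\mathbb{G}\to\mathbb{M}$ with $\rho(f(x)^{-1}f(xh),L(h))/d(h)\to0$ as $h\to e$; $L=Df(x)$ is unique and $df(x)=\exp^{-1}\circ Df(x)\circ\exp:\mathcal{G}\to\mathcal{M}$ is the P-differential read between Lie algebras. $f$ is continuously P-differentiable if it is P-differentiable at every point and $x\mapsto df(x)$ is continuous. A finite dimensional vector space $W$ is regarded as the graded group $(W,+)$ with single layer $W$ and dilations $v\mapsto rv$; this gives the meaning of P-differentiability of $F_j$. $\pi_j:\mathcal{M}\to W_j$ is the canonical projection. Iterated brackets: $[X,Y]_0=Y$, $[X,Y]_k=[X,[X,Y]_{k-1}]$. $f$ is h-differentiable at $x$ if $X\mapsto f(x\exp X)$, defined on a neighbourhood of $0$ in $V_1$, is differentiable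 at $0$; its differential is $d_Hf(x):V_1\to T_{f(x)}\mathbb{M}$ ($V_1$ identified with the horizontal space $H_x\mathbb{G}=\{X(x):X\in V_1\}$ of left invariant fields). $f$ is continuously h-differentiable if it is h-differentiable everywhere and $x\mapsto d_Hf(x)$ is continuous; it is contact if $d_Hf(x)(H_x\mathbb{G})\subset H_{f(x)}\mathbb{M}=\{W(f(x)):W\in W_1\}$ for every $x\in\Omega$. *)

theory Defs
  imports "HOL-Analysis.Analysis"
begin

text \<open>Graded groups are modelled in exponential coordinates: the group is its Lie algebra
(a finite dimensional real vector space) with the Baker-Campbell-Hausdorff product, so that
exp is the identity map.  The layers are V 1, ..., V N.\<close>

definition graded :: "('a::euclidean_space \<Rightarrow> 'a \<Rightarrow> 'a) \<Rightarrow> (nat \<Rightarrow> 'a set) \<Rightarrow> nat \<Rightarrow> bool" where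
  "graded br V N \<longleftrightarrow>
     1 \<le> N \<and>
     bilinear br \<and>
     (\<forall>x. br x x = 0) \<and>
     (\<forall>x y z. br x (br y z) + br y (br z x) + br z (br x y) = 0) \<and>
     (\<forall>i\<in>{1..N}. subspace (V i)) \<and>
     (\<forall>x. \<exists>!c. (\<forall>i\<in>{1..N}. c i \<in> V i) \<and> (\<forall>i. i \<notin> {1..N} \<longrightarrow> c i = 0)
              \<and> x = (\<Sum>i=1..N. c i)) \<and>
     (\<forall>i\<in>{1..N}. \<forall>j\<in>{1..N}. \<forall>x\<in>V i. \<forall>y\<in>V j.
         br x y \<in> (if i + j \<le> N then V (i + j) else {0}))"

definition stratified :: "('a::euclidean_space \<Rightarrow> 'a \<Rightarrow> 'a) \<Rightarrow> (nat \<Rightarrow> 'a set) \<Rightarrow> nat \<Rightarrow> bool" where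
  "stratified br V N \<longleftrightarrow> graded br V N \<and>
     (\<forall>i\<in>{1..N}. \<forall>j\<in>{1..N}.
        span {br x y | x y. x \<in> V i \<and> y \<in> V j} = (if i + j \<le> N then V (i + j) else {0}))"

text \<open>Canonical projection onto the layer V j.\<close>
definition proj :: "(nat \<Rightarrow> 'a::euclidean_space set) \<Rightarrow> nat \<Rightarrow> nat \<Rightarrow> 'a \<Rightarrow> 'a" where
  "proj V N j x = (THE y. \<exists>c. (\<forall>i\<in>{1..N}. c i \<in> V i) \<and> (\<forall>i. i \<notin> {1..N} \<longrightarrow> c i = 0)
                               \<and> x = (\<Sum>i=1..N. c i) \<and> y = c j)"

text \<open>Dilations.\<close>
definition dil :: "(nat \<Rightarrow> 'a::euclidean_space set) \<Rightarrow> nat \<Rightarrow> real \<Rightarrow> 'a \<Rightarrow> 'a" where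
  "dil V N r x = (\<Sum>i=1..N. (r ^ i) *\<^sub>R proj V N i x)"

text \<open>Right-nested brackets [z1,[z2,...[z(m-1),zm]...]].\<close>
fun nest :: "('a::zero \<Rightarrow> 'a \<Rightarrow> 'a) \<Rightarrow> 'a list \<Rightarrow> 'a" where
  "nest br [] = 0"
| "nest br [z] = z"
| "nest br (z # w # zs) = br z (nest br (w # zs))"

text \<open>Dynkin's form of the BCH series, truncated at total order N (exact for an N-step
nilpotent, in particular graded of step N, Lie algebra): log(exp X exp Y).\<close>
definition bch :: "('a::euclidean_space \<Rightarrow> 'a \<Rightarrow> 'a) \<Rightarrow> nat \<Rightarrow> 'a \<Rightarrow> 'a \<Rightarrow> 'a" where
  "bch br N X Y =
    (\<Sum>n\<in>{1..N}. \<Sum>rs\<in>{rs. length rs = n \<and> (\<forall>p\<in>set rs. 0 < fst p + snd p \<and> fst p + snd p \<le> N)}.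
       (((-1) ^ (n - 1) / real n) /
          (real (\<Sum>p\<leftarrow>rs. fst p + snd p) * (\<Prod>p\<leftarrow>rs. fact (fst p) * fact (snd p))))
       *\<^sub>R nest br (concat (map (\<lambda>p. replicate (fst p) X @ replicate (snd p) Y) rs)))"

text \<open>Homogeneous distance (identity e = 0).\<close>
definition hom_dist :: "('a::euclidean_space \<Rightarrow> 'a \<Rightarrow> 'a) \<Rightarrow> (nat \<Rightarrow> 'a set) \<Rightarrow> nat
    \<Rightarrow> ('a \<Rightarrow> 'a \<Rightarrow> real) \<Rightarrow> bool" where
  "hom_dist br V N d \<longleftrightarrow>
     (\<forall>x y. 0 \<le> d x y) \<and> (\<forall>x y. d x y = 0 \<longleftrightarrow> x = y) \<and> (\<forall>x y. d x y = d y x) \<and>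
     (\<forall>x y z. d x y \<le> d x z + d z y) \<and>
     continuous_on UNIV (\<lambda>z. d (fst z) (snd z)) \<and>
     (\<forall>x y z. d (bch br N z x) (bch br N z y) = d x y) \<and>
     (\<forall>r>0. \<forall>x y. d (dil V N r x) (dil V N r y) = r * d x y)"

text \<open>P-differentiability with P-differential L at x, for a general target graded group
given by carrier S, product mM, inverse iM, dilations dM and homogeneous distance rho.
L is an h-homomorphism (group homomorphism commuting with dilations).\<close>
definition Pdiff_at :: "('a::euclidean_space \<Rightarrow> 'a \<Rightarrow> 'a) \<Rightarrow> (real \<Rightarrow> 'a \<Rightarrow> 'a) \<Rightarrow> ('a \<Rightarrow> 'a \<Rightarrow> real)
    \<Rightarrow> 'b::euclidean_space set \<Rightarrow> ('b \<Rightarrow> 'b \<Rightarrow> 'b) \<Rightarrow> ('b \<Rightarrow> 'b) \<Rightarrow> (real \<Rightarrow> 'b \<Rightarrow> 'b) \<Rightarrow> ('b \<Rightarrow> 'b \<Rightarrow> real)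
    \<Rightarrow> ('a \<Rightarrow> 'b) \<Rightarrow> 'a \<Rightarrow> ('a \<Rightarrow> 'b) \<Rightarrow> bool" where
  "Pdiff_at mG dG d S mM iM dM \<rho> f x L \<longleftrightarrow>
     (\<forall>h. L h \<in> S) \<and>
     (\<forall>h k. L (mG h k) = mM (L h) (L k)) \<and>
     (\<forall>r>0. \<forall>h. L (dG r h) = dM r (L h)) \<and>
     ((\<lambda>h. \<rho> (mM (iM (f x)) (f (mG x h))) (L h) / d h 0) \<longlongrightarrow> 0) (at 0)"

text \<open>Continuity of x \<mapsto> D x as a map into linear maps (operator norm topology; the
operators are tested on the unit ball of the subspace A).\<close>
definition cont_op :: "'a::euclidean_space set \<Rightarrow> ('a \<Rightarrow> 'c \<Rightarrow> 'b::euclidean_space) \<Rightarrow> 'c::real_normed_vector set \<Rightarrow> bool" where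
  "cont_op \<Omega> D A \<longleftrightarrow> (\<forall>x\<in>\<Omega>. \<forall>e>0. \<exists>\<delta>>0. \<forall>y\<in>\<Omega>. dist y x < \<delta> \<longrightarrow>
        (\<forall>h\<in>A. norm h \<le> 1 \<longrightarrow> dist (D y h) (D x h) < e))"

text \<open>P-differentiability of f : G \<rightarrow> M.\<close>
definition PdGM where
  "PdGM brG VG NG d brM WM NM \<rho> f x L =
     Pdiff_at (bch brG NG) (dil VG NG) d UNIV (bch brM NM) uminus (dil WM NM) \<rho> f x L"

definition dfGM where
  "dfGM brG VG NG d brM WM NM \<rho> f x = (THE L. PdGM brG VG NG d brM WM NM \<rho> f x L)"

definition cPdGM where
  "cPdGM brG VG NG d brM WM NM \<rho> \<Omega> f \<longleftrightarrow>
     (\<forall>x\<in>\<Omega>. \<exists>L. PdGM brG VG NG d brM WM NM \<rho> f x L) \<and>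
     cont_op \<Omega> (dfGM brG VG NG d brM WM NM \<rho> f) UNIV"

text \<open>P-differentiability of F : G \<rightarrow> (W,+) where W is a subspace (one-layer graded group,
dilations v \<mapsto> r v, homogeneous distance given by the norm).\<close>
definition PdGW where
  "PdGW brG VG NG d W F x L = Pdiff_at (bch brG NG) (dil VG NG) d W (+) uminus (*\<^sub>R) dist F x L"

definition dfGW where
  "dfGW brG VG NG d W F x = (THE L. PdGW brG VG NG d W F x L)"

definition cPdGW where
  "cPdGW brG VG NG d W \<Omega> F \<longleftrightarrow>
     (\<forall>x\<in>\<Omega>. \<exists>L. PdGW brG VG NG d W F x L) \<and> cont_op \<Omega> (dfGW brG VG NG d W F) UNIV"

text \<open>Iterated brackets [X,Y]_k.\<close>
definition iter_br :: "('a \<Rightarrow> 'a \<Rightarrow> 'a) \<Rightarrow> nat \<Rightarrow> 'a \<Rightarrow> 'a \<Rightarrow> 'a" where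
  "iter_br br k X Y = (br X ^^ k) Y"

text \<open>h-differentiability: X \<mapsto> f(x exp X) on V 1 differentiable at 0.\<close>
definition hdiff_at where
  "hdiff_at brG VG NG f x D \<longleftrightarrow> ((\<lambda>X. f (bch brG NG x X)) has_derivative D) (at 0 within VG 1)"

definition dH where
  "dH brG VG NG f x = (SOME D. hdiff_at brG VG NG f x D)"

definition chdiff where
  "chdiff brG VG NG \<Omega> f \<longleftrightarrow> (\<forall>x\<in>\<Omega>. \<exists>D. hdiff_at brG VG NG f x D) \<and>
     cont_op \<Omega> (dH brG VG NG f) (VG 1)"

text \<open>Horizontal space at p: values W(p) of left invariant fields W in the first layer.\<close>
definition horiz where
  "horiz br N W1 p = {v. \<exists>W\<in>W1. ((\<lambda>t. bch br N p (t *\<^sub>R W)) has_vector_derivative v) (at 0)}"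

definition contact where
  "contact brG VG NG brM WM NM \<Omega> f \<longleftrightarrow>
     (\<forall>x\<in>\<Omega>. \<forall>X\<in>VG 1. dH brG VG NG f x X \<in> horiz brM NM (WM 1) (f x))"

end

theory Submission
  imports Defs
begin

text \<open>In exponential coordinates the differential of the left translation by \<open>p\<close> at \<open>0\<close> is the inverse
  of $\Phi_p=(1-e^{-\mathrm{ad}\,p})/\mathrm{ad}\,p=\sum_{n\ge1}\frac{(-1)^{n-1}}{n!}\mathrm{ad}_p^{n-1}$, so the
  equations in (ii) say that $\Phi_{F(x)}$ maps $dF(x)(h)$ into the first layer, that is, that
  $dF(x)(h)$ is horizontal.

  (i) implies (ii): only the horizontal part of $Df(x)(h)$ contributes to the first order
  expansion of \<open>F\<close>. (ii) implies (iii): restrict to \<open>V 1\<close>. (iii) implies (i): along a horizontal line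
  the rescaled curve $\delta_{1/r}(f(x)^{-1}f(x\cdot s\,\delta_rX))$ has a left logarithmic derivative close to
  $A(x)X=\pi_1d_Hf(x)(X)$, hence it is close to $s\,A(x)X$. Every \<open>h\<close> in a bounded set is a product
  $X_1\cdots X_m$ of boundedly many bounded horizontal elements, so the difference quotients
  converge uniformly to $A(x)X_1\cdots A(x)X_m$, which is the P-differential.

  The group laws of the Dynkin series come from a faithful nilpotent representation \<open>M\<close>, for which
  $e^{M(\mathrm{bch}(X,Y))}=e^{MX}e^{MY}$: both $M(\mathrm{bch}(tX,tY))$ and $\log(e^{tMX}e^{tMY})$
  solve Dynkin's differential equation.\<close>

section \<open>Truncated power series of nilpotent operators\<close>

text \<open>The product is given only as a finite sum of brackets, from which neither associativity
  nor the differential of a translation can be read off. In an associative algebra where logarithms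
  terminate, both become identities between power series. In the passage from contact maps to
  P-differentiability the obstacle is that h-differentiability controls \<open>f\<close> only along
  horizontal lines, while each factor of a product X_1 ... X_m moves the base point of the next one.
  All estimates are therefore uniform over base points near a fixed x0, with the operator frozen at
  x0; continuity of d_H f is what allows the freezing. The same uniformity gives the continuity of
  the P-differential. A curve in the group has no integral to compare with, so closeness is obtained
  by multiplying with the inverse one-parameter group and estimating the derivative of that product.
  Dilations reduce the difference quotients to elements at distance 1 from the identity, a bounded
  set.\<close>

definition fcalc :: "nat \<Rightarrow> real fps \<Rightarrow> ('v::real_vector \<Rightarrow> 'v) \<Rightarrow> 'v \<Rightarrow> 'v" where
  "fcalc K f T w = (\<Sum>k<K. fps_nth f k *\<^sub>R (T ^^ k) w)"

lemma linear_funpow: "linear T \<Longrightarrow> linear (T ^^ k)"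
  for T :: "'v::real_vector \<Rightarrow> 'v"
  by (induction k) (auto intro!: linear_compose linear_id)

lemma linear_fcalc: "linear T \<Longrightarrow> linear (fcalc K f T)"
  unfolding fcalc_def
  by (intro linear_compose_sum ballI linear_compose_scale_right linear_funpow)

lemma funpow_eq_0_mono:
  fixes T :: "'v::real_vector \<Rightarrow> 'v"
  assumes "linear T" "(T ^^ K) v = 0" "K \<le> n"
  shows "(T ^^ n) v = 0"
proof -
  have "T ^^ n = (T ^^ (n - K)) \<circ> (T ^^ K)"
    using \<open>K \<le> n\<close> by (metis add.commute funpow_add le_add_diff_inverse)
  then show ?thesis
    using assms linear_0[OF linear_funpow[OF assms(1)]] by simp
qed

text \<open>The cut-off \<open>n\<close> on the total degree may lie below the range
  \<open>K\<close> of the factors. Conjugation uses \<open>n = K\<close>; the derivative of the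
  exponential uses \<open>n = K - 1\<close>, since differentiation lowers the degree by one.\<close>

lemma sum_triangle_Cauchy:
  fixes b c :: "nat \<Rightarrow> 'v::real_vector" and op :: "'v \<Rightarrow> 'v \<Rightarrow> 'w::real_vector"
  assumes "bilinear op" "n \<le> K" "\<And>m j. n \<le> m + j \<Longrightarrow> op (b m) (c j) = 0"
  shows "(\<Sum>k<n. \<Sum>m\<le>k. op (b m) (c (k - m))) = op (\<Sum>m<K. b m) (\<Sum>j<K. c j)"
proof -
  have "op (\<Sum>m<K. b m) (\<Sum>j<K. c j) = (\<Sum>(m,j)\<in>{..<K}\<times>{..<K}. op (b m) (c j))"
    using assms(1) by (simp add: bilinear_sum)
  also have "\<dots> = (\<Sum>(m,j)\<in>{(m,j). m + j < n}. op (b m) (c j))"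
    using assms(2,3) by (intro sum.mono_neutral_right) (auto, meson not_less)
  also have "\<dots> = (\<Sum>k<n. \<Sum>m\<le>k. op (b m) (c (k - m)))"
    by (rule sum.triangle_reindex)
  finally show ?thesis by simp
qed

text \<open>The terms cut off from the product have degree at least \<open>K\<close> and vanish at
  \<open>w\<close>. Nilpotency is asked at the single vector \<open>w\<close> because the order
  \<open>K\<close> for \<open>ad Z\<close> is established only on \<open>J 0\<close>.\<close>

lemma fcalc_mult:
  fixes T :: "'v::real_vector \<Rightarrow> 'v"
  assumes T: "linear T" "(T ^^ K) w = 0"
  shows "fcalc K (f * g) T w = fcalc K f T (fcalc K g T w)"
proof -
  have "fcalc K f T (fcalc K g T w)
      = (\<Sum>(m,j)\<in>{..<K}\<times>{..<K}. (fps_nth f m * fps_nth g j) *\<^sub>R (T ^^ (m + j)) w)"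
    unfolding fcalc_def
    by (simp add: linear_sum[OF linear_funpow[OF T(1)]] linear_scale[OF linear_funpow[OF T(1)]]
        scaleR_sum_right sum.cartesian_product funpow_add)
  also have "\<dots> = (\<Sum>(m,j)\<in>{(m,j). m + j < K}. (fps_nth f m * fps_nth g j) *\<^sub>R (T ^^ (m + j)) w)"
    using funpow_eq_0_mono[OF T] by (intro sum.mono_neutral_right) (auto, meson not_less)
  also have "\<dots> = (\<Sum>k<K. \<Sum>m\<le>k. (fps_nth f m * fps_nth g (k - m)) *\<^sub>R (T ^^ (m + (k - m))) w)"
    by (rule sum.triangle_reindex)
  also have "\<dots> = fcalc K (f * g) T w"
    by (simp add: fcalc_def fps_mult_nth scaleR_sum_left atLeast0AtMost)
  finally show ?thesis by simp
qed

lemma fcalc_1: "linear T \<Longrightarrow> 0 < K \<Longrightarrow> fcalc K 1 T w = w"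
  by (simp add: fcalc_def if_distrib[of "\<lambda>x. x *\<^sub>R _"] cong: if_cong)

lemma fcalc_X: "1 < K \<Longrightarrow> fcalc K fps_X T w = T w"
  by (simp add: fcalc_def fps_X_def if_distrib[of "\<lambda>x. x *\<^sub>R _"] cong: if_cong)

lemma fcalc_add: "fcalc K (f + g) T w = fcalc K f T w + fcalc K g T w"
  by (simp add: fcalc_def scaleR_left_distrib sum.distrib)

lemma fcalc_diff: "fcalc K (f - g) T w = fcalc K f T w - fcalc K g T w"
  by (simp add: fcalc_def scaleR_left_diff_distrib sum_subtractf)

lemma fcalc_power:
  assumes T: "linear T" "(T ^^ K) w = 0" "0 < K"
  shows "(fcalc K g T ^^ n) w = fcalc K (g ^ n) T w"
  by (induction n) (simp_all add: fcalc_1[OF T(1,3)] fcalc_mult[OF T(1,2)])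

text \<open>Since \<open>g\<close> starts in degree one, \<open>g ^ k\<close> starts in degree
  \<open>k\<close>; this makes the coefficients of the composition finite sums and lets both
  truncations at \<open>K\<close> agree.\<close>

lemma fcalc_compose:
  assumes T: "linear T" "(T ^^ K) w = 0" "0 < K" and g: "fps_nth g 0 = 0"
  shows "fcalc K f (fcalc K g T) w = fcalc K (f oo g) T w"
proof -
  have "fcalc K f (fcalc K g T) w
      = (\<Sum>k<K. \<Sum>i<K. (fps_nth f k * fps_nth (g ^ k) i) *\<^sub>R (T ^^ i) w)"
    by (simp add: fcalc_def[of K f] fcalc_power[OF T]) (simp add: fcalc_def scaleR_sum_right)
  also have "\<dots> = (\<Sum>i<K. \<Sum>k<K. (fps_nth f k * fps_nth (g ^ k) i) *\<^sub>R (T ^^ i) w)"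
    by (rule sum.swap)
  also have "\<dots> = (\<Sum>i<K. \<Sum>k\<in>{0..i}. (fps_nth f k * fps_nth (g ^ k) i) *\<^sub>R (T ^^ i) w)"
    by (intro sum.cong refl sum.mono_neutral_right)
       (auto simp: startsby_zero_power_prefix[OF g])
  also have "\<dots> = fcalc K (f oo g) T w"
    by (simp add: fcalc_def fps_compose_nth scaleR_sum_left)
  finally show ?thesis .
qed

lemma fcalc_cong:
  assumes "\<And>v. v \<in> A \<Longrightarrow> T v = S v" "\<And>v. v \<in> A \<Longrightarrow> S v \<in> A" "w \<in> A"
  shows "fcalc K f T w = fcalc K f S w"
proof -
  have "(T ^^ k) w = (S ^^ k) w \<and> (S ^^ k) w \<in> A" for k
    by (induction k) (auto simp: assms)
  then show ?thesis by (simp add: fcalc_def)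
qed

text \<open>By this naturality, power series identities are moved between brackets,
  \<open>ad (M X)\<close> and dilations.\<close>

lemma fcalc_intertwine:
  assumes "linear M" "\<And>w. M (T w) = S (M w)"
  shows "M (fcalc K f T w) = fcalc K f S (M w)"
proof -
  have "M ((T ^^ k) w) = (S ^^ k) (M w)" for k
    by (induction k) (auto simp: assms)
  then show ?thesis
    by (simp add: fcalc_def linear_sum[OF assms(1)] linear_scale[OF assms(1)])
qed

text \<open>The series of $(e^z-1)/z$ and of $\ln(1+w)/w$.\<close>
definition fps_expquot :: "real fps" where
  "fps_expquot = Abs_fps (\<lambda>n. 1 / fact (Suc n))"

definition fps_lnquot :: "real fps" where
  "fps_lnquot = Abs_fps (\<lambda>n. (-1) ^ n / real (Suc n))"

lemma fps_expquot_X: "fps_expquot * fps_X = fps_exp 1 - 1"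
proof (rule fps_ext)
  fix n show "fps_nth (fps_expquot * fps_X) n = fps_nth (fps_exp 1 - 1) n"
    by (cases n) (simp_all add: fps_expquot_def field_simps)
qed

lemma fps_lnquot_X: "fps_lnquot * fps_X = fps_ln 1"
proof (rule fps_ext)
  fix n show "fps_nth (fps_lnquot * fps_X) n = fps_nth (fps_ln 1) n"
    by (cases n) (simp_all add: fps_lnquot_def fps_ln_nth)
qed

lemma fps_ln_exp: "fps_ln 1 oo (fps_exp 1 - 1) = (fps_X :: real fps)"
  and fps_exp_ln: "(fps_exp 1 - 1) oo fps_ln 1 = (fps_X :: real fps)"
  by (simp_all add: fps_ln_fps_exp_inv fps_inv fps_inv_right)

lemma fps_exp_ln': "fps_exp 1 oo fps_ln 1 = (1 + fps_X :: real fps)"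
  using fps_exp_ln by (simp add: fps_compose_sub_distrib algebra_simps)

text \<open>With w = e^z - 1 the factor ln(1+w)/w becomes z/(e^z - 1). This inverse of (e^z - 1)/z
  is what solves the derivative formula of the exponential for Z'.\<close>

lemma fps_lnquot_expquot: "(fps_lnquot oo (fps_exp 1 - 1)) * fps_expquot = 1"
proof -
  have "((fps_lnquot oo (fps_exp 1 - 1)) * fps_expquot) * fps_X
      = (fps_lnquot oo (fps_exp 1 - 1)) * (fps_exp 1 - 1)"
    by (simp add: fps_expquot_X[symmetric] mult.assoc)
  also have "\<dots> = (fps_lnquot * fps_X) oo (fps_exp 1 - 1)"
    by (subst fps_compose_mult_distrib) simp_all
  also have "\<dots> = 1 * fps_X"
    by (simp add: fps_lnquot_X fps_ln_exp)
  finally show ?thesis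
    by (metis fps_X_neq_zero mult_right_cancel)
qed

section \<open>The Banach algebra of endomorphisms\<close>

text \<open>A type of its own lets composition be the ring multiplication, so that
  \<open>exp\<close> and its calculus are available. \<open>perfect_space\<close> keeps the zero
  space out, where 0 = 1 would hold.\<close>

typedef (overloaded) 'a endo =
  "UNIV :: ('a::{real_normed_vector,perfect_space} \<Rightarrow>\<^sub>L 'a) set"
  morphisms rep_endo Abs_endo
  by simp

setup_lifting type_definition_endo

instantiation endo :: ("{real_normed_vector,perfect_space}") real_normed_vector
begin

lift_definition zero_endo :: "'a endo" is 0 .
lift_definition plus_endo :: "'a endo \<Rightarrow> 'a endo \<Rightarrow> 'a endo" is "(+)" .
lift_definition minus_endo :: "'a endo \<Rightarrow> 'a endo \<Rightarrow> 'a endo" is "(-)" .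
lift_definition uminus_endo :: "'a endo \<Rightarrow> 'a endo" is uminus .
lift_definition scaleR_endo :: "real \<Rightarrow> 'a endo \<Rightarrow> 'a endo" is scaleR .
lift_definition norm_endo :: "'a endo \<Rightarrow> real" is norm .
definition dist_endo :: "'a endo \<Rightarrow> 'a endo \<Rightarrow> real" where "dist_endo x y = norm (x - y)"
definition sgn_endo :: "'a endo \<Rightarrow> 'a endo" where "sgn_endo x = inverse (norm x) *\<^sub>R x"
definition uniformity_endo :: "('a endo \<times> 'a endo) filter" where
  "uniformity_endo = (INF e\<in>{0 <..}. principal {(x, y). dist x y < e})"
definition open_endo :: "'a endo set \<Rightarrow> bool" where
  "open_endo U = (\<forall>x\<in>U. eventually (\<lambda>(x', y). x' = x \<longrightarrow> y \<in> U) uniformity)"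

instance
  apply intro_classes
  apply (simp_all add: dist_endo_def sgn_endo_def uniformity_endo_def open_endo_def)
  by (transfer; simp add: algebra_simps norm_triangle_ineq)+

end

instantiation endo :: ("{real_normed_vector,perfect_space}") real_normed_algebra_1
begin

lift_definition one_endo :: "'a endo" is id_blinfun .
lift_definition times_endo :: "'a endo \<Rightarrow> 'a endo \<Rightarrow> 'a endo" is blinfun_compose .

instance
proof
  show "(0 :: 'a endo) \<noteq> 1"
    by transfer (metis norm_blinfun_id norm_zero zero_neq_one)
qed (transfer; auto simp: norm_blinfun_compose blinfun.bilinear_simps intro!: blinfun_eqI)+

end

instance endo :: ("{banach,perfect_space}") banach
proof
  fix X :: "nat \<Rightarrow> 'a endo"
  assume X: "Cauchy X"
  have "Cauchy (\<lambda>n. rep_endo (X n))"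
    using X unfolding Cauchy_def dist_norm by (simp add: norm_endo.rep_eq minus_endo.rep_eq)
  then obtain L where L: "(\<lambda>n. rep_endo (X n)) \<longlonglongrightarrow> L"
    by (auto simp: Cauchy_convergent_iff convergent_def)
  have "X \<longlonglongrightarrow> Abs_endo L"
    using L unfolding lim_sequentially dist_norm
    by (simp add: norm_endo.rep_eq minus_endo.rep_eq Abs_endo_inverse)
  then show "convergent X" by (auto simp: convergent_def)
qed

lift_definition app :: "'a::{real_normed_vector,perfect_space} endo \<Rightarrow> 'a \<Rightarrow> 'a" is blinfun_apply .

lemma endo_eqI: "(\<And>v. app S v = app T v) \<Longrightarrow> S = T"
  by transfer (rule blinfun_eqI)

lemma app_simps [simp]:
  "app 0 v = 0" "app 1 v = v" "app (S + T) v = app S v + app T v"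
  "app (S - T) v = app S v - app T v" "app (- S) v = - app S v"
  "app (c *\<^sub>R S) v = c *\<^sub>R app S v" "app (S * T) v = app S (app T v)"
  by (transfer; simp add: blinfun.bilinear_simps)+

section \<open>Logarithms in a nilpotent filtered algebra\<close>

definition ad :: "'a::real_algebra \<Rightarrow> 'a \<Rightarrow> 'a" where
  "ad Z w = Z * w - w * Z"

lemma linear_ad: "linear (ad Z)"
  by (rule linearI) (simp_all add: ad_def algebra_simps)

lemma linear_times: "linear ((*) (Z :: 'a::real_algebra))"
  by (rule linearI) (simp_all add: algebra_simps)

lemma times_funpow: "((*) Z ^^ k) w = Z ^ k * (w :: 'a::real_algebra_1)"
  by (induction k) (simp_all add: mult.assoc)

lemma fcalc_times: "fcalc K f ((*) Z) w = fcalc K f ((*) Z) 1 * (w :: 'a::real_algebra_1)"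
  by (simp add: fcalc_def times_funpow sum_distrib_right)

text \<open>Left multiplication by \<open>Z\<close> is \<open>ad Z\<close> plus right multiplication
  by \<open>Z\<close>, and these two commute: this is the binomial theorem for them.\<close>

lemma power_mult_ad:
  "Z ^ k * w = (\<Sum>m\<le>k. real (k choose m) *\<^sub>R ((ad Z ^^ m) w * Z ^ (k - m)))"
  for w :: "'a::real_algebra_1"
proof (induction k)
  case (Suc k)
  let ?a = "\<lambda>m. (ad Z ^^ m) w"
  have comm: "Z * (?a m * y) = ?a (Suc m) * y + ?a m * (Z * y)" for m y
    by (simp add: ad_def algebra_simps)
  have "Z ^ Suc k * w = Z * (\<Sum>m\<le>k. real (k choose m) *\<^sub>R (?a m * Z ^ (k - m)))"
    by (simp add: Suc mult.assoc)
  also have "\<dots> = (\<Sum>m\<le>k. real (k choose m) *\<^sub>R (?a (Suc m) * Z ^ (k - m)))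
      + (\<Sum>m\<le>k. real (k choose m) *\<^sub>R (?a m * Z ^ (Suc k - m)))"
    by (simp only: sum_distrib_left mult_scaleR_right comm scaleR_right_distrib sum.distrib)
       (simp add: Suc_diff_le)
  also have "(\<Sum>m\<le>k. real (k choose m) *\<^sub>R (?a m * Z ^ (Suc k - m)))
      = (\<Sum>m\<le>Suc k. real (k choose m) *\<^sub>R (?a m * Z ^ (Suc k - m)))"
    by simp
  also have "\<dots> = w * Z ^ Suc k
      + (\<Sum>m\<le>k. real (k choose Suc m) *\<^sub>R (?a (Suc m) * Z ^ (k - m)))"
    by (subst sum.atMost_Suc_shift) simp
  finally have "Z ^ Suc k * w = w * Z ^ Suc k
      + (\<Sum>m\<le>k. real (Suc k choose Suc m) *\<^sub>R (?a (Suc m) * Z ^ (k - m)))"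
    by (simp add: scaleR_left_distrib sum.distrib del: funpow.simps)
  then show ?case
    by (subst sum.atMost_Suc_shift) simp
qed simp

text \<open>With left and right multiplication l and r the sum is (l^k - r^k)/(l - r), where l - r =
  \<open>ad Z\<close>; expanding (ad Z + r)^k gives the shifted binomial coefficients. It turns the
  derivative of a power into iterated commutators.\<close>

lemma sum_power_mult_ad:
  "(\<Sum>i<k. Z ^ i * w * Z ^ (k - Suc i))
    = (\<Sum>m<k. real (k choose Suc m) *\<^sub>R ((ad Z ^^ m) w * Z ^ (k - Suc m)))"
  for w :: "'a::real_algebra_1"
proof (induction k)
  case (Suc k)
  have "(\<Sum>i<Suc k. Z ^ i * w * Z ^ (Suc k - Suc i))
      = (\<Sum>i<k. Z ^ i * w * Z ^ (k - Suc i)) * Z + Z ^ k * w"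
    by (simp add: sum_distrib_right mult.assoc power_Suc2[symmetric] Suc_diff_Suc del: power_Suc)
  also have "\<dots> = (\<Sum>m<k. real (k choose Suc m) *\<^sub>R ((ad Z ^^ m) w * Z ^ (k - m)))
      + (\<Sum>m\<le>k. real (k choose m) *\<^sub>R ((ad Z ^^ m) w * Z ^ (k - m)))"
    unfolding Suc power_mult_ad[of Z k w] sum_distrib_right
    by (simp add: mult.assoc power_Suc2[symmetric] Suc_diff_Suc del: power_Suc)
  also have "(\<Sum>m<k. real (k choose Suc m) *\<^sub>R ((ad Z ^^ m) w * Z ^ (k - m)))
      = (\<Sum>m\<le>k. real (k choose Suc m) *\<^sub>R ((ad Z ^^ m) w * Z ^ (k - m)))"
    by (simp add: lessThan_Suc_atMost[symmetric])
  finally show ?case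
    by (simp add: lessThan_Suc_atMost scaleR_left_distrib sum.distrib add.commute)
qed simp

lemma has_vector_derivative_power:
  fixes Z :: "real \<Rightarrow> 'a::real_normed_algebra_1"
  assumes "(Z has_vector_derivative W) (at t within A)"
  shows "((\<lambda>t. Z t ^ k) has_vector_derivative (\<Sum>i<k. Z t ^ i * W * Z t ^ (k - Suc i))) (at t within A)"
proof (induction k)
  case (Suc k)
  have "((\<lambda>t. Z t ^ k * Z t) has_vector_derivative
      Z t ^ k * W + (\<Sum>i<k. Z t ^ i * W * Z t ^ (k - Suc i)) * Z t) (at t within A)"
    by (intro has_vector_derivative_mult Suc assms)
  then show ?case
    by (simp add: sum_distrib_right mult.assoc power_Suc2[symmetric] Suc_diff_Suc add.commute
        del: power_Suc)
qed simp

text \<open>\<open>J n\<close> models the operators that raise a filtration by at least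
  \<open>n\<close>; logarithms live in \<open>J (Suc 0)\<close>. The bound \<open>2 \<le> K\<close>
  keeps linear terms within the truncation, so that \<open>fps_X\<close> is not cut off.\<close>

locale nil_filtration =
  fixes J :: "nat \<Rightarrow> 'a::{real_normed_algebra_1,banach} set" and K :: nat
  assumes J_subspace: "subspace (J n)"
    and J_mult: "x \<in> J m \<Longrightarrow> y \<in> J n \<Longrightarrow> x * y \<in> J (m + n)"
    and J_zero: "x \<in> J n \<Longrightarrow> K \<le> n \<Longrightarrow> x = 0"
    and J_Suc: "x \<in> J (Suc n) \<Longrightarrow> x \<in> J n"
    and J_one: "1 \<in> J 0"
    and K_ge: "2 \<le> K"
begin

lemma K_pos: "0 < K" using K_ge by simp

lemma J_power: "x \<in> J (Suc 0) \<Longrightarrow> x ^ n \<in> J n"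
  using J_mult[of x "Suc 0"] by (induction n) (auto simp: J_one)

lemma J_mono: "x \<in> J m \<Longrightarrow> n \<le> m \<Longrightarrow> x \<in> J n"
  by (induction m) (auto simp: le_Suc_eq dest: J_Suc)

lemma J_ad: "Z \<in> J (Suc 0) \<Longrightarrow> w \<in> J m \<Longrightarrow> (ad Z ^^ n) w \<in> J (m + n)"
proof (induction n)
  case (Suc n)
  then show ?case
    using J_mult[of Z "Suc 0" "(ad Z ^^ n) w" "m + n"] J_mult[of "(ad Z ^^ n) w" "m + n" Z "Suc 0"]
    by (auto simp: ad_def[of Z "(ad Z ^^ n) w"] intro: subspace_diff J_subspace)
qed simp

lemma J_scaleR: "x \<in> J n \<Longrightarrow> c *\<^sub>R x \<in> J n"
  by (rule subspace_scale[OF J_subspace])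

lemma ad_nilpotent: "Z \<in> J (Suc 0) \<Longrightarrow> w \<in> J 0 \<Longrightarrow> (ad Z ^^ K) w = 0"
  using J_ad[of Z w 0 K] J_zero[of _ K] by simp

lemma times_nilpotent: "Z \<in> J (Suc 0) \<Longrightarrow> ((*) Z ^^ K) w = 0"
  unfolding times_funpow using J_power[of Z K] J_zero[of "Z ^ K" K] by simp

lemma J_fcalc_ad: "Z \<in> J (Suc 0) \<Longrightarrow> w \<in> J m \<Longrightarrow> fcalc K f (ad Z) w \<in> J m"
  unfolding fcalc_def
  by (intro subspace_sum J_subspace J_scaleR) (meson J_ad J_mono le_add1)

lemma J_fcalc_times:
  assumes "Z \<in> J (Suc 0)" "fps_nth f 0 = 0"
  shows "fcalc K f ((*) Z) 1 \<in> J (Suc 0)"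
  unfolding fcalc_def times_funpow
proof (intro subspace_sum J_subspace)
  fix k show "fps_nth f k *\<^sub>R (Z ^ k * 1) \<in> J (Suc 0)"
    using assms J_mono[OF J_power[OF assms(1)], of "Suc 0" k] subspace_0[OF J_subspace]
    by (cases k) (auto intro: J_scaleR)
qed

lemma exp_eq_fcalc: "Z \<in> J (Suc 0) \<Longrightarrow> exp Z = fcalc K (fps_exp 1) ((*) Z) 1"
proof -
  assume Z: "Z \<in> J (Suc 0)"
  have "exp Z = (\<Sum>n<K. Z ^ n /\<^sub>R fact n)"
    unfolding exp_def using Z J_zero[OF J_power]
    by (intro suminf_finite) (auto simp: not_less)
  then show ?thesis
    by (simp add: fcalc_def times_funpow inverse_eq_divide)
qed

text \<open>The argument is the nilpotent part: \<open>nlog n\<close> is ln(1 + n), so the logarithm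
  of \<open>u\<close> is \<open>nlog (u - 1)\<close>.\<close>

definition nlog :: "'a \<Rightarrow> 'a" where
  "nlog n = fcalc K (fps_ln 1) ((*) n) 1"

lemma nlog_J: "n \<in> J (Suc 0) \<Longrightarrow> nlog n \<in> J (Suc 0)"
  unfolding nlog_def by (rule J_fcalc_times) simp_all

lemma fcalc_fcalc_times:
  assumes "n \<in> J (Suc 0)" "fps_nth g 0 = 0"
  shows "fcalc K f ((*) (fcalc K g ((*) n) 1)) 1 = fcalc K (f oo g) ((*) n) 1"
  unfolding fcalc_times[symmetric]
  by (rule fcalc_compose) (use assms linear_times times_nilpotent K_pos in auto)

lemma exp_nlog: "n \<in> J (Suc 0) \<Longrightarrow> exp (nlog n) = 1 + n"
  unfolding nlog_def[symmetric] using K_ge exp_eq_fcalc[OF nlog_J, of n]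
  by (simp add: nlog_def fcalc_fcalc_times fps_exp_ln' fcalc_add fcalc_1 linear_times fcalc_X)

lemma exp_minus_1: "Z \<in> J (Suc 0) \<Longrightarrow> exp Z - 1 = fcalc K (fps_exp 1 - 1) ((*) Z) 1"
  by (simp add: exp_eq_fcalc fcalc_diff fcalc_1 linear_times K_pos)

lemma exp_J: "Z \<in> J (Suc 0) \<Longrightarrow> exp Z - 1 \<in> J (Suc 0)"
  unfolding exp_minus_1 by (rule J_fcalc_times) simp_all

lemma nlog_exp: "Z \<in> J (Suc 0) \<Longrightarrow> nlog (exp Z - 1) = Z"
  using K_ge by (simp add: nlog_def exp_minus_1 fcalc_fcalc_times fps_ln_exp fcalc_X)

text \<open>Expanding each Z^k w by \<open>power_mult_ad\<close> turns e^Z w into the Cauchy product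
  of e^(ad Z) w and e^Z; terms of total degree at least \<open>K\<close> vanish by the
  filtration.\<close>

lemma exp_conj:
  assumes Z: "Z \<in> J (Suc 0)" and w: "w \<in> J 0"
  shows "exp Z * w * exp (- Z) = fcalc K (fps_exp 1) (ad Z) w"
proof -
  let ?b = "\<lambda>m. (ad Z ^^ m) w /\<^sub>R fact m" and ?c = "\<lambda>j. Z ^ j /\<^sub>R fact j"
  have zero: "?b m * ?c j = 0" if "K \<le> m + j" for m j
    using J_mult[OF J_ad[OF Z w, of m] J_power[OF Z, of j]] that J_zero by simp
  have "exp Z * w = (\<Sum>k<K. (Z ^ k * w) /\<^sub>R fact k)"
    by (simp add: exp_eq_fcalc[OF Z] fcalc_def times_funpow sum_distrib_right inverse_eq_divide)
  also have "\<dots> = (\<Sum>k<K. \<Sum>m\<le>k. ?b m * ?c (k - m))"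
  proof (intro sum.cong refl)
    fix k
    show "(Z ^ k * w) /\<^sub>R fact k = (\<Sum>m\<le>k. ?b m * ?c (k - m))"
      unfolding power_mult_ad scaleR_sum_right
      by (intro sum.cong refl) (simp add: binomial_fact field_simps)
  qed
  also have "\<dots> = (\<Sum>m<K. ?b m) * (\<Sum>j<K. ?c j)"
    by (rule sum_triangle_Cauchy) (use zero in \<open>auto simp: bilinear_times\<close>)
  also have "\<dots> = fcalc K (fps_exp 1) (ad Z) w * exp Z"
    by (simp add: exp_eq_fcalc[OF Z] fcalc_def times_funpow inverse_eq_divide)
  finally show ?thesis
    by (simp add: mult.assoc exp_minus_inverse)
qed

lemma exp_has_vector_derivative:
  assumes ZJ: "\<And>t. Z t \<in> J (Suc 0)" and W: "W \<in> J (Suc 0)"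
    and der: "(Z has_vector_derivative W) (at t)"
  shows "((\<lambda>t. exp (Z t)) has_vector_derivative fcalc K fps_expquot (ad (Z t)) W * exp (Z t)) (at t)"
proof -
  let ?b = "\<lambda>m. (ad (Z t) ^^ m) W /\<^sub>R fact (Suc m)" and ?c = "\<lambda>j. Z t ^ j /\<^sub>R fact j"
  let ?S = "\<lambda>k. \<Sum>i<k. Z t ^ i * W * Z t ^ (k - Suc i)"
  have exp_sum: "exp (Z s) = (\<Sum>k<K. Z s ^ k /\<^sub>R fact k)" for s
    by (simp add: exp_eq_fcalc[OF ZJ] fcalc_def times_funpow inverse_eq_divide)
  \<comment> \<open>The vector \<open>W\<close> already has degree one, so products vanish from
    total degree \<open>K - 1\<close> on. This matches the differentiated sum, which lost its
    constant term.\<close>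
  have zero: "?b m * ?c j = 0" if "K - 1 \<le> m + j" for m j
    using J_mult[OF J_ad[OF ZJ W, of m t] J_power[OF ZJ[of t], of j]] that J_zero by simp
  have "((\<lambda>s. \<Sum>k<K. Z s ^ k /\<^sub>R fact k) has_vector_derivative
      (\<Sum>k<K. ?S k /\<^sub>R fact k)) (at t)"
    by (intro has_vector_derivative_sum has_vector_derivative_power[OF der]
        bounded_linear.has_vector_derivative[OF bounded_linear_scaleR_right])
  moreover have "(\<Sum>k<K. ?S k /\<^sub>R fact k) = (\<Sum>k<K - 1. ?S (Suc k) /\<^sub>R fact (Suc k))"
    using sum.lessThan_Suc_shift[of "\<lambda>k. ?S k /\<^sub>R fact k" "K - 1"] K_pos
    by (simp add: Suc_diff_1 del: sum.lessThan_Suc fact_Suc)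
  moreover have "\<dots> = (\<Sum>k<K - 1. \<Sum>m\<le>k. ?b m * ?c (k - m))"
  proof (intro sum.cong refl)
    fix k
    show "?S (Suc k) /\<^sub>R fact (Suc k) = (\<Sum>m\<le>k. ?b m * ?c (k - m))"
      unfolding sum_power_mult_ad unfolding scaleR_sum_right lessThan_Suc_atMost
      by (intro sum.cong refl) (simp add: binomial_fact divide_simps del: fact_Suc binomial_Suc_Suc)
  qed
  moreover have "\<dots> = (\<Sum>m<K. ?b m) * (\<Sum>j<K. ?c j)"
    by (rule sum_triangle_Cauchy) (use zero in \<open>auto simp: bilinear_times\<close>)
  moreover have "(\<Sum>m<K. ?b m) = fcalc K fps_expquot (ad (Z t)) W"
    by (simp add: fcalc_def fps_expquot_def inverse_eq_divide)
  ultimately show ?thesis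
    by (simp add: exp_sum)
qed

text \<open>With $Z(t)=\log(e^{tX}e^{tY})$ and $u=e^{Z}$ one has $u'=Ru$ for
  $R=X+e^{t\,\mathrm{ad}X}Y$, so $\frac{e^{\mathrm{ad}Z}-1}{\mathrm{ad}Z}Z'=R$; inverting the
  power series and using $e^{\mathrm{ad}Z}=e^{t\,\mathrm{ad}X}e^{t\,\mathrm{ad}Y}$ gives Dynkin's
  differential equation for $Z$.\<close>

lemma nlog_has_vector_derivative:
  fixes X Y :: 'a
  assumes X: "X \<in> J (Suc 0)" and Y: "Y \<in> J (Suc 0)"
  defines "u \<equiv> (\<lambda>t. exp (t *\<^sub>R X) * exp (t *\<^sub>R Y))"
  defines "E \<equiv> (\<lambda>t w. fcalc K (fps_exp 1) (ad (t *\<^sub>R X)) (fcalc K (fps_exp 1) (ad (t *\<^sub>R Y)) w))"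
  shows "u t - 1 \<in> J (Suc 0)"
    and "((\<lambda>t. nlog (u t - 1)) has_vector_derivative
      fcalc K fps_lnquot (\<lambda>w. E t w - w) (X + fcalc K (fps_exp 1) (ad (t *\<^sub>R X)) Y)) (at t)"
proof -
  have X': "t *\<^sub>R X \<in> J (Suc 0)" and Y': "t *\<^sub>R Y \<in> J (Suc 0)" for t
    using X Y J_scaleR by auto
  have uJ: "u t - 1 \<in> J (Suc 0)" for t
  proof -
    have "u t - 1 = (exp (t *\<^sub>R X) - 1) * (exp (t *\<^sub>R Y) - 1)
        + (exp (t *\<^sub>R X) - 1) + (exp (t *\<^sub>R Y) - 1)"
      by (simp add: u_def algebra_simps)
    moreover have "(exp (t *\<^sub>R X) - 1) * (exp (t *\<^sub>R Y) - 1) \<in> J (Suc 0)"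
      using J_mult[OF exp_J[OF X'] exp_J[OF Y'], of t t] J_mono by auto
    ultimately show ?thesis
      using exp_J[OF X', of t] exp_J[OF Y', of t] by (metis subspace_add J_subspace)
  qed
  then show "u t - 1 \<in> J (Suc 0)" .
  define R where "R = X + fcalc K (fps_exp 1) (ad (t *\<^sub>R X)) Y"
  have RJ: "R \<in> J (Suc 0)"
    unfolding R_def using X X' Y by (auto intro: subspace_add J_subspace J_fcalc_ad)
  define Z where "Z = (\<lambda>t. nlog (u t - 1))"
  have ZJ: "Z t \<in> J (Suc 0)" for t
    unfolding Z_def by (rule nlog_J[OF uJ])
  have expZ: "exp (Z t) = u t" for t
    unfolding Z_def by (simp add: exp_nlog uJ)
  have "(u has_vector_derivative exp (t *\<^sub>R X) * (exp (t *\<^sub>R Y) * Y)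
      + (exp (t *\<^sub>R X) * X) * exp (t *\<^sub>R Y)) (at t)"
    unfolding u_def
    by (intro has_vector_derivative_mult exp_scaleR_has_vector_derivative_right)
  moreover have "exp (t *\<^sub>R X) * (exp (t *\<^sub>R Y) * Y) + (exp (t *\<^sub>R X) * X) * exp (t *\<^sub>R Y) = R * u t"
  proof -
    have "R = X + exp (t *\<^sub>R X) * Y * exp (- (t *\<^sub>R X))"
      unfolding R_def by (simp add: exp_conj X' J_mono[OF Y])
    moreover have "exp (- (t *\<^sub>R X)) * (exp (t *\<^sub>R X) * w) = w" for w
      using exp_minus_inverse[of "- (t *\<^sub>R X)"] by (simp add: mult.assoc[symmetric])
    moreover have "exp (t *\<^sub>R X) * X = X * exp (t *\<^sub>R X)" "exp (t *\<^sub>R Y) * Y = Y * exp (t *\<^sub>R Y)"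
      by (simp_all add: exp_times_scaleR_commute)
    ultimately show ?thesis
      by (simp add: u_def algebra_simps)
  qed
  ultimately have u': "(u has_vector_derivative R * u t) (at t)" by simp
  \<comment> \<open>The termwise derivative of the truncated logarithm. Its explicit form places
    \<open>W\<close> in \<open>J (Suc 0)\<close>, as the derivative formula for
    \<open>exp (Z t)\<close> demands.\<close>
  define W where "W = (\<Sum>k<K. fps_nth (fps_ln 1) k *\<^sub>R
      (\<Sum>i<k. (u t - 1) ^ i * (R * u t) * (u t - 1) ^ (k - Suc i)))"
  have nJ: "x * w * y \<in> J (Suc 0)" if "x \<in> J 0" "w \<in> J (Suc 0)" "y \<in> J 0" for x w y
    using J_mult[OF J_mult[OF that(1,2)] that(3)] by simp
  have uJ0: "u t \<in> J 0"
    using subspace_add[OF J_subspace J_mono[OF uJ, of 0 t] J_one] by simp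
  have WJ: "W \<in> J (Suc 0)"
    unfolding W_def
    by (intro subspace_sum J_subspace J_scaleR nJ J_mono[OF J_power[OF uJ], of 0]
        J_mult[OF RJ uJ0, simplified]) simp_all
  have Z': "(Z has_vector_derivative W) (at t)"
  proof -
    have "((\<lambda>t. u t - 1) has_vector_derivative R * u t) (at t)"
      using has_vector_derivative_diff[OF u' has_vector_derivative_const[of 1]] by simp
    from has_vector_derivative_power[OF this]
    show ?thesis
      unfolding Z_def nlog_def fcalc_def times_funpow W_def mult_1_right
      by (intro has_vector_derivative_sum
        bounded_linear.has_vector_derivative[OF bounded_linear_scaleR_right])
  qed
  have "(u has_vector_derivative fcalc K fps_expquot (ad (Z t)) W * u t) (at t)"
    using exp_has_vector_derivative[OF ZJ WJ Z'] by (simp add: expZ)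
  with u' have "R * u t = fcalc K fps_expquot (ad (Z t)) W * u t"
    by (rule vector_derivative_unique_at)
  then have "R * (exp (Z t) * exp (- Z t)) = fcalc K fps_expquot (ad (Z t)) W * (exp (Z t) * exp (- Z t))"
    by (simp add: expZ mult.assoc[symmetric])
  then have R: "R = fcalc K fps_expquot (ad (Z t)) W"
    by (simp add: exp_minus_inverse)
  \<comment> \<open>Conjugation by e^(tX) e^(tY) = e^Z identifies \<open>E t\<close> with e^(ad Z)
    on \<open>J 0\<close>; this set is invariant, which is what \<open>fcalc_cong\<close> asks
    for.\<close>
  have "E t w = exp (Z t) * w * exp (- Z t)" if "w \<in> J 0" for w
  proof -
    have "exp (- Z t) = exp (- (t *\<^sub>R Y)) * exp (- (t *\<^sub>R X))"
    proof -
      have "exp (Z t) * (exp (- (t *\<^sub>R Y)) * exp (- (t *\<^sub>R X))) = 1"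
        unfolding expZ u_def
        by (metis exp_minus_inverse mult.assoc mult.right_neutral)
      moreover have "exp (- Z t) * exp (Z t) = 1"
        using exp_minus_inverse[of "- Z t"] by simp
      ultimately show ?thesis
        by (metis mult.assoc mult.left_neutral mult.right_neutral)
    qed
    then show ?thesis
      unfolding E_def exp_conj[OF Y' that, symmetric]
      using exp_conj[OF X' J_fcalc_ad[OF Y' that], of t "fps_exp 1" t]
      by (simp add: exp_conj[OF Y' that, symmetric] expZ u_def mult.assoc)
  qed
  then have E: "E t w - w = fcalc K (fps_exp 1 - 1) (ad (Z t)) w" if "w \<in> J 0" for w
    using that by (simp add: exp_conj ZJ fcalc_diff fcalc_1 linear_ad K_pos)
  have "fcalc K fps_lnquot (\<lambda>w. E t w - w) R
      = fcalc K fps_lnquot (fcalc K (fps_exp 1 - 1) (ad (Z t))) R"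
    by (rule fcalc_cong[of "J 0"]) (use E J_fcalc_ad[OF ZJ] J_mono[OF RJ] in auto)
  also have "\<dots> = fcalc K ((fps_lnquot oo (fps_exp 1 - 1)) * fps_expquot) (ad (Z t)) W"
    using J_mono[OF RJ, of 0] J_mono[OF WJ, of 0]
    by (simp add: fcalc_compose linear_ad ad_nilpotent ZJ K_pos) (simp add: R fcalc_mult linear_ad ad_nilpotent ZJ)
  finally have "fcalc K fps_lnquot (\<lambda>w. E t w - w) R
      = fcalc K ((fps_lnquot oo (fps_exp 1 - 1)) * fps_expquot) (ad (Z t)) W" .
  then have "fcalc K fps_lnquot (\<lambda>w. E t w - w) R = W"
    by (simp add: fps_lnquot_expquot fcalc_1 linear_ad K_pos)
  with Z' show "((\<lambda>t. nlog (u t - 1)) has_vector_derivative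
      fcalc K fps_lnquot (\<lambda>w. E t w - w) (X + fcalc K (fps_exp 1) (ad (t *\<^sub>R X)) Y)) (at t)"
    by (simp add: Z_def R_def)
qed

end

section \<open>Graded Lie algebras\<close>

locale graded_algebra =
  fixes br :: "'a::euclidean_space \<Rightarrow> 'a \<Rightarrow> 'a" and V :: "nat \<Rightarrow> 'a set" and N :: nat
  assumes graded: "graded br V N"
begin

section \<open>Brackets and projections onto the layers\<close>

abbreviation P :: "nat \<Rightarrow> 'a \<Rightarrow> 'a" where "P \<equiv> proj V N"

lemma N_ge: "1 \<le> N" and bil: "bilinear br" and br_self [simp]: "br x x = 0"
  and jacobi: "br x (br y z) + br y (br z x) + br z (br x y) = 0"
  and V_subspace: "i \<in> {1..N} \<Longrightarrow> subspace (V i)"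
  and V_br: "i \<in> {1..N} \<Longrightarrow> j \<in> {1..N} \<Longrightarrow> x \<in> V i \<Longrightarrow> y \<in> V j \<Longrightarrow>
    br x y \<in> (if i + j \<le> N then V (i + j) else {0})"
  using graded unfolding graded_def by blast+

lemmas br_simps = bilinear_ladd[OF bil] bilinear_radd[OF bil] bilinear_lmul[OF bil]
  bilinear_rmul[OF bil] bilinear_lzero[OF bil] bilinear_rzero[OF bil] bilinear_lneg[OF bil]
  bilinear_rneg[OF bil] bilinear_lsub[OF bil] bilinear_rsub[OF bil]

lemma linear_br: "linear (br x)"
  using bil by (simp add: bilinear_def)

lemma br_anti: "br y x = - br x y"
proof -
  have "0 = br (x + y) (x + y)" by (simp only: br_self)
  also have "\<dots> = br x y + br y x" by (simp only: br_simps) simp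
  finally have "br x y + br y x = 0" by simp
  then show ?thesis by (simp add: eq_neg_iff_add_eq_0 add.commute)
qed

lemma br_br: "br (br x y) z = br x (br y z) - br y (br x z)"
proof -
  have "br z (br x y) = - br (br x y) z" "br y (br z x) = - br y (br x z)"
    by (simp_all add: br_anti[of z x] br_anti[of z "br x y"] br_simps)
  then show ?thesis
    using jacobi[of x y z] by (simp add: algebra_simps)
qed

lemma decomposition_unique:
  "\<exists>!c. (\<forall>i\<in>{1..N}. c i \<in> V i) \<and> (\<forall>i. i \<notin> {1..N} \<longrightarrow> c i = 0) \<and> x = (\<Sum>i=1..N. c i)"
  using graded unfolding graded_def by blast

lemma projI:
  assumes "\<And>i. i \<in> {1..N} \<Longrightarrow> c i \<in> V i" "\<And>i. i \<notin> {1..N} \<Longrightarrow> c i = 0" "x = (\<Sum>i=1..N. c i)"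
  shows "P j x = c j"
  unfolding proj_def
proof (rule the_equality)
  fix y
  assume "\<exists>c. (\<forall>i\<in>{1..N}. c i \<in> V i) \<and> (\<forall>i. i \<notin> {1..N} \<longrightarrow> c i = 0) \<and> x = (\<Sum>i=1..N. c i) \<and> y = c j"
  then obtain c' where c': "(\<forall>i\<in>{1..N}. c' i \<in> V i) \<and> (\<forall>i. i \<notin> {1..N} \<longrightarrow> c' i = 0) \<and> x = (\<Sum>i=1..N. c' i)"
    and "y = c' j" by blast
  moreover have "c' = c"
    using c' assms decomposition_unique[of x] by blast
  ultimately show "y = c j" by simp
qed (use assms in blast)

lemma proj_decomposition:
  "(\<forall>i\<in>{1..N}. P i x \<in> V i) \<and> (\<forall>i. i \<notin> {1..N} \<longrightarrow> P i x = 0) \<and> x = (\<Sum>i=1..N. P i x)"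
proof -
  obtain c where c: "(\<forall>i\<in>{1..N}. c i \<in> V i) \<and> (\<forall>i. i \<notin> {1..N} \<longrightarrow> c i = 0) \<and> x = (\<Sum>i=1..N. c i)"
    using decomposition_unique[of x] by blast
  then have "P j x = c j" for j
    by (intro projI) auto
  then have "(\<lambda>j. P j x) = c" by auto
  with c show ?thesis by metis
qed

lemma proj_in: "i \<in> {1..N} \<Longrightarrow> P i x \<in> V i"
  and proj_out: "i \<notin> {1..N} \<Longrightarrow> P i x = 0"
  and sum_proj: "(\<Sum>i=1..N. P i x) = x"
  using proj_decomposition[of x] by auto

lemma linear_proj: "linear (P j)"
proof (rule linearI)
  show "P j (x + y) = P j x + P j y" for x y
    by (rule projI) (simp_all only: subspace_add[OF V_subspace] proj_in sum.distrib sum_proj, simp add: proj_out)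
  show "P j (c *\<^sub>R x) = c *\<^sub>R P j x" for c x
    by (rule projI) (simp_all only: subspace_scale[OF V_subspace] proj_in
        scaleR_sum_right[symmetric] sum_proj, simp add: proj_out)
qed

lemmas proj_simps = linear_add[OF linear_proj] linear_scale[OF linear_proj] linear_0[OF linear_proj]
  linear_neg[OF linear_proj] linear_diff[OF linear_proj] linear_sum[OF linear_proj]

lemma proj_V: "j \<in> {1..N} \<Longrightarrow> x \<in> V j \<Longrightarrow> P i x = (if i = j then x else 0)"
  by (rule projI) (auto simp: subspace_0[OF V_subspace])

lemma proj_eqI: "(\<And>i. i \<in> {1..N} \<Longrightarrow> P i x = P i y) \<Longrightarrow> x = y"
  by (metis (no_types, lifting) sum.cong sum_proj)

lemma V_iff: "j \<in> {1..N} \<Longrightarrow> x \<in> V j \<longleftrightarrow> (\<forall>i. i \<noteq> j \<longrightarrow> P i x = 0)"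
proof
  assume j: "j \<in> {1..N}" and *: "\<forall>i. i \<noteq> j \<longrightarrow> P i x = 0"
  have "x = P j x"
    by (rule proj_eqI) (use j * proj_V[OF j proj_in[OF j]] in auto)
  then show "x \<in> V j" using proj_in[OF j] by metis
qed (simp add: proj_V)

lemma proj_br: "P k (br x y) = (\<Sum>i=1..N. \<Sum>j=1..N. if i + j = k then br (P i x) (P j y) else 0)"
proof -
  have "br x y = br (\<Sum>i=1..N. P i x) (\<Sum>j=1..N. P j y)"
    by (simp only: sum_proj)
  also have "\<dots> = (\<Sum>i=1..N. \<Sum>j=1..N. br (P i x) (P j y))"
    by (simp add: bilinear_sum[OF bil] sum.cartesian_product)
  finally have "P k (br x y) = (\<Sum>i=1..N. \<Sum>j=1..N. P k (br (P i x) (P j y)))"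
    by (simp add: proj_simps)
  also have "\<dots> = (\<Sum>i=1..N. \<Sum>j=1..N. if i + j = k then br (P i x) (P j y) else 0)"
  proof (intro sum.cong refl)
    fix i j assume ij: "i \<in> {1..N}" "j \<in> {1..N}"
    have "br (P i x) (P j y) \<in> (if i + j \<le> N then V (i + j) else {0})"
      by (rule V_br) (use ij proj_in in auto)
    then show "P k (br (P i x) (P j y)) = (if i + j = k then br (P i x) (P j y) else 0)"
      using ij proj_V[of "i + j" "br (P i x) (P j y)" k] by (auto split: if_splits simp: proj_simps)
  qed
  finally show ?thesis .
qed

text \<open>The sum of the layers from \<open>c\<close> on. Layers start at 1, so
  \<open>tail 0\<close> and \<open>tail (Suc 0)\<close> are everything, and a bracket with an
  arbitrary element raises the index by at least one.\<close>

definition tail :: "nat \<Rightarrow> 'a set" where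
  "tail c = {x. \<forall>i<c. P i x = 0}"

lemma subspace_tail: "subspace (tail c)"
  by (auto simp: subspace_def tail_def proj_simps)

lemma tail_mono: "x \<in> tail c \<Longrightarrow> b \<le> c \<Longrightarrow> x \<in> tail b"
  by (auto simp: tail_def)

lemma tail_1: "x \<in> tail (Suc 0)"
  by (auto simp: tail_def proj_out)

lemma tail_0: "x \<in> tail 0"
  by (auto simp: tail_def)

lemma tail_zero: "x \<in> tail c \<Longrightarrow> N < c \<Longrightarrow> x = 0"
  by (rule proj_eqI) (auto simp: tail_def proj_simps)

lemma tail_br: "x \<in> tail a \<Longrightarrow> y \<in> tail b \<Longrightarrow> br x y \<in> tail (a + b)"
proof -
  assume x: "x \<in> tail a" and y: "y \<in> tail b"
  have "br (P i x) (P j y) = 0" if "i + j < a + b" for i j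
  proof (cases "i < a")
    case False
    then have "P j y = 0" using that y by (auto simp: tail_def)
    then show ?thesis by (simp add: br_simps)
  qed (use x in \<open>simp add: tail_def br_simps\<close>)
  then show ?thesis
    unfolding tail_def by (auto simp: proj_br intro!: sum.neutral)
qed

lemma V_tail: "j \<in> {1..N} \<Longrightarrow> x \<in> V j \<Longrightarrow> x \<in> tail j"
  by (auto simp: tail_def proj_V)

lemma proj_proj: "P i (P j x) = (if i = j then P j x else 0)"
  by (cases "j \<in> {1..N}") (auto simp: proj_V proj_in proj_out proj_simps)

lemma tail_diff_proj: "x \<in> tail c \<Longrightarrow> x - P c x \<in> tail (Suc c)"
  by (auto simp: tail_def proj_simps proj_proj less_Suc_eq)

lemma tail_br_Suc: "y \<in> tail b \<Longrightarrow> br x y \<in> tail (Suc b)"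
  using tail_br[OF tail_1[of x], of y b] by simp

lemma tail_br_funpow: "y \<in> tail b \<Longrightarrow> (br x ^^ k) y \<in> tail (k + b)"
  by (induction k) (auto intro: tail_br_Suc)

lemma br_nilpotent: "(br x ^^ Suc N) w = 0"
  using tail_br_funpow[OF tail_0[of w], of "Suc N" x] by (intro tail_zero) auto

text \<open>The degree derivation makes the following representation on
  $\mathcal G\times\mathbb R$ faithful even on the centre.\<close>

definition deg :: "'a \<Rightarrow> 'a" where
  "deg x = (\<Sum>i=1..N. real i *\<^sub>R P i x)"

lemma linear_deg: "linear deg"
  unfolding deg_def
  by (intro linear_compose_sum ballI linear_compose_scale_right linear_proj)

lemma proj_deg: "P i (deg x) = real i *\<^sub>R P i x"
  by (cases "i \<in> {1..N}")
     (auto simp: deg_def proj_simps proj_proj proj_out if_distrib[of "\<lambda>x. _ *\<^sub>R x"] cong: if_cong)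

lemma deg_br: "deg (br x y) = br (deg x) y + br x (deg y)"
proof (rule proj_eqI)
  fix k
  show "P k (deg (br x y)) = P k (br (deg x) y + br x (deg y))"
    unfolding proj_deg proj_simps proj_br scaleR_sum_right sum.distrib[symmetric]
    by (intro sum.cong refl) (auto simp: br_simps scaleR_left_distrib)
qed

lemma deg_inj: "deg x = 0 \<Longrightarrow> x = 0"
proof (rule proj_eqI)
  fix i assume "deg x = 0" "i \<in> {1..N}"
  then show "P i x = P i 0" using proj_deg[of i x] by (simp add: proj_simps)
qed

text \<open>The adjoint action of \<open>x\<close> on the semidirect sum of the algebra with the
  line of D = \<open>deg\<close>: [x, y + sD] = [x,y] - s deg x.\<close>

definition M :: "'a \<Rightarrow> ('a \<times> real) endo" where
  "M x = Abs_endo (Blinfun (\<lambda>v. (br x (fst v) - snd v *\<^sub>R deg x, 0)))"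

lemma app_M [simp]: "app (M x) v = (br x (fst v) - snd v *\<^sub>R deg x, 0)"
proof -
  have "linear (\<lambda>v :: 'a \<times> real. (br x (fst v) - snd v *\<^sub>R deg x, 0 :: real))"
    by (rule linearI) (simp_all add: br_simps algebra_simps)
  then show ?thesis
    by (simp add: M_def app_def Abs_endo_inverse bounded_linear_Blinfun_apply
        linear_conv_bounded_linear)
qed

lemma linear_M: "linear M"
  by (rule linearI)
     (auto intro!: endo_eqI simp: br_simps algebra_simps linear_add[OF linear_deg] linear_scale[OF linear_deg])

text \<open>On the algebra this is the Jacobi identity; on the added coordinate it is the derivation
  rule for \<open>deg\<close>.\<close>

lemma M_br: "M (br x y) = ad (M x) (M y)"
  by (rule endo_eqI) (simp add: ad_def br_br deg_br br_simps br_anti[of y "deg x"] algebra_simps)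

lemma M_inj: "M x = M y \<Longrightarrow> x = y"
proof -
  assume "M x = M y"
  then have "app (M x) (0, 1) = app (M y) (0, 1)" by simp
  then have "deg (x - y) = 0" by (simp add: br_simps linear_diff[OF linear_deg])
  then show "x = y" using deg_inj[of "x - y"] by simp
qed

text \<open>The added coordinate has degree 0 and is sent into \<open>tail (Suc 0)\<close> by every
  \<open>M x\<close>. Since \<open>tail (Suc N)\<close> is trivial, operators of degree
  \<open>Suc N\<close> are zero, which fixes the truncation order.\<close>

definition filt :: "nat \<Rightarrow> ('a \<times> real) set" where
  "filt c = (if c = 0 then UNIV else tail c \<times> {0})"

definition filt_endo :: "nat \<Rightarrow> ('a \<times> real) endo set" where
  "filt_endo n = {T. \<forall>c. \<forall>v\<in>filt c. app T v \<in> filt (c + n)}"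

lemma subspace_filt: "subspace (filt c)"
  unfolding filt_def by (auto intro!: subspace_Times subspace_tail)

lemma filt_Suc: "v \<in> filt (Suc c) \<Longrightarrow> v \<in> filt c"
  by (auto simp: filt_def intro: tail_mono)

lemma M_filt: "M x \<in> filt_endo (Suc 0)"
  by (auto simp: filt_endo_def filt_def tail_1 intro: tail_br_Suc)

sublocale nil_filtration filt_endo "Suc N"
proof
  show "subspace (filt_endo n)" for n
    by (auto simp: subspace_def filt_endo_def subspace_0[OF subspace_filt]
        intro: subspace_add[OF subspace_filt] subspace_scale[OF subspace_filt])
  show "x * y \<in> filt_endo (m + n)" if "x \<in> filt_endo m" "y \<in> filt_endo n" for x y m n
    using that unfolding filt_endo_def by (force simp: ac_simps)
  show "x = 0" if "x \<in> filt_endo n" "Suc N \<le> n" for x n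
  proof (rule endo_eqI)
    fix v
    have "\<forall>v\<in>filt 0. app x v \<in> filt (0 + n)"
      using that(1) unfolding filt_endo_def by blast
    then have "app x v \<in> filt n" by (cases v) (simp add: filt_def)
    with that(2) have "app x v = 0"
      by (auto simp: filt_def zero_prod_def dest: tail_zero split: if_splits)
    then show "app x v = app 0 v" by simp
  qed
  show "x \<in> filt_endo n" if "x \<in> filt_endo (Suc n)" for x n
    using that by (auto simp: filt_endo_def intro: filt_Suc)
  show "1 \<in> filt_endo 0"
    by (simp add: filt_endo_def)
  show "2 \<le> Suc N" using N_ge by simp
qed

end

section \<open>The Baker--Campbell--Hausdorff product\<close>

lemma nest_append: "ys \<noteq> [] \<Longrightarrow> nest br (xs @ ys) = foldr br xs (nest br ys)"
proof (induction xs)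
  case (Cons x xs)
  then obtain w ws where "xs @ ys = w # ws" by (cases "xs @ ys") auto
  then have "nest br ((x # xs) @ ys) = br x (nest br (xs @ ys))" by simp
  with Cons show ?case by simp
qed simp

lemma foldr_replicate': "foldr f (replicate n x) w = (f x ^^ n) w"
  by (induction n) auto

definition bch_word :: "'a \<Rightarrow> 'a \<Rightarrow> nat \<times> nat \<Rightarrow> 'a list" where
  "bch_word X Y p = replicate (fst p) X @ replicate (snd p) Y"

definition bch_pairs :: "nat \<Rightarrow> (nat \<times> nat) set" where
  "bch_pairs N = {p. 0 < fst p + snd p \<and> fst p + snd p \<le> N}"

definition bch_lists :: "nat \<Rightarrow> nat \<Rightarrow> (nat \<times> nat) list set" where
  "bch_lists N n = {rs. length rs = n \<and> (\<forall>p\<in>set rs. 0 < fst p + snd p \<and> fst p + snd p \<le> N)}"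

lemma finite_bch_pairs: "finite (bch_pairs N)"
  by (rule finite_subset[of _ "{..N} \<times> {..N}"]) (auto simp: bch_pairs_def)

lemma bch_lists_0: "bch_lists N 0 = {[]}"
  by (auto simp: bch_lists_def)

lemma bch_lists_Suc: "bch_lists N (Suc n) = (\<lambda>(p, rs). p # rs) ` (bch_pairs N \<times> bch_lists N n)"
  by (force simp: bch_lists_def bch_pairs_def length_Suc_conv image_iff)

lemma finite_bch_lists: "finite (bch_lists N n)"
  by (induction n) (auto simp: bch_lists_0 bch_lists_Suc finite_bch_pairs)

lemma sum_bch_lists_Suc:
  "(\<Sum>rs\<in>bch_lists N (Suc n). g rs) = (\<Sum>p\<in>bch_pairs N. \<Sum>rs\<in>bch_lists N n. g (p # rs))"
  unfolding bch_lists_Suc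
  by (subst sum.reindex) (auto simp: inj_on_def sum.cartesian_product case_prod_unfold intro: sum.cong)

lemma length_bch_words: "length (concat (map (bch_word X Y) rs)) = (\<Sum>p\<leftarrow>rs. fst p + snd p)"
  by (induction rs) (auto simp: bch_word_def)

lemma bch_lists_degree: "rs \<in> bch_lists N n \<Longrightarrow> n \<le> (\<Sum>p\<leftarrow>rs. fst p + snd p)"
proof (induction n arbitrary: rs)
  case (Suc n)
  then obtain p qs where "rs = p # qs" "p \<in> bch_pairs N" "qs \<in> bch_lists N n"
    by (auto simp: bch_lists_Suc)
  with Suc.IH[of qs] show ?case by (auto simp: bch_pairs_def)
qed simp

lemma bch_words_nonempty: "rs \<in> bch_lists N (Suc n) \<Longrightarrow> concat (map (bch_word X Y) rs) \<noteq> []"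
  using bch_lists_degree[of rs N "Suc n"] length_bch_words[of X Y rs]
  by (metis list.size(3) not_less_eq_eq zero_le)

abbreviation bch_weight :: "(nat \<times> nat) list \<Rightarrow> real" where
  "bch_weight rs \<equiv> (\<Prod>p\<leftarrow>rs. fact (fst p) * fact (snd p))"

lemma bch_alt:
  "bch br N X Y = (\<Sum>n\<in>{1..N}. \<Sum>rs\<in>bch_lists N n.
     (((-1) ^ (n - 1) / real n) / (real (\<Sum>p\<leftarrow>rs. fst p + snd p) * bch_weight rs))
       *\<^sub>R nest br (concat (map (bch_word X Y) rs)))"
  by (simp add: bch_def bch_lists_def bch_word_def[abs_def])

context graded_algebra
begin

section \<open>Dynkin words sorted by their number of blocks\<close>

lemma nest_scaleR: "nest br (map ((*\<^sub>R) t) xs) = t ^ length xs *\<^sub>R nest br xs"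
  by (induction xs rule: induct_list012) (simp_all add: br_simps)

lemma bch_words_scaleR: "concat (map (bch_word (t *\<^sub>R X) (t *\<^sub>R Y)) rs) = map ((*\<^sub>R) t) (concat (map (bch_word X Y) rs))"
  by (induction rs) (simp_all add: bch_word_def)

text \<open>Dynkin's coefficients without the factor 1/degree and without the weights of the
  logarithm. The former is cancelled by differentiating along (tX, tY); the latter are put back in
  \<open>bch_block_sum\<close>.\<close>

definition bch_block :: "nat \<Rightarrow> 'a \<Rightarrow> 'a \<Rightarrow> 'a" where
  "bch_block n X Y = (\<Sum>rs\<in>bch_lists N n. (1 / bch_weight rs) *\<^sub>R nest br (concat (map (bch_word X Y) rs)))"

abbreviation ead :: "'a \<Rightarrow> 'a \<Rightarrow> 'a" where
  "ead X \<equiv> fcalc (Suc N) (fps_exp 1) (br X)"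

lemma tail_br_words: "(br X ^^ r) ((br Y ^^ s) w) \<in> tail (r + s)"
  using tail_br_funpow[OF tail_br_funpow[OF tail_0[of w], of s Y], of r X] by simp

text \<open>Prepending a block to a word acts by divided powers of ad X and ad Y. Over all pairs
  these sum to e^(ad X) e^(ad Y); the excluded pair \<open>(0, 0)\<close> accounts for
  \<open>- w\<close>, and pairs of degree above \<open>N\<close> act as zero.\<close>

lemma sum_bch_pairs:
  "(\<Sum>p\<in>bch_pairs N. (1 / (fact (fst p) * fact (snd p))) *\<^sub>R (br X ^^ fst p) ((br Y ^^ snd p) w))
    = ead X (ead Y w) - w"
proof -
  let ?g = "\<lambda>p. (1 / (fact (fst p) * fact (snd p))) *\<^sub>R (br X ^^ fst p) ((br Y ^^ snd p) w)"
  have "ead X (ead Y w) = (\<Sum>p\<in>{..N} \<times> {..N}. ?g p)"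
    unfolding fcalc_def
    by (simp add: linear_sum[OF linear_funpow[OF linear_br]] linear_scale[OF linear_funpow[OF linear_br]]
        scaleR_sum_right sum.cartesian_product lessThan_Suc_atMost case_prod_unfold mult.commute)
  also have "\<dots> = (\<Sum>p\<in>insert (0, 0) (bch_pairs N). ?g p)"
  proof (rule sum.mono_neutral_right)
    show "\<forall>p\<in>{..N} \<times> {..N} - insert (0, 0) (bch_pairs N). ?g p = 0"
    proof
      fix p assume "p \<in> {..N} \<times> {..N} - insert (0, 0) (bch_pairs N)"
      then have "N < fst p + snd p" by (cases p) (auto simp: bch_pairs_def)
      then show "?g p = 0" using tail_zero[OF tail_br_words] by simp
    qed
    show "insert (0, 0) (bch_pairs N) \<subseteq> {..N} \<times> {..N}"
      by (auto simp: bch_pairs_def)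
  qed simp
  also have "\<dots> = w + (\<Sum>p\<in>bch_pairs N. ?g p)"
    by (subst sum.insert[OF finite_bch_pairs]) (auto simp: bch_pairs_def)
  finally show ?thesis by simp
qed

text \<open>The recursion starts from one block and not from none, because prefixing letters acts by
  brackets only on a nonempty word.\<close>

lemma bch_block_Suc: "bch_block (Suc (Suc n)) X Y = ead X (ead Y (bch_block (Suc n) X Y)) - bch_block (Suc n) X Y"
proof -
  let ?w = "\<lambda>rs. concat (map (bch_word X Y) rs)"
  have "(1 / bch_weight (p # rs)) *\<^sub>R nest br (?w (p # rs))
      = (1 / (fact (fst p) * fact (snd p))) *\<^sub>R (br X ^^ fst p) ((br Y ^^ snd p) ((1 / bch_weight rs) *\<^sub>R nest br (?w rs)))"
    if "rs \<in> bch_lists N (Suc n)" for p rs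
    using bch_words_nonempty[OF that, of X Y]
    by (simp add: nest_append bch_word_def foldr_replicate' linear_scale[OF linear_funpow[OF linear_br]])
  then have "bch_block (Suc (Suc n)) X Y = (\<Sum>p\<in>bch_pairs N. \<Sum>rs\<in>bch_lists N (Suc n).
      (1 / (fact (fst p) * fact (snd p))) *\<^sub>R (br X ^^ fst p) ((br Y ^^ snd p) ((1 / bch_weight rs) *\<^sub>R nest br (?w rs))))"
    unfolding bch_block_def sum_bch_lists_Suc[of _ N "Suc n"] by (intro sum.cong refl) simp
  also have "\<dots> = (\<Sum>p\<in>bch_pairs N. (1 / (fact (fst p) * fact (snd p))) *\<^sub>R
      (br X ^^ fst p) ((br Y ^^ snd p) (bch_block (Suc n) X Y)))"
    by (simp add: bch_block_def linear_sum[OF linear_funpow[OF linear_br]] scaleR_sum_right)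
  finally show ?thesis by (simp add: sum_bch_pairs)
qed

lemma nest_replicate: "2 \<le> n \<Longrightarrow> nest br (replicate n X) = 0"
proof (induction n rule: dec_induct)
  case base
  then show ?case by (simp add: numeral_2_eq_2)
next
  case (step n)
  then obtain m where "n = Suc m" by (cases n) auto
  with step show ?case by (simp add: br_simps)
qed

text \<open>The end of the block is its innermost bracket; two equal letters there give [Z,Z] = 0,
  so only blocks ending in a single \<open>Y\<close>, or the single letter \<open>X\<close>,
  survive.\<close>

lemma nest_bch_word:
  "nest br (bch_word X Y (r, s)) = (if s = 1 then (br X ^^ r) Y else if s = 0 \<and> r = 1 then X else 0)"
proof (cases "s = 0")
  case True
  then show ?thesis
    using nest_replicate[of r X] by (cases r) (auto simp: bch_word_def)
next
  case False
  then have "nest br (bch_word X Y (r, s)) = (br X ^^ r) (nest br (replicate s Y))"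
    by (simp add: bch_word_def nest_append foldr_replicate')
  with False show ?thesis
    using nest_replicate[of s Y] linear_0[OF linear_funpow[OF linear_br]] by (cases "s = 1") auto
qed

lemma bch_block_1: "bch_block (Suc 0) X Y = X + ead X Y"
proof -
  let ?g = "\<lambda>p. (1 / (fact (fst p) * fact (snd p))) *\<^sub>R nest br (bch_word X Y p)"
  have "bch_block (Suc 0) X Y = (\<Sum>p\<in>bch_pairs N. ?g p)"
    by (simp add: bch_block_def sum_bch_lists_Suc bch_lists_0)
  also have "\<dots> = (\<Sum>p\<in>insert (1, 0) ((\<lambda>r. (r, 1)) ` {..<N}). ?g p)"
    using N_ge by (intro sum.mono_neutral_right finite_bch_pairs)
      (auto simp: bch_pairs_def nest_bch_word split: if_splits)
  also have "\<dots> = X + (\<Sum>r<N. (1 / fact r) *\<^sub>R (br X ^^ r) Y)"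
    by (subst sum.insert) (auto simp: sum.reindex inj_on_def nest_bch_word)
  \<comment> \<open>\<open>ead\<close> contains one further term, r = N, which vanishes because
    \<open>Y\<close> itself already has degree one.\<close>
  also have "(\<Sum>r<N. (1 / fact r) *\<^sub>R (br X ^^ r) Y) = ead X Y"
    using tail_zero[OF tail_br_funpow[OF tail_1[of Y], of N X]] by (simp add: fcalc_def)
  finally show ?thesis .
qed

lemma bch_block_funpow:
  "bch_block (Suc k) X Y = ((\<lambda>w. ead X (ead Y w) - w) ^^ k) (X + ead X Y)"
  by (induction k) (simp_all add: bch_block_1 bch_block_Suc)

lemma ead_minus_id_tail: "w \<in> tail c \<Longrightarrow> ead X (ead Y w) - w \<in> tail (Suc c)"
  unfolding sum_bch_pairs[symmetric]
  by (intro subspace_sum subspace_tail subspace_scale[OF subspace_tail])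
     (auto simp: bch_pairs_def intro!: tail_mono[OF tail_br_funpow[OF tail_br_funpow]])

lemma linear_ead: "linear (ead X)"
  by (intro linear_fcalc linear_br)

text \<open>\<open>bch_block n\<close> is the (n-1)-st power of e^(ad X) e^(ad Y) - 1 at X + e^(ad
  X) Y, so the weights (-1)^(n-1)/n assemble ln(1+w)/w. Here Dynkin's sum takes the shape of the
  right-hand side found for the logarithm of e^(tX) e^(tY).\<close>

lemma bch_block_sum:
  "(\<Sum>n=1..N. ((-1) ^ (n - 1) / real n) *\<^sub>R bch_block n X Y)
    = fcalc (Suc N) fps_lnquot (\<lambda>w. ead X (ead Y w) - w) (X + ead X Y)"
proof -
  let ?B = "\<lambda>w. ead X (ead Y w) - w"
  have "(?B ^^ k) (X + ead X Y) \<in> tail (Suc k)" for k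
    by (induction k) (auto simp: tail_1 intro: ead_minus_id_tail)
  then have zero: "(?B ^^ N) (X + ead X Y) = 0"
    using tail_zero by blast
  have "(\<Sum>n=1..N. ((-1) ^ (n - 1) / real n) *\<^sub>R bch_block n X Y)
      = (\<Sum>k<N. ((-1) ^ k / real (Suc k)) *\<^sub>R bch_block (Suc k) X Y)"
    by (rule sum.reindex_bij_witness[of _ Suc "\<lambda>n. n - 1"]) auto
  also have "\<dots> = fcalc (Suc N) fps_lnquot ?B (X + ead X Y)"
    using zero by (simp add: fcalc_def fps_lnquot_def bch_block_funpow)
  finally show ?thesis .
qed

lemma bch_scaleR:
  "bch br N (t *\<^sub>R X) (t *\<^sub>R Y) = (\<Sum>n\<in>{1..N}. \<Sum>rs\<in>bch_lists N n. t ^ (\<Sum>p\<leftarrow>rs. fst p + snd p) *\<^sub>R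
     ((((-1) ^ (n - 1) / real n) / (real (\<Sum>p\<leftarrow>rs. fst p + snd p) * bch_weight rs))
       *\<^sub>R nest br (concat (map (bch_word X Y) rs))))"
  unfolding bch_alt bch_words_scaleR nest_scaleR length_bch_words by (simp add: mult.commute)

lemma bch_block_scaleR:
  "bch_block n (t *\<^sub>R X) (t *\<^sub>R Y) = (\<Sum>rs\<in>bch_lists N n. t ^ (\<Sum>p\<leftarrow>rs. fst p + snd p) *\<^sub>R
     ((1 / bch_weight rs) *\<^sub>R nest br (concat (map (bch_word X Y) rs))))"
  unfolding bch_block_def bch_words_scaleR nest_scaleR length_bch_words by (simp add: mult.commute)

text \<open>Differentiating t^m gives m/t times t^m, and m cancels Dynkin's factor 1/m. The
  remaining 1/t cancels the t that X and Y bring into the block sum; carrying it confines the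
  argument to nonzero \<open>t\<close>.\<close>

lemma bch_ode:
  assumes "t \<noteq> 0"
  shows "((\<lambda>t. bch br N (t *\<^sub>R X) (t *\<^sub>R Y)) has_vector_derivative
    fcalc (Suc N) fps_lnquot (\<lambda>w. ead (t *\<^sub>R X) (ead (t *\<^sub>R Y) w) - w) (X + ead (t *\<^sub>R X) Y)) (at t)"
    (is "(_ has_vector_derivative ?D) _")
proof -
  let ?B = "\<lambda>w. ead (t *\<^sub>R X) (ead (t *\<^sub>R Y) w) - w"
  let ?m = "\<lambda>rs :: (nat \<times> nat) list. \<Sum>p\<leftarrow>rs. fst p + snd p"
  let ?v = "\<lambda>rs. nest br (concat (map (bch_word X Y) rs))"
  let ?c = "\<lambda>n rs. (((-1) ^ (n - 1) / real n) / (real (?m rs) * bch_weight rs)) *\<^sub>R ?v rs"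
  have "((\<lambda>t. t ^ m *\<^sub>R c) has_vector_derivative (1 / t) *\<^sub>R (t ^ m *\<^sub>R (real m *\<^sub>R c))) (at t)"
    for m and c :: 'a
  proof -
    have "((\<lambda>t. t ^ m) has_vector_derivative real m * t ^ (m - 1)) (at t)"
      using DERIV_pow[of m t] by (simp add: has_real_derivative_iff_has_vector_derivative)
    moreover have "real m * t ^ (m - 1) = (1 / t) * (t ^ m * real m)"
      using assms by (cases m) auto
    ultimately show ?thesis
      using bounded_linear.has_vector_derivative[OF bounded_linear_scaleR_left] by fastforce
  qed
  then have "((\<lambda>t. bch br N (t *\<^sub>R X) (t *\<^sub>R Y)) has_vector_derivative
      (\<Sum>n\<in>{1..N}. \<Sum>rs\<in>bch_lists N n. (1 / t) *\<^sub>R (t ^ ?m rs *\<^sub>R (real (?m rs) *\<^sub>R ?c n rs)))) (at t)"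
    unfolding bch_scaleR by (intro has_vector_derivative_sum) blast
  moreover have "real (?m rs) *\<^sub>R ?c n rs = ((-1) ^ (n - 1) / real n) *\<^sub>R ((1 / bch_weight rs) *\<^sub>R ?v rs)"
    if "n \<in> {1..N}" "rs \<in> bch_lists N n" for n rs
  proof -
    have "?m rs \<noteq> 0" using bch_lists_degree[OF that(2)] that(1) by (metis atLeastAtMost_iff le_zero_eq not_one_le_zero)
    moreover have "real m *\<^sub>R ((a / (real m * b)) *\<^sub>R v) = a *\<^sub>R ((1 / b) *\<^sub>R v)"
      if "m \<noteq> 0" for m a b and v :: 'a
      using that by simp
    ultimately show ?thesis by blast
  qed
  then have "(\<Sum>n\<in>{1..N}. \<Sum>rs\<in>bch_lists N n. (1 / t) *\<^sub>R (t ^ ?m rs *\<^sub>R (real (?m rs) *\<^sub>R ?c n rs)))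
      = (\<Sum>n\<in>{1..N}. \<Sum>rs\<in>bch_lists N n. (1 / t) *\<^sub>R (t ^ ?m rs *\<^sub>R
          (((-1) ^ (n - 1) / real n) *\<^sub>R ((1 / bch_weight rs) *\<^sub>R ?v rs))))"
    by (intro sum.cong refl) (simp only:)
  also have "\<dots> = (1 / t) *\<^sub>R (\<Sum>n=1..N. ((-1) ^ (n - 1) / real n) *\<^sub>R bch_block n (t *\<^sub>R X) (t *\<^sub>R Y))"
    by (simp add: bch_block_scaleR scaleR_sum_right mult.left_commute mult.commute)
  also have "\<dots> = (1 / t) *\<^sub>R fcalc (Suc N) fps_lnquot ?B (t *\<^sub>R (X + ead (t *\<^sub>R X) Y))"
    by (simp only: bch_block_sum linear_scale[OF linear_ead] scaleR_right_distrib)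
  also have "\<dots> = ?D"
  proof -
    have "linear ?B"
      using linear_compose[OF linear_ead linear_ead, of "t *\<^sub>R X" "t *\<^sub>R Y"]
      by (intro linear_compose_sub) (auto simp: comp_def linear_id[unfolded id_def])
    with assms show ?thesis
      by (simp add: linear_scale[OF linear_fcalc])
  qed
  ultimately show ?thesis by simp
qed

lemma M_fcalc: "M (fcalc (Suc N) g (br X) w) = fcalc (Suc N) g (ad (M X)) (M w)"
  by (rule fcalc_intertwine[where M = M and T = "br X" and S = "ad (M X)", OF linear_M M_br])

lemma bch_zero_zero: "bch br N 0 0 = 0"
  unfolding bch_alt
proof (intro sum.neutral ballI)
  fix n rs assume n: "n \<in> {1..N}" and rs: "rs \<in> bch_lists N n"
  then have "0 < (\<Sum>p\<leftarrow>rs. fst p + snd p)"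
    using bch_lists_degree[OF rs] by (metis atLeastAtMost_iff gr0I le_zero_eq not_one_le_zero)
  then have "nest br (concat (map (bch_word 0 0) rs)) = 0"
    using nest_scaleR[of 0 "concat (map (bch_word 0 0) rs)"] bch_words_scaleR[of 0 "0 :: 'a" 0 rs]
    by (simp only: length_bch_words zero_power scaleR_zero_left scaleR_zero_right)
  then show "((- 1) ^ (n - 1) / real n / (real (\<Sum>p\<leftarrow>rs. fst p + snd p) * bch_weight rs)) *\<^sub>R
      nest br (concat (map (bch_word 0 0) rs)) = 0" by simp
qed

theorem exp_M_bch: "exp (M (bch br N X Y)) = exp (M X) * exp (M Y)"
proof -
  define c where "c = (\<lambda>t. bch br N (t *\<^sub>R X) (t *\<^sub>R Y))"
  define z where "z = (\<lambda>t. nlog (exp (t *\<^sub>R M X) * exp (t *\<^sub>R M Y) - 1))"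
  note [simp] = linear_scale[OF linear_M] linear_add[OF linear_M] linear_diff[OF linear_M]
  have z': "(z has_vector_derivative fcalc (Suc N) fps_lnquot
     (\<lambda>w. fcalc (Suc N) (fps_exp 1) (ad (t *\<^sub>R M X)) (fcalc (Suc N) (fps_exp 1) (ad (t *\<^sub>R M Y)) w) - w)
     (M X + fcalc (Suc N) (fps_exp 1) (ad (t *\<^sub>R M X)) (M Y))) (at t)"
    and zJ: "exp (t *\<^sub>R M X) * exp (t *\<^sub>R M Y) - 1 \<in> filt_endo (Suc 0)" for t
    unfolding z_def by (rule nlog_has_vector_derivative; rule M_filt)+
  have M: "bounded_linear M" by (simp add: linear_M linear_conv_bounded_linear[symmetric])
  have c': "((\<lambda>t. M (c t)) has_vector_derivative fcalc (Suc N) fps_lnquot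
     (\<lambda>w. fcalc (Suc N) (fps_exp 1) (ad (t *\<^sub>R M X)) (fcalc (Suc N) (fps_exp 1) (ad (t *\<^sub>R M Y)) w) - w)
     (M X + fcalc (Suc N) (fps_exp 1) (ad (t *\<^sub>R M X)) (M Y))) (at t)" if "t \<noteq> 0" for t
  proof -
    have "M (fcalc (Suc N) fps_lnquot (\<lambda>w. ead (t *\<^sub>R X) (ead (t *\<^sub>R Y) w) - w) (X + ead (t *\<^sub>R X) Y))
      = fcalc (Suc N) fps_lnquot
     (\<lambda>w. fcalc (Suc N) (fps_exp 1) (ad (t *\<^sub>R M X)) (fcalc (Suc N) (fps_exp 1) (ad (t *\<^sub>R M Y)) w) - w)
     (M (X + ead (t *\<^sub>R X) Y))"
      by (rule fcalc_intertwine[OF linear_M]) (simp add: M_fcalc)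
    then show ?thesis
      using bounded_linear.has_vector_derivative[OF M bch_ode[OF that, of X Y]]
      by (simp add: M_fcalc c_def)
  qed
  have "M (c 1) - z 1 = 0"
  \<comment> \<open>The exceptional set \<open>{0}\<close> is where \<open>bch_ode\<close> gives no
    derivative; continuity bridges it.\<close>
  proof (rule has_derivative_zero_unique_strong_interval[of "{0}" 0 1 "\<lambda>t. M (c t) - z t"])
    have "continuous_on {0..1} c"
      unfolding c_def bch_scaleR by (intro continuous_intros)
    moreover have "continuous_on {0..1} z"
      using z' by (meson continuous_at_imp_continuous_on has_vector_derivative_continuous)
    ultimately show "continuous_on {0..1} (\<lambda>t. M (c t) - z t)"
      by (intro continuous_on_diff bounded_linear.continuous_on[OF M])
    show "M (c 0) - z 0 = 0"
      using nlog_exp[OF subspace_0[OF J_subspace]]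
      by (simp add: c_def z_def bch_zero_zero linear_0[OF linear_M])
    show "((\<lambda>t. M (c t) - z t) has_derivative (\<lambda>h. 0)) (at x within {0..1})" if "x \<in> {0..1} - {0}" for x
      using has_vector_derivative_diff[OF c' z', of x] that
      by (auto simp: has_vector_derivative_def intro: has_derivative_at_withinI)
  qed auto
  then have "M (bch br N X Y) = nlog (exp (M X) * exp (M Y) - 1)"
    by (simp add: c_def z_def)
  then show ?thesis
    using exp_nlog[OF zJ[of 1]] by simp
qed

end

section \<open>Group laws in exponential coordinates\<close>

text \<open>The series of $(1-e^{-z})/z$.\<close>
definition fps_phi :: "real fps" where
  "fps_phi = Abs_fps (\<lambda>n. (-1) ^ n / fact (Suc n))"

lemma fps_exp_phi: "fps_exp 1 * fps_phi = fps_expquot"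
proof -
  have *: "fps_phi * fps_X = 1 - fps_exp (-1)"
  proof (rule fps_ext)
    fix n show "fps_nth (fps_phi * fps_X) n = fps_nth (1 - fps_exp (-1)) n"
      by (cases n) (simp_all add: fps_phi_def field_simps)
  qed
  have "(fps_exp 1 * fps_phi) * fps_X = fps_exp 1 - fps_exp 1 * fps_exp (-1)"
    by (simp add: mult.assoc * right_diff_distrib)
  also have "\<dots> = fps_expquot * fps_X"
    by (simp add: fps_exp_add_mult[symmetric] fps_expquot_X)
  finally show ?thesis
    by (metis fps_X_neq_zero mult_right_cancel)
qed

text \<open>Conjugation is multiplicative, so it passes through powers and the truncated
  exponential. The conjugate stays in \<open>J (Suc 0)\<close>, hence the same truncation applies to
  it.\<close>

lemma (in nil_filtration) exp_conj_exp:
  assumes Z: "Z \<in> J (Suc 0)" and W: "W \<in> J (Suc 0)"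
  shows "exp Z * exp W * exp (- Z) = exp (exp Z * W * exp (- Z))"
proof -
  have inv: "exp (- Z) * exp Z = 1"
    using exp_minus_inverse[of "- Z"] by simp
  have power: "(exp Z * W * exp (- Z)) ^ k = exp Z * W ^ k * exp (- Z)" for k
  proof (induction k)
    case (Suc k)
    have "(exp Z * W * exp (- Z)) ^ Suc k = (exp Z * W * exp (- Z)) * (exp Z * W ^ k * exp (- Z))"
      by (simp only: power_Suc Suc)
    also have "\<dots> = exp Z * W * (exp (- Z) * exp Z) * W ^ k * exp (- Z)"
      by (simp only: mult.assoc)
    finally show ?case by (simp add: inv mult.assoc)
  qed (simp add: exp_minus_inverse)
  have "exp Z * W * exp (- Z) \<in> J (Suc 0)"
    unfolding exp_conj[OF Z J_mono[OF W, of 0, simplified]] by (rule J_fcalc_ad[OF Z W])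
  then show ?thesis
    by (simp add: exp_eq_fcalc[OF W] exp_eq_fcalc fcalc_def times_funpow power sum_distrib_left
        sum_distrib_right)
qed

context graded_algebra
begin

section \<open>Group axioms and conjugation\<close>

abbreviation mul :: "'a \<Rightarrow> 'a \<Rightarrow> 'a" where "mul \<equiv> bch br N"

lemmas M_simps = linear_scale[OF linear_M] linear_add[OF linear_M] linear_diff[OF linear_M]
  linear_neg[OF linear_M] linear_0[OF linear_M]

text \<open>The logarithm recovers \<open>M x\<close>, and \<open>M\<close> is injective. Group
  identities are therefore checked after applying \<open>M\<close> and \<open>exp\<close>, where
  \<open>mul\<close> is associative multiplication.\<close>

lemma exp_M_inj: "exp (M x) = exp (M y) \<Longrightarrow> x = y"
  by (metis M_inj M_filt nlog_exp)

lemma mul_assoc: "mul (mul x y) z = mul x (mul y z)"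
  by (rule exp_M_inj) (simp add: exp_M_bch mult.assoc)

lemma mul_0 [simp]: "mul 0 y = y" "mul x 0 = x"
  by (rule exp_M_inj; simp add: exp_M_bch M_simps)+

lemma mul_minus_right [simp]: "mul x (- x) = 0"
  by (rule exp_M_inj) (simp add: exp_M_bch M_simps exp_minus_inverse)

lemma mul_minus_left [simp]: "mul (- x) x = 0"
  using mul_minus_right[of "- x"] by simp

lemma mul_cancel [simp]: "mul (- x) (mul x y) = y" "mul x (mul (- x) y) = y"
  by (simp_all add: mul_assoc[symmetric])

lemma minus_mul: "- mul x y = mul (- y) (- x)"
proof -
  have "mul (- y) (- x) = mul (- mul x y) (mul (mul x y) (mul (- y) (- x)))" by simp
  also have "mul (mul x y) (mul (- y) (- x)) = mul x (mul (mul y (- y)) (- x))"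
    by (simp only: mul_assoc)
  finally show ?thesis by simp
qed

lemma mul_scaleR_same: "mul (s *\<^sub>R x) (t *\<^sub>R x) = (s + t) *\<^sub>R x"
  by (rule exp_M_inj) (simp add: exp_M_bch M_simps scaleR_left_distrib exp_add_commuting)

lemma mul_conj: "mul (mul x y) (- x) = ead x y"
proof (rule exp_M_inj)
  have "exp (M (mul (mul x y) (- x))) = exp (exp (M x) * M y * exp (- M x))"
    by (simp add: exp_M_bch M_simps exp_conj_exp[OF M_filt M_filt])
  then show "exp (M (mul (mul x y) (- x))) = exp (M (ead x y))"
    by (simp add: exp_conj[OF M_filt J_mono[OF M_filt]] M_fcalc)
qed

text \<open>The innermost bracket of a word in two letters is [x,y] up to sign, or zero, and outer
  brackets do not leave \<open>tail c\<close>.\<close>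

lemma nest_tail:
  assumes "br x y \<in> tail c"
  shows "set zs \<subseteq> {x, y} \<Longrightarrow> 2 \<le> length zs \<Longrightarrow> nest br zs \<in> tail c"
proof (induction zs rule: induct_list012)
  case (3 a b zs)
  show ?case
  proof (cases "zs = []")
    case True
    have "br y x \<in> tail c" using br_anti[of y x] subspace_neg[OF subspace_tail assms] by simp
    with True 3(3) assms subspace_0[OF subspace_tail] show ?thesis by auto
  next
    case False
    then have "nest br (b # zs) \<in> tail c" using 3 by (cases zs) auto
    then show ?thesis by (auto intro: tail_mono[OF tail_br_Suc])
  qed
qed auto

text \<open>Apart from the two one-letter words every Dynkin term has at least two letters. Thus the
  product is addition up to the depth of the commutator, which underlies the computations layer by
  layer.\<close>

lemma mul_tail:
  assumes "br x y \<in> tail c"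
  shows "mul x y - x - y \<in> tail c"
proof -
  let ?f = "\<lambda>n rs. (((-1) ^ (n - 1) / real n) / (real (\<Sum>p\<leftarrow>rs. fst p + snd p) * bch_weight rs))
       *\<^sub>R nest br (concat (map (bch_word x y) rs))"
  have big: "?f n rs \<in> tail c" if "2 \<le> (\<Sum>p\<leftarrow>rs. fst p + snd p)" for n rs
    by (intro subspace_scale[OF subspace_tail] nest_tail[OF assms])
       (use that in \<open>auto simp: bch_word_def length_bch_words[symmetric, of _ x y] simp del: length_concat\<close>)
  have e1: "mul x y = (\<Sum>rs\<in>bch_lists N 1. ?f 1 rs) + (\<Sum>n\<in>{2..N}. \<Sum>rs\<in>bch_lists N n. ?f n rs)"
    unfolding bch_alt using N_ge sum.atLeast_Suc_atMost[of 1 N "\<lambda>n. \<Sum>rs\<in>bch_lists N n. ?f n rs"]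
    by (simp only: numeral_2_eq_2 One_nat_def)
  have r2: "(\<Sum>n\<in>{2..N}. \<Sum>rs\<in>bch_lists N n. ?f n rs) \<in> tail c"
    by (intro subspace_sum subspace_tail big) (use bch_lists_degree in force)
  have e2: "(\<Sum>rs\<in>bch_lists N 1. ?f 1 rs) = (\<Sum>p\<in>bch_pairs N. ?f 1 [p])"
    by (simp add: sum_bch_lists_Suc bch_lists_0)
  have e3: "(\<Sum>p\<in>bch_pairs N. ?f 1 [p])
      = (\<Sum>p\<in>bch_pairs N - {(1,0),(0,1)}. ?f 1 [p]) + (\<Sum>p\<in>{(1,0),(0,1)}. ?f 1 [p])"
    using N_ge by (intro sum.subset_diff finite_bch_pairs) (auto simp: bch_pairs_def)
  have e4: "(\<Sum>p\<in>{(1,0),(0,1)}. ?f 1 [p]) = x + y"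
    by (simp add: bch_word_def)
  have r1: "(\<Sum>p\<in>bch_pairs N - {(1,0),(0,1)}. ?f 1 [p]) \<in> tail c"
  proof (intro subspace_sum subspace_tail big)
    fix p assume "p \<in> bch_pairs N - {(1, 0), (0, 1)}"
    then have "0 < fst p + snd p" "\<not> (fst p = 1 \<and> snd p = 0)" "\<not> (fst p = 0 \<and> snd p = 1)"
      by (auto simp: bch_pairs_def prod_eq_iff)
    then have "2 \<le> fst p + snd p" by linarith
    then show "2 \<le> (\<Sum>p\<leftarrow>[p]. fst p + snd p)" by simp
  qed
  have "a + (x + y) + b - x - y = a + b" for a b :: 'a by simp
  then show ?thesis
    unfolding e1 e2 e3 e4 using subspace_add[OF subspace_tail r1 r2] by (simp only:)
qed

lemma tail_mul: "x \<in> tail c \<Longrightarrow> y \<in> tail c \<Longrightarrow> mul x y \<in> tail c"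
proof -
  assume x: "x \<in> tail c" and y: "y \<in> tail c"
  have "mul x y - x - y \<in> tail c"
    by (rule mul_tail) (use tail_br[OF x y] in \<open>auto intro: tail_mono\<close>)
  from subspace_add[OF subspace_tail this subspace_add[OF subspace_tail x y]]
  show ?thesis by simp
qed

lemma proj_mul_tail: "x \<in> tail c \<Longrightarrow> y \<in> tail c \<Longrightarrow> 1 \<le> c \<Longrightarrow> P c (mul x y) = P c x + P c y"
proof -
  assume x: "x \<in> tail c" and y: "y \<in> tail c" and c: "1 \<le> c"
  have "mul x y - x - y \<in> tail (Suc c)"
    by (rule mul_tail) (use tail_br[OF x y] c in \<open>auto intro: tail_mono\<close>)
  then show ?thesis
    by (simp add: tail_def proj_simps algebra_simps)
qed

lemma proj_1_mul: "P 1 (mul x y) = P 1 x + P 1 y"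
  using proj_mul_tail[OF tail_1 tail_1] by simp

subsection \<open>Dilations\<close>

abbreviation dl :: "real \<Rightarrow> 'a \<Rightarrow> 'a" where "dl \<equiv> dil V N"

lemma linear_dil: "linear (dl r)"
  unfolding dil_def
  by (intro linear_compose_sum ballI linear_compose_scale_right linear_proj)

lemma proj_dil: "P i (dl r x) = r ^ i *\<^sub>R P i x"
  by (cases "i \<in> {1..N}")
     (auto simp: dil_def proj_simps proj_proj proj_out if_distrib[of "\<lambda>x. _ *\<^sub>R x"] cong: if_cong)

lemma dil_V: "j \<in> {1..N} \<Longrightarrow> x \<in> V j \<Longrightarrow> dl r x = r ^ j *\<^sub>R x"
  by (rule proj_eqI) (auto simp: proj_dil proj_simps proj_V)

lemma dil_dil: "dl r (dl s x) = dl (r * s) x"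
  by (rule proj_eqI) (simp add: proj_dil power_mult_distrib)

lemma dil_1 [simp]: "dl 1 x = x"
  by (rule proj_eqI) (simp add: proj_dil)

lemma dil_inverse: "r \<noteq> 0 \<Longrightarrow> dl (1 / r) (dl r x) = x" "r \<noteq> 0 \<Longrightarrow> dl r (dl (1 / r) x) = x"
  by (simp_all add: dil_dil)

lemma dil_0 [simp]: "dl r 0 = 0"
  by (rule linear_0[OF linear_dil])

lemma dil_br: "dl r (br x y) = br (dl r x) (dl r y)"
proof (rule proj_eqI)
  fix k
  show "P k (dl r (br x y)) = P k (br (dl r x) (dl r y))"
    unfolding proj_dil proj_br scaleR_sum_right
    by (intro sum.cong refl) (auto simp: br_simps power_add)
qed

lemma dil_nest: "nest br (map (dl r) zs) = dl r (nest br zs)"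
  by (induction zs rule: induct_list012) (simp_all add: dil_br)

lemma dil_mul: "dl r (mul x y) = mul (dl r x) (dl r y)"
proof -
  have "concat (map (bch_word (dl r x) (dl r y)) rs) = map (dl r) (concat (map (bch_word x y) rs))" for rs
    by (induction rs) (simp_all add: bch_word_def)
  then show ?thesis
    unfolding bch_alt
    by (simp only: dil_nest linear_sum[OF linear_dil] linear_scale[OF linear_dil])
qed

subsection \<open>Smoothness of the product\<close>

lemma bounded_bilinear_br: "bounded_bilinear br"
  using bil by (simp add: bilinear_conv_bounded_bilinear)

lemma continuous_on_nest:
  "(\<And>f. f \<in> set fs \<Longrightarrow> continuous_on S f) \<Longrightarrow> continuous_on S (\<lambda>z. nest br (map (\<lambda>f. f z) fs))"
  by (induction fs rule: induct_list012)
     (auto intro!: bounded_bilinear.continuous_on[OF bounded_bilinear_br])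

lemma differentiable_nest:
  "(\<And>f. f \<in> set fs \<Longrightarrow> f differentiable (at z within S)) \<Longrightarrow>
    (\<lambda>z. nest br (map (\<lambda>f. f z) fs)) differentiable (at z within S)"
proof (induction fs rule: induct_list012)
  case (3 f g fs)
  then have "f differentiable (at z within S)"
    "(\<lambda>z. nest br (map (\<lambda>f. f z) (g # fs))) differentiable (at z within S)" by auto
  then show ?case
    unfolding differentiable_def by (auto dest: bounded_bilinear.FDERIV[OF bounded_bilinear_br])
qed auto

lemma bch_words_fun: "concat (map (bch_word (f z) (g z)) rs) = map (\<lambda>h. h z) (concat (map (bch_word f g) rs))"
  by (induction rs) (simp_all add: bch_word_def)

lemma set_bch_words: "h \<in> set (concat (map (bch_word f g) rs)) \<Longrightarrow> h = f \<or> h = g"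
  by (auto simp: bch_word_def)

lemma continuous_on_mul [continuous_intros]:
  "continuous_on S f \<Longrightarrow> continuous_on S g \<Longrightarrow> continuous_on S (\<lambda>z. mul (f z) (g z))"
  unfolding bch_alt bch_words_fun[of f _ g]
  by (intro continuous_intros continuous_on_nest) (auto dest!: set_bch_words simp del: set_concat)

lemma differentiable_mul:
  "f differentiable (at z within S) \<Longrightarrow> g differentiable (at z within S) \<Longrightarrow>
    (\<lambda>z. mul (f z) (g z)) differentiable (at z within S)"
  unfolding bch_alt bch_words_fun[of f _ g]
  by (intro differentiable_sum finite_atLeastAtMost finite_bch_lists ballI differentiable_scaleR
      differentiable_const differentiable_nest) (auto dest!: set_bch_words simp del: set_concat)

lemma continuous_on_fcalc [continuous_intros]:
  assumes "continuous_on S p" "continuous_on S w"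
  shows "continuous_on S (\<lambda>z. fcalc K g (br (p z)) (w z))"
proof -
  have "continuous_on S (\<lambda>z. (br (p z) ^^ k) (w z))" for k
    by (induction k) (auto intro!: assms bounded_bilinear.continuous_on[OF bounded_bilinear_br])
  then show ?thesis
    unfolding fcalc_def by (intro continuous_intros)
qed

subsection \<open>Left logarithmic derivatives\<close>

text \<open>\<open>Phi p v\<close> is the vector of the Lie algebra whose left invariant field has the value \<open>v\<close>
  at \<open>p\<close>, and \<open>Psi p\<close> is the inverse map.\<close>

definition Phi :: "'a \<Rightarrow> 'a \<Rightarrow> 'a" where
  "Phi p = fcalc (Suc N) fps_phi (br p)"

definition Psi :: "'a \<Rightarrow> 'a \<Rightarrow> 'a" where
  "Psi p = fcalc (Suc N) (inverse fps_phi) (br p)"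

lemma Phi_Psi: "Phi p (Psi p w) = w" and Psi_Phi: "Psi p (Phi p w) = w"
proof -
  have "fps_nth fps_phi 0 \<noteq> 0" by (simp add: fps_phi_def)
  then have "inverse fps_phi * fps_phi = 1" "fps_phi * inverse fps_phi = 1"
    using inverse_mult_eq_1[of fps_phi] by (simp_all add: mult.commute)
  then show "Phi p (Psi p w) = w" "Psi p (Phi p w) = w"
    unfolding Phi_def Psi_def
    by (simp_all only: fcalc_mult[OF linear_br br_nilpotent, symmetric] fcalc_1[OF linear_br zero_less_Suc])
qed

lemma linear_Psi: "linear (Psi p)"
  unfolding Psi_def by (intro linear_fcalc linear_br)

lemma Phi_0: "Phi 0 v = v"
proof -
  have "(br 0 ^^ k) v = (if k = 0 then v else 0)" for k
    by (cases k) (auto simp: br_simps)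
  then show ?thesis
    by (simp add: Phi_def fcalc_def if_distrib[of "\<lambda>x. _ *\<^sub>R x"] fps_phi_def cong: if_cong)
qed

lemma ead_Phi: "ead p (Phi p v) = fcalc (Suc N) fps_expquot (br p) v"
  unfolding Phi_def by (simp only: fcalc_mult[OF linear_br br_nilpotent, symmetric] fps_exp_phi)

text \<open>The general derivative formula has its factor to the left of the exponential. Moving it
  to the right conjugates it and turns (e^z - 1)/z into (1 - e^(-z))/z; so \<open>Phi\<close>
  computes the left logarithmic derivative.\<close>

lemma exp_M_has_vector_derivative:
  assumes "(\<gamma> has_vector_derivative v) (at t)"
  shows "((\<lambda>t. exp (M (\<gamma> t))) has_vector_derivative exp (M (\<gamma> t)) * M (Phi (\<gamma> t) v)) (at t)"
proof -
  have M: "bounded_linear M" by (simp add: linear_M linear_conv_bounded_linear[symmetric])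
  have "((\<lambda>t. exp (M (\<gamma> t))) has_vector_derivative
      fcalc (Suc N) fps_expquot (ad (M (\<gamma> t))) (M v) * exp (M (\<gamma> t))) (at t)"
    by (rule exp_has_vector_derivative[OF M_filt M_filt])
       (rule bounded_linear.has_vector_derivative[OF M assms])
  moreover have "fcalc (Suc N) fps_expquot (ad (M (\<gamma> t))) (M v) * exp (M (\<gamma> t))
      = exp (M (\<gamma> t)) * M (Phi (\<gamma> t) v) * (exp (- M (\<gamma> t)) * exp (M (\<gamma> t)))"
    by (simp add: M_fcalc[symmetric] ead_Phi[symmetric])
       (simp add: M_fcalc exp_conj[OF M_filt J_mono[OF M_filt], symmetric] mult.assoc)
  moreover have "exp (- M (\<gamma> t)) * exp (M (\<gamma> t)) = 1"
    using exp_minus_inverse[of "- M (\<gamma> t)"] by simp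
  ultimately show ?thesis by simp
qed

text \<open>The constant left factor \<open>exp (M p)\<close> cancels from the left logarithmic
  derivative.\<close>

lemma Phi_left_translate:
  assumes \<gamma>: "(\<gamma> has_vector_derivative v) (at t)"
    and \<beta>: "((\<lambda>t. mul p (\<gamma> t)) has_vector_derivative w) (at t)"
  shows "Phi (mul p (\<gamma> t)) w = Phi (\<gamma> t) v"
proof -
  have "((\<lambda>t. exp (M p) * exp (M (\<gamma> t))) has_vector_derivative
      exp (M p) * (exp (M (\<gamma> t)) * M (Phi (\<gamma> t) v))) (at t)"
    by (intro bounded_linear.has_vector_derivative[OF bounded_linear_mult_right]
        exp_M_has_vector_derivative \<gamma>)
  moreover have "((\<lambda>t. exp (M p) * exp (M (\<gamma> t))) has_vector_derivative
      exp (M p) * (exp (M (\<gamma> t)) * M (Phi (mul p (\<gamma> t)) w))) (at t)"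
    using exp_M_has_vector_derivative[OF \<beta>] by (simp add: exp_M_bch mult.assoc)
  ultimately have eq: "exp (M p) * (exp (M (\<gamma> t)) * M (Phi (\<gamma> t) v))
      = exp (M p) * (exp (M (\<gamma> t)) * M (Phi (mul p (\<gamma> t)) w))"
    by (rule vector_derivative_unique_at)
  have cancel: "exp (- Z) * (exp Z * y) = y" for Z y :: "('a \<times> real) endo"
    using exp_minus_inverse[of "- Z"] by (simp add: mult.assoc[symmetric])
  from eq have "M (Phi (\<gamma> t) v) = M (Phi (mul p (\<gamma> t)) w)"
    by (metis cancel)
  then show ?thesis using M_inj by simp
qed

text \<open>Differentiability holds because the product is polynomial; the differential is
  identified by comparing left logarithmic derivatives along lines through 0, where
  \<open>Phi\<close> is the identity.\<close>

lemma mul_has_derivative: "(mul p has_derivative Psi p) (at 0)"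
proof -
  have "(\<lambda>z. mul p z) differentiable (at 0)"
    by (rule differentiable_mul) auto
  then obtain D where D: "(mul p has_derivative D) (at 0)"
    by (auto simp: differentiable_def)
  have "D w = Psi p w" for w
  proof -
    have g: "((\<lambda>t. t *\<^sub>R w) has_vector_derivative w) (at 0)"
      by (auto simp: has_vector_derivative_def intro!: derivative_eq_intros)
    moreover have "((\<lambda>t. mul p (t *\<^sub>R w)) has_vector_derivative D w) (at 0)"
      using has_derivative_compose[OF g[unfolded has_vector_derivative_def], of "mul p" D] D
      by (simp add: has_vector_derivative_def linear_scale has_derivative_linear)
    ultimately have "Phi (mul p (0 *\<^sub>R w)) (D w) = Phi (0 *\<^sub>R w) w"
      by (rule Phi_left_translate)
    then have "Phi p (D w) = w" by (simp add: Phi_0)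
    then show ?thesis by (metis Psi_Phi)
  qed
  then have "D = Psi p" by auto
  with D show ?thesis by simp
qed

lemma proj_1_Phi: "P 1 (Phi p v) = P 1 v"
proof -
  have "P 1 ((br p ^^ Suc k) v) = 0" for k
    using tail_br_Suc[OF tail_1, of p "(br p ^^ k) v"] by (simp add: tail_def)
  then have "P 1 (Phi p v) = fps_nth fps_phi 0 *\<^sub>R P 1 v"
    unfolding Phi_def fcalc_def by (subst sum.lessThan_Suc_shift) (simp add: proj_simps del: funpow.simps)
  then show ?thesis by (simp add: fps_phi_def)
qed

lemma proj_1_Psi: "P 1 (Psi p v) = P 1 v"
  using proj_1_Phi[of p "Psi p v"] by (simp add: Phi_Psi)

text \<open>The term of order \<open>N\<close> vanishes since \<open>v\<close> has degree one. The
  coefficient (-1)^(n-1)/n! is rewritten as -(-1)^n/n!, the sign convention of the first order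
  system.\<close>

lemma Phi_iter_br: "Phi p v = v - (\<Sum>n=2..N. ((-1) ^ n / fact n) *\<^sub>R iter_br br (n - 1) p v)"
proof -
  have "(br p ^^ N) v = 0"
    using tail_zero[OF tail_br_funpow[OF tail_1[of v], of N p]] by simp
  then have "Phi p v = (\<Sum>k<N. ((-1) ^ k / fact (Suc k)) *\<^sub>R (br p ^^ k) v)"
    by (simp add: Phi_def fcalc_def fps_phi_def)
  also have "\<dots> = v + (\<Sum>k<N - 1. ((-1) ^ Suc k / fact (Suc (Suc k))) *\<^sub>R (br p ^^ Suc k) v)"
    using N_ge sum.lessThan_Suc_shift[of "\<lambda>k. ((-1) ^ k / fact (Suc k)) *\<^sub>R (br p ^^ k) v" "N - 1"] by simp
  also have "(\<Sum>k<N - 1. ((-1) ^ Suc k / fact (Suc (Suc k))) *\<^sub>R (br p ^^ Suc k) v)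
      = (\<Sum>n=2..N. - (((-1) ^ n / fact n) *\<^sub>R iter_br br (n - 1) p v))"
    by (rule sum.reindex_bij_witness[of _ "\<lambda>n. n - 2" "\<lambda>k. k + 2"])
       (auto simp: iter_br_def numeral_2_eq_2 Suc_diff_Suc)
  finally show ?thesis by (simp add: sum_negf)
qed

text \<open>By the differential of left translation, the left invariant field of \<open>w\<close>
  has the value \<open>Psi p w\<close> at \<open>p\<close>.\<close>

lemma horiz_iff: "v \<in> horiz br N (V 1) p \<longleftrightarrow> Phi p v \<in> V 1"
proof -
  have "((\<lambda>t. mul p (t *\<^sub>R w)) has_vector_derivative Psi p w) (at 0)" for w
  proof -
    have g: "((\<lambda>t. t *\<^sub>R w) has_derivative (\<lambda>t. t *\<^sub>R w)) (at 0)"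
      by (auto intro!: derivative_eq_intros)
    show ?thesis
      using has_derivative_compose[OF g, of "mul p" "Psi p"] mul_has_derivative
      by (simp add: has_vector_derivative_def linear_scale[OF linear_Psi])
  qed
  then have "v \<in> horiz br N (V 1) p \<longleftrightarrow> (\<exists>W\<in>V 1. v = Psi p W)"
    unfolding horiz_def by (auto dest: vector_derivative_unique_at)
  then show ?thesis by (metis Phi_Psi Psi_Phi)
qed

end

section \<open>Homogeneous distances\<close>

lemma uniformly_continuous_pair:
  fixes g :: "'a::euclidean_space \<Rightarrow> 'b::euclidean_space \<Rightarrow> 'c::metric_space"
  assumes "continuous_on UNIV (\<lambda>z. g (fst z) (snd z))" "0 < e"
  obtains \<delta> where "0 < \<delta>"
    "\<And>x y x' y'. norm x \<le> C \<Longrightarrow> norm y \<le> C \<Longrightarrow> dist x' x < \<delta> \<Longrightarrow> dist y' y < \<delta> \<Longrightarrow> dist (g x' y') (g x y) < e"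
proof -
  \<comment> \<open>Only the centres are bounded by \<open>C\<close>. With a modulus at most 1 the
    perturbed points stay within radius \<open>C + 1\<close>, the compact set used for uniform
    continuity.\<close>
  let ?S = "cball (0::'a) (C + 1) \<times> cball (0::'b) (C + 1)"
  have "uniformly_continuous_on ?S (\<lambda>z. g (fst z) (snd z))"
    by (intro compact_uniformly_continuous compact_Times compact_cball continuous_on_subset[OF assms(1)]) auto
  then obtain d where d: "0 < d"
    "\<And>z z'. z \<in> ?S \<Longrightarrow> z' \<in> ?S \<Longrightarrow> dist z' z < d \<Longrightarrow> dist (g (fst z') (snd z')) (g (fst z) (snd z)) < e"
    using \<open>0 < e\<close> unfolding uniformly_continuous_on_def by metis
  show thesis
  proof (rule that[of "min 1 (d / 2)"])
    fix x x' :: 'a and y y' :: 'b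
    assume *: "norm x \<le> C" "norm y \<le> C" "dist x' x < min 1 (d / 2)" "dist y' y < min 1 (d / 2)"
    have "dist (x', y') (x, y) \<le> dist x' x + dist y' y"
      unfolding dist_Pair_Pair by (rule sqrt_sum_squares_le_sum) auto
    with * have "dist (x', y') (x, y) < d" by simp
    moreover have "norm x' \<le> C + 1" "norm y' \<le> C + 1"
      using * norm_triangle_sub[of x' x] norm_triangle_sub[of y' y] by (auto simp: dist_norm)
    ultimately show "dist (g x' y') (g x y) < e"
      using d(2)[of "(x, y)" "(x', y')"] * by auto
  qed (use d in auto)
qed

lemma norm_bounded_on_cball:
  fixes g :: "'a::euclidean_space \<Rightarrow> 'b::real_normed_vector"
  assumes "continuous_on UNIV g"
  obtains C where "0 \<le> C" "\<And>x. norm x \<le> R \<Longrightarrow> norm (g x) \<le> C"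
proof -
  have "compact (g ` cball 0 R)"
    by (intro compact_continuous_image compact_cball continuous_on_subset[OF assms]) simp
  then obtain C where "\<forall>y\<in>g ` cball 0 R. norm y \<le> C" using compact_imp_bounded bounded_iff by blast
  then have "norm (g x) \<le> C" if "norm x \<le> R" for x using that by auto
  then have "norm (g x) \<le> max 0 C" if "norm x \<le> R" for x using that by (simp add: le_max_iff_disj)
  with that[of "max 0 C"] show thesis by simp
qed

context graded_algebra
begin

lemma continuous_mul_pair: "continuous_on UNIV (\<lambda>z. mul (fst z) (snd z))"
  by (intro continuous_intros)

lemma continuous_on_dil [continuous_intros]:
  "continuous_on S r \<Longrightarrow> continuous_on S f \<Longrightarrow> continuous_on S (\<lambda>z. dl (r z) (f z))"
  unfolding dil_def
  by (intro continuous_intros bounded_linear.continuous_on[OF linear_linear[THEN iffD2, OF linear_proj]])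

lemma dil_zero: "dl 0 x = 0"
  by (rule proj_eqI) (simp add: proj_dil proj_simps)

lemma dil_norm_bound:
  obtains K where "0 < K" "\<And>r x. 0 \<le> r \<Longrightarrow> r \<le> 1 \<Longrightarrow> norm (dl r x) \<le> K * r * norm x"
proof -
  have bl: "bounded_linear (P i)" for i
    by (rule linear_linear[THEN iffD2, OF linear_proj])
  have "norm (dl r x) \<le> (1 + (\<Sum>i=1..N. onorm (P i))) * r * norm x" if r: "0 \<le> r" "r \<le> 1" for r x
  proof -
    have "norm (dl r x) \<le> (\<Sum>i=1..N. norm (r ^ i *\<^sub>R P i x))"
      unfolding dil_def by (rule norm_sum)
    also have "\<dots> \<le> (\<Sum>i=1..N. r * (onorm (P i) * norm x))"
    proof (rule sum_mono)
      fix i assume "i \<in> {1..N}"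
      then have "r ^ i \<le> r ^ 1" using r by (intro power_decreasing) auto
      then show "norm (r ^ i *\<^sub>R P i x) \<le> r * (onorm (P i) * norm x)"
        using r onorm[OF bl, of i x] by (simp add: mult_mono)
    qed
    also have "\<dots> = (\<Sum>i=1..N. onorm (P i)) * r * norm x"
      unfolding sum_distrib_right by (intro sum.cong refl) (simp add: mult_ac)
    also have "\<dots> \<le> (1 + (\<Sum>i=1..N. onorm (P i))) * r * norm x"
      using r by (intro mult_right_mono) auto
    finally show ?thesis .
  qed
  moreover have "0 < 1 + (\<Sum>i=1..N. onorm (P i))"
    using sum_nonneg[of "{1..N}" "\<lambda>i. onorm (P i)"] onorm_pos_le[OF bl] by (smt (verit))
  ultimately show thesis using that by blast
qed

text \<open>A factorisation in place of a subtraction: \<open>k\<close> is its lowest layer times an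
  element of the next tail. Downward inductions on tails rest on it.\<close>

lemma mul_minus_proj_tail: "k \<in> tail c \<Longrightarrow> 1 \<le> c \<Longrightarrow> mul (- P c k) k \<in> tail (Suc c)"
proof -
  assume k: "k \<in> tail c" and c: "1 \<le> c"
  have Pk: "- P c k \<in> tail c"
    by (auto simp: tail_def proj_simps proj_proj)
  have "P c (mul (- P c k) k) = 0"
    using proj_mul_tail[OF Pk k c] by (simp add: proj_simps proj_proj)
  with tail_mul[OF Pk k] show ?thesis
    by (auto simp: tail_def less_Suc_eq)
qed

lemma tail_downward_induct [consumes 1, case_names zero step]:
  assumes "1 \<le> c" "\<And>c. N < c \<Longrightarrow> Q c" "\<And>c. 1 \<le> c \<Longrightarrow> c \<le> N \<Longrightarrow> Q (Suc c) \<Longrightarrow> Q c"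
  shows "Q c"
  using \<open>1 \<le> c\<close>
proof (induction "Suc N - c" arbitrary: c)
  case 0
  then show ?case using assms(2) by simp
next
  case (Suc n)
  then show ?case using assms(3)[of c] by auto
qed

text \<open>A homomorphism into a vector group vanishes on the higher layers, since there
  \<open>2 Z\<close> is both \<open>Z Z\<close> and the dilation of \<open>Z\<close> by a factor different from \<open>2\<close>.\<close>

lemma additive_hom:
  fixes L :: "'a \<Rightarrow> 'c::real_vector"
  assumes hom: "\<And>h k. L (mul h k) = L h + L k" and dil: "\<And>r h. 0 < r \<Longrightarrow> L (dl r h) = r *\<^sub>R L h"
  shows "linear L" and "L (P 1 h) = L h"
proof -
  have L0: "L 0 = 0" using hom[of 0 0] by simp
  have V: "L Z = 0" if j: "2 \<le> j" "j \<le> N" and Z: "Z \<in> V j" for j Z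
  proof -
    let ?s = "2 powr (1 / real j) :: real"
    have s: "?s ^ j = 2" using j by (simp add: powr_realpow[symmetric] powr_powr)
    have "mul Z Z = dl ?s Z"
      using mul_scaleR_same[of 1 Z 1] dil_V[OF _ Z, of ?s] s j by simp
    then have "L Z + L Z = ?s *\<^sub>R L Z" by (metis hom dil powr_gt_zero zero_neq_numeral)
    then have "(2 - ?s) *\<^sub>R L Z = 0" by (simp add: scaleR_left_diff_distrib scaleR_2)
    moreover have "?s < 2 powr 1" using j by (intro powr_less_mono) auto
    ultimately show ?thesis by simp
  qed
  have tail: "L k = 0" if "2 \<le> c" "k \<in> tail c" for c k
  proof -
    have "1 \<le> c" using that by simp
    then have "2 \<le> c \<longrightarrow> (\<forall>k\<in>tail c. L k = 0)"
    proof (induction rule: tail_downward_induct)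
      case (step c)
      show ?case
      proof (intro impI ballI)
        fix k assume c: "2 \<le> c" and k: "k \<in> tail c"
        have "L k = L (P c k) + L (mul (- P c k) k)" by (simp add: hom[symmetric])
        moreover have "L (P c k) = 0" using c step(2) by (intro V[of c] proj_in) auto
        ultimately show "L k = 0" using step(3) c mul_minus_proj_tail[OF k step(1)] by auto
      qed
    qed (auto dest: tail_zero simp: L0)
    with that show ?thesis by blast
  qed
  have P: "L (P 1 h) = L h" for h
  proof -
    have "L h = L (P 1 h) + L (mul (- P 1 h) h)" by (simp add: hom[symmetric])
    moreover have "mul (- P 1 h) h \<in> tail 2"
      using mul_minus_proj_tail[of h 1] tail_1 by (simp add: numeral_2_eq_2)
    ultimately show ?thesis using tail[of 2] by simp
  qed
  then show "L (P 1 h) = L h" .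
  have neg: "L (- x) = - L x" for x
    using hom[of x "- x"] L0 by (simp add: eq_neg_iff_add_eq_0 add.commute)
  have pos: "L (r *\<^sub>R x) = r *\<^sub>R L x" if "0 < r" for r x
  proof -
    have "L (r *\<^sub>R x) = L (P 1 (dl r x))"
      by (subst P[symmetric]) (simp add: proj_dil proj_simps)
    then show ?thesis by (simp only: P dil that)
  qed
  show "linear L"
  proof (rule linearI)
    show "L (x + y) = L x + L y" for x y
      by (metis P hom proj_1_mul linear_add linear_proj)
    show "L (r *\<^sub>R x) = r *\<^sub>R L x" for r x
    proof (cases r "0 :: real" rule: linorder_cases)
      case less
      then show ?thesis using pos[of "- r" x] neg[of "r *\<^sub>R x"] by simp
    qed (auto simp: L0 pos)
  qed
qed

end

locale hom_group = graded_algebra +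
  fixes d :: "'a \<Rightarrow> 'a \<Rightarrow> real"
  assumes hom_dist: "hom_dist br V N d"
begin

section \<open>Comparison of a homogeneous distance with the norm\<close>

lemma d_nonneg: "0 \<le> d x y" and d_eq_0: "d x y = 0 \<longleftrightarrow> x = y" and d_sym: "d x y = d y x"
  and d_triangle: "d x y \<le> d x z + d z y"
  and d_continuous: "continuous_on UNIV (\<lambda>z. d (fst z) (snd z))"
  and d_left: "d (mul z x) (mul z y) = d x y"
  and d_dil: "0 < r \<Longrightarrow> d (dl r x) (dl r y) = r * d x y"
  using hom_dist unfolding hom_dist_def by blast+

lemma d_0_pos: "0 < d h 0 \<longleftrightarrow> h \<noteq> 0"
  using d_nonneg[of h 0] d_eq_0[of h 0] by auto

lemma d_dil_0: "0 < r \<Longrightarrow> d (dl r x) 0 = r * d x 0"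
  using d_dil[of r x 0] by simp

lemma d_translate: "d x y = d (mul (- y) x) 0"
  using d_left[of "- y" x y] by simp

lemma continuous_on_d [continuous_intros]:
  "continuous_on S f \<Longrightarrow> continuous_on S g \<Longrightarrow> continuous_on S (\<lambda>z. d (f z) (g z))"
  using continuous_on_compose2[OF d_continuous, of S "\<lambda>z. (f z, g z)"]
  by (auto intro: continuous_on_Pair)

text \<open>The norm is not homogeneous under dilations, so a vector of norm at least 1 is brought
  to the unit sphere by the intermediate value theorem along \<open>s \<mapsto> dl s v\<close>; this
  multiplies the distance by some s \<le> 1. Compactness of the sphere gives
  \<open>c\<close>.\<close>

lemma d_lower_bound:
  obtains c where "0 < c" "\<And>v. 1 \<le> norm v \<Longrightarrow> c \<le> d v 0"
proof -
  have "\<exists>c>0. \<forall>v\<in>sphere 0 1. c \<le> d v 0"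
  proof -
    have "continuous_on (sphere 0 1) (\<lambda>v. d v 0)" by (intro continuous_intros)
    moreover have "sphere (0::'a) 1 \<noteq> {}"
      using norm_Basis nonempty_Basis by (metis equals0D ex_in_conv mem_sphere_0)
    ultimately obtain w where "w \<in> sphere 0 1" "\<forall>v\<in>sphere 0 1. d w 0 \<le> d v 0"
      using continuous_attains_inf[OF compact_sphere] by blast
    then show ?thesis using d_0_pos[of w] by (intro exI[of _ "d w 0"]) auto
  qed
  then obtain c where c: "0 < c" "\<And>v. norm v = 1 \<Longrightarrow> c \<le> d v 0" by auto
  have "c \<le> d v 0" if "1 \<le> norm v" for v
  proof -
    have "\<exists>s\<ge>0. s \<le> 1 \<and> norm (dl s v) = 1"
      by (rule IVT') (use that in \<open>auto simp: dil_zero intro!: continuous_intros\<close>)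
    then obtain s where s: "0 \<le> s" "s \<le> 1" "norm (dl s v) = 1" by blast
    then have "s \<noteq> 0" by (auto simp: dil_zero)
    with s have "c \<le> s * d v 0" using c(2)[of "dl s v"] d_dil_0[of s v] by simp
    also have "\<dots> \<le> 1 * d v 0" using s d_nonneg by (intro mult_right_mono) auto
    finally show ?thesis by simp
  qed
  with c(1) that show thesis by blast
qed

lemma d_small_imp_norm_small:
  assumes "0 < e" obtains \<eta> where "0 < \<eta>" "\<And>v. d v 0 < \<eta> \<Longrightarrow> norm v < e"
proof -
  obtain c where c: "0 < c" "\<And>v. 1 \<le> norm v \<Longrightarrow> c \<le> d v 0" using d_lower_bound by blast
  obtain K where K: "0 < K" "\<And>r x. 0 \<le> r \<Longrightarrow> r \<le> 1 \<Longrightarrow> norm (dl r x) \<le> K * r * norm x"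
    using dil_norm_bound by blast
  \<comment> \<open>A distance below \<open>c * t\<close> puts \<open>dl (1 / t) v\<close> inside
    the unit ball, and dilating back by t \<le> 1 gives norm below
    \<open>K * t \<le> e\<close>.\<close>
  define t where "t = min 1 (e / K)"
  have t: "0 < t" "t \<le> 1" "K * t \<le> e"
    using assms K(1) by (auto simp: t_def min_def field_simps)
  have "norm v < e" if "d v 0 < c * t" for v
  proof -
    have "d (dl (1 / t) v) 0 < c"
    proof -
      have "t * d (dl (1 / t) v) 0 = d v 0" using t d_dil_0[of "1 / t" v] by simp
      with that have "t * d (dl (1 / t) v) 0 < t * c" by (simp add: mult.commute)
      with t show ?thesis by simp
    qed
    then have 1: "norm (dl (1 / t) v) < 1" using c(2) by (meson not_le)
    have "norm v \<le> K * t * norm (dl (1 / t) v)"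
      using K(2)[of t "dl (1 / t) v"] t dil_inverse(2)[of t v] by simp
    also have "\<dots> < K * t * 1" using 1 K(1) t by (intro mult_strict_left_mono) auto
    finally show ?thesis using t(3) by simp
  qed
  moreover have "0 < c * t" using c t by simp
  ultimately show thesis using that by blast
qed

lemma d_bounded_imp_norm_bounded:
  obtains B where "0 < B" "\<And>v. d v 0 \<le> 1 \<Longrightarrow> norm v \<le> B"
proof -
  obtain \<eta> where \<eta>: "0 < \<eta>" "\<And>v. d v 0 < \<eta> \<Longrightarrow> norm v < 1"
    using d_small_imp_norm_small[of 1] by auto
  have bl: "bounded_linear (dl (2 / \<eta>))"
    by (rule linear_linear[THEN iffD2, OF linear_dil])
  have "norm v \<le> onorm (dl (2 / \<eta>)) + 1" if "d v 0 \<le> 1" for v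
  proof -
    have "d (dl (\<eta> / 2) v) 0 < \<eta>"
    proof -
      have "d (dl (\<eta> / 2) v) 0 = \<eta> / 2 * d v 0" using \<eta>(1) by (intro d_dil_0) simp
      also have "\<dots> \<le> \<eta> / 2 * 1" using that \<eta>(1) by (intro mult_left_mono) auto
      finally show ?thesis using \<eta>(1) by simp
    qed
    then have "norm (dl (\<eta> / 2) v) < 1" by (rule \<eta>(2))
    then have "onorm (dl (2 / \<eta>)) * norm (dl (\<eta> / 2) v) \<le> onorm (dl (2 / \<eta>)) * 1"
      using onorm_pos_le[OF bl] by (intro mult_left_mono) auto
    moreover have "v = dl (2 / \<eta>) (dl (\<eta> / 2) v)" using \<eta>(1) by (simp add: dil_dil)
    then have "norm v \<le> onorm (dl (2 / \<eta>)) * norm (dl (\<eta> / 2) v)"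
      using onorm[OF bl] by metis
    ultimately show ?thesis by linarith
  qed
  moreover have "0 < onorm (dl (2 / \<eta>)) + 1" using onorm_pos_le[OF bl] by linarith
  ultimately show thesis using that by blast
qed

lemma norm_small_imp_d_small:
  assumes "0 < e" obtains \<delta> where "0 < \<delta>" "\<And>v. norm v < \<delta> \<Longrightarrow> d v 0 < e"
proof -
  obtain \<delta> where "0 < \<delta>"
    "\<And>x y x' y'. norm x \<le> 0 \<Longrightarrow> norm y \<le> 0 \<Longrightarrow> dist x' x < \<delta> \<Longrightarrow> dist y' y < \<delta> \<Longrightarrow> dist (d x' y') (d x y) < e"
    using uniformly_continuous_pair[OF d_continuous assms, of 0] by blast
  then show thesis
    using that[of \<delta>] d_eq_0[of 0 0] d_nonneg by (fastforce simp: dist_real_def)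
qed

text \<open>The distance sees only z^(-1) y, and translating back by \<open>z\<close> distorts the
  norm; the bound \<open>C\<close> on \<open>z\<close> makes this distortion uniform.\<close>

lemma d_close_imp_norm_close:
  assumes "0 < e" obtains \<eta> where "0 < \<eta>" "\<And>y z. norm z \<le> C \<Longrightarrow> d y z < \<eta> \<Longrightarrow> norm (y - z) < e"
proof -
  obtain \<delta> where \<delta>: "0 < \<delta>"
    "\<And>x y x' y'. norm x \<le> \<bar>C\<bar> \<Longrightarrow> norm y \<le> \<bar>C\<bar> \<Longrightarrow> dist x' x < \<delta> \<Longrightarrow> dist y' y < \<delta> \<Longrightarrow> dist (mul x' y') (mul x y) < e"
    using uniformly_continuous_pair[OF continuous_mul_pair assms, of "\<bar>C\<bar>"] by blast
  obtain \<eta> where \<eta>: "0 < \<eta>" "\<And>v. d v 0 < \<eta> \<Longrightarrow> norm v < \<delta>"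
    using d_small_imp_norm_small[OF \<delta>(1)] by blast
  have "norm (y - z) < e" if "norm z \<le> C" "d y z < \<eta>" for y z
  proof -
    have "norm (mul (- z) y) < \<delta>" using that(2) d_translate[of y z] by (intro \<eta>(2)) simp
    then have "dist (mul z (mul (- z) y)) (mul z 0) < e"
      using that(1) \<delta>(1) by (intro \<delta>(2)) auto
    then show ?thesis by (simp add: dist_norm)
  qed
  with \<eta>(1) that show thesis by blast
qed

text \<open>The limit runs over norm neighbourhoods of 0, the estimates over balls of
  \<open>d\<close>; the two neighbourhood bases are equivalent.\<close>

lemma quotient_tendsto_iff:
  assumes "\<And>h. 0 \<le> q h"
  shows "((\<lambda>h. q h / d h 0) \<longlongrightarrow> 0) (at 0) \<longleftrightarrow>
    (\<forall>e>0. \<exists>\<delta>>0. \<forall>h. h \<noteq> 0 \<longrightarrow> d h 0 < \<delta> \<longrightarrow> q h \<le> e * d h 0)" (is "?l \<longleftrightarrow> ?r")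
proof
  assume l: ?l
  show ?r
  proof (intro allI impI)
    fix e :: real assume "0 < e"
    with l obtain s where s: "0 < s" "\<And>h. h \<noteq> 0 \<and> norm (h - 0) < s \<Longrightarrow> norm (q h / d h 0 - 0) < e"
      unfolding LIM_eq by meson
    obtain \<delta> where \<delta>: "0 < \<delta>" "\<And>v. d v 0 < \<delta> \<Longrightarrow> norm v < s"
      using d_small_imp_norm_small[OF s(1)] by blast
    have "q h \<le> e * d h 0" if "h \<noteq> 0" "d h 0 < \<delta>" for h
      using s(2)[of h] \<delta>(2)[OF that(2)] d_0_pos[of h] that(1) assms[of h] by (simp add: field_simps)
    with \<delta>(1) show "\<exists>\<delta>>0. \<forall>h. h \<noteq> 0 \<longrightarrow> d h 0 < \<delta> \<longrightarrow> q h \<le> e * d h 0" by blast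
  qed
next
  assume r: ?r
  show ?l
    unfolding LIM_eq
  proof (intro allI impI)
    fix e :: real assume "0 < e"
    then obtain \<delta> where \<delta>: "0 < \<delta>" "\<And>h. h \<noteq> 0 \<Longrightarrow> d h 0 < \<delta> \<Longrightarrow> q h \<le> (e / 2) * d h 0"
      using r by (meson half_gt_zero)
    obtain s where s: "0 < s" "\<And>v. norm v < s \<Longrightarrow> d v 0 < \<delta>"
      using norm_small_imp_d_small[OF \<delta>(1)] by blast
    have "norm (q h / d h 0 - 0) < e" if "h \<noteq> 0 \<and> norm (h - 0) < s" for h
    proof -
      have "q h \<le> (e / 2) * d h 0" using that by (intro \<delta>(2) s(2)) auto
      then have "q h / d h 0 \<le> e / 2" using d_0_pos[of h] that by (simp add: divide_le_eq)
      moreover have "0 \<le> q h / d h 0" using assms d_nonneg by simp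
      ultimately show ?thesis using \<open>0 < e\<close>
        by (simp only: diff_zero real_norm_def)
    qed
    with s(1) show "\<exists>s>0. \<forall>x. x \<noteq> 0 \<and> norm (x - 0) < s \<longrightarrow> norm (q x / d x 0 - 0) < e" by blast
  qed
qed

end

section \<open>Generation by the first layer\<close>

context graded_algebra
begin

lemma mul_bounded:
  obtains B where "0 \<le> B" "\<And>x y. norm x \<le> C \<Longrightarrow> norm y \<le> C \<Longrightarrow> norm (mul x y) \<le> B"
proof -
  obtain B where B: "0 \<le> B" "\<And>z. norm z \<le> C + C \<Longrightarrow> norm (mul (fst z) (snd z)) \<le> B"
    using norm_bounded_on_cball[OF continuous_mul_pair, of "C + C"] by blast
  have "norm (mul x y) \<le> B" if "norm x \<le> C" "norm y \<le> C" for x y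
    using B(2)[of "(x, y)"] that norm_Pair_le[of x y] by simp
  with B(1) that show thesis by blast
qed

section \<open>Products of finitely many horizontal elements\<close>

definition hprod :: "'a list \<Rightarrow> 'a" where
  "hprod xs = foldr mul xs 0"

lemma hprod_simps [simp]: "hprod [] = 0" "hprod (x # xs) = mul x (hprod xs)"
  by (simp_all add: hprod_def)

lemma hprod_append: "hprod (xs @ ys) = mul (hprod xs) (hprod ys)"
  by (induction xs) (simp_all add: mul_assoc)

lemma hprod_rev_uminus: "hprod (rev (map uminus xs)) = - hprod xs"
  by (induction xs) (simp_all add: hprod_append minus_mul)

text \<open>The number of factors is exactly \<open>m\<close>; shorter products are padded by 0, the
  identity, so that the bounds can be enlarged freely.\<close>

definition hprods :: "nat \<Rightarrow> real \<Rightarrow> 'a set" where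
  "hprods m C = {hprod xs | xs. length xs = m \<and> (\<forall>x\<in>set xs. x \<in> V 1 \<and> norm x \<le> C)}"

lemma V1_subspace: "subspace (V 1)"
  using V_subspace[of 1] N_ge by simp

lemma hprods_mono: "z \<in> hprods m C \<Longrightarrow> m \<le> m' \<Longrightarrow> C \<le> C' \<Longrightarrow> 0 \<le> C \<Longrightarrow> z \<in> hprods m' C'"
proof -
  assume z: "z \<in> hprods m C" and le: "m \<le> m'" "C \<le> C'" "0 \<le> C"
  then obtain xs where xs: "z = hprod xs" "length xs = m" "\<forall>x\<in>set xs. x \<in> V 1 \<and> norm x \<le> C"
    by (auto simp: hprods_def)
  have "hprod (replicate n 0) = 0" for n by (induction n) auto
  then have "z = hprod (xs @ replicate (m' - m) 0)" by (simp add: hprod_append xs(1))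
  then show ?thesis
    unfolding hprods_def using le xs subspace_0[OF V1_subspace]
    by (intro CollectI exI) (auto intro: order_trans[of _ C C'])
qed

lemma hprods_mul: "y \<in> hprods m C \<Longrightarrow> z \<in> hprods n C \<Longrightarrow> mul y z \<in> hprods (m + n) C"
proof -
  assume "y \<in> hprods m C" "z \<in> hprods n C"
  then obtain xs ys where
    "y = hprod xs" "length xs = m" "\<forall>x\<in>set xs. x \<in> V 1 \<and> norm x \<le> C"
    "z = hprod ys" "length ys = n" "\<forall>x\<in>set ys. x \<in> V 1 \<and> norm x \<le> C"
    by (auto simp: hprods_def)
  then show ?thesis
    unfolding hprods_def by (intro CollectI exI[of _ "xs @ ys"]) (auto simp: hprod_append)
qed

lemma hprods_uminus: "z \<in> hprods m C \<Longrightarrow> - z \<in> hprods m C"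
proof -
  assume "z \<in> hprods m C"
  then obtain xs where "z = hprod xs" "length xs = m" "\<forall>x\<in>set xs. x \<in> V 1 \<and> norm x \<le> C"
    by (auto simp: hprods_def)
  then show ?thesis
    unfolding hprods_def using subspace_neg[OF V1_subspace]
    by (intro CollectI exI[of _ "rev (map uminus xs)"]) (auto simp: hprod_rev_uminus)
qed

lemma hprods_single: "x \<in> V 1 \<Longrightarrow> norm x \<le> C \<Longrightarrow> x \<in> hprods 1 C"
  unfolding hprods_def by (intro CollectI exI[of _ "[x]"]) auto

lemma hprods_bounded:
  obtains B where "0 \<le> B" "\<And>z. z \<in> hprods m C \<Longrightarrow> norm z \<le> B"
proof -
  have "\<exists>B\<ge>0. \<forall>z\<in>hprods m C. norm z \<le> B"
  proof (induction m)
    case (Suc m)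
    then obtain B where B: "0 \<le> B" "\<forall>z\<in>hprods m C. norm z \<le> B" by blast
    obtain B' where B': "0 \<le> B'" "\<And>x y. norm x \<le> max B C \<Longrightarrow> norm y \<le> max B C \<Longrightarrow> norm (mul x y) \<le> B'"
      using mul_bounded[of "max B C"] by blast
    have "norm z \<le> B'" if "z \<in> hprods (Suc m) C" for z
    proof -
      from that obtain x xs where xs: "z = mul x (hprod xs)" "length xs = m"
        "norm x \<le> C" "\<forall>x\<in>set xs. x \<in> V 1 \<and> norm x \<le> C"
        by (auto simp: hprods_def length_Suc_conv)
      then have "hprod xs \<in> hprods m C" by (auto simp: hprods_def)
      with B(2) xs show ?thesis by (auto intro!: B'(2) simp: le_max_iff_disj)
    qed
    with B'(1) show ?case by blast
  qed (auto simp: hprods_def)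
  with that show thesis by blast
qed

text \<open>Conjugation gives e^(ad x) g = g + [x,g] up to depth j + 2, and multiplying by the
  inverse of \<open>g\<close> removes \<open>g\<close> up to the same depth.\<close>

lemma proj_commutator:
  assumes x: "x \<in> V 1" and g: "g \<in> tail j" "1 \<le> j"
  shows "mul (mul (mul x g) (- x)) (- g) \<in> tail (Suc j)"
    and "P (Suc j) (mul (mul (mul x g) (- x)) (- g)) = br x (P j g)"
proof -
  define w where "w = mul (mul x g) (- x)"
  have "w = (\<Sum>k<Suc N. (1 / fact k) *\<^sub>R (br x ^^ k) g)"
    by (simp add: w_def mul_conj fcalc_def)
  also have "\<dots> = g + (\<Sum>k<N. (1 / fact (Suc k)) *\<^sub>R (br x ^^ Suc k) g)"
    by (subst sum.lessThan_Suc_shift) simp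
  also have "(\<Sum>k<N. (1 / fact (Suc k)) *\<^sub>R (br x ^^ Suc k) g)
      = br x g + (\<Sum>k<N - 1. (1 / fact (Suc (Suc k))) *\<^sub>R (br x ^^ Suc (Suc k)) g)"
    using N_ge sum.lessThan_Suc_shift[of "\<lambda>k. (1 / fact (Suc k)) *\<^sub>R (br x ^^ Suc k) g" "N - 1"] by simp
  finally have "w - g - br x g = (\<Sum>k<N - 1. (1 / fact (Suc (Suc k))) *\<^sub>R (br x ^^ Suc (Suc k)) g)"
    by (simp add: algebra_simps)
  also have "\<dots> \<in> tail (Suc (Suc j))"
    by (intro subspace_sum subspace_tail subspace_scale[OF subspace_tail] tail_mono[OF tail_br_funpow[OF g(1)]]) simp
  finally have wg: "w - g - br x g \<in> tail (Suc (Suc j))" .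
  have wg1: "w - g \<in> tail (Suc j)"
    using subspace_add[OF subspace_tail tail_mono[OF wg, of "Suc j"] tail_br_Suc[OF g(1), of x]] by simp
  \<comment> \<open>Since [g,g] = 0, the bracket involves only w - g, which is one layer deeper;
    this puts the correction of \<open>mul_tail\<close> at depth j + 2.\<close>
  have "br w (- g) = - br (w - g) g" by (simp add: br_simps)
  moreover have "br (w - g) g \<in> tail (Suc (Suc j))"
    by (rule tail_mono[OF tail_br[OF wg1 g(1)]]) (use g(2) in simp)
  ultimately have "mul w (- g) - w - - g \<in> tail (Suc (Suc j))"
    by (intro mul_tail) (auto intro: subspace_neg[OF subspace_tail])
  from subspace_add[OF subspace_tail this wg]
  have m: "mul w (- g) - br x g \<in> tail (Suc (Suc j))" by (simp add: algebra_simps)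
  have "mul w (- g) \<in> tail (Suc j)"
    using subspace_add[OF subspace_tail tail_mono[OF m, of "Suc j"] tail_br_Suc[OF g(1), of x]] by simp
  then show "mul (mul (mul x g) (- x)) (- g) \<in> tail (Suc j)"
    by (simp add: w_def)
  have "br x (g - P j g) \<in> tail (Suc (Suc j))"
    by (intro tail_br_Suc tail_diff_proj g)
  from subspace_add[OF subspace_tail m this]
  have "mul w (- g) - br x (P j g) \<in> tail (Suc (Suc j))"
    by (simp add: br_simps)
  then have "P (Suc j) (mul w (- g)) = P (Suc j) (br x (P j g))"
    by (simp add: tail_def proj_simps)
  also have "\<dots> = br x (P j g)"
  proof (cases "j \<in> {1..N}")
    case True
    then have "br x (P j g) \<in> (if 1 + j \<le> N then V (1 + j) else {0})"
      by (intro V_br x proj_in) auto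
    then show ?thesis
      by (cases "Suc j \<le> N") (auto simp: proj_V[of "Suc j"] proj_simps)
  qed (simp add: proj_out br_simps proj_simps)
  finally show "P (Suc j) (mul (mul (mul x g) (- x)) (- g)) = br x (P j g)"
    by (simp add: w_def)
qed

end

text \<open>The coordinates are linear functionals on the whole space; their operator norms will
  bound the coefficients of all vectors of a ball at once.\<close>

lemma finite_span_coordinates:
  fixes S :: "'a::euclidean_space set"
  obtains B g where "finite B" "B \<subseteq> S" "\<And>b. b \<in> B \<Longrightarrow> bounded_linear (g b :: 'a \<Rightarrow> real)"
    "\<And>v. v \<in> span S \<Longrightarrow> v = (\<Sum>b\<in>B. g b v *\<^sub>R b)"
proof -
  obtain B where B: "B \<subseteq> S" "independent B" "S \<subseteq> span B"
    using maximal_independent_subset[of S] by blast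
  have fin: "finite B" using B(2) by (rule independent_imp_finite)
  have "\<forall>b. \<exists>g. linear g \<and> (\<forall>x\<in>B. g x = (if x = b then 1 else 0 :: real))"
    by (intro allI linear_independent_extend[OF B(2)])
  from choice[OF this] obtain g
    where "\<forall>b. linear (g b) \<and> (\<forall>x\<in>B. g b x = (if x = b then 1 else 0 :: real))" ..
  then have g: "\<And>b. linear (g b)" "\<And>b x. x \<in> B \<Longrightarrow> g b x = (if x = b then 1 else 0 :: real)"
    by simp_all
  have "v = (\<Sum>b\<in>B. g b v *\<^sub>R b)" if "v \<in> span S" for v
  proof (rule linear_eq_on_span[of "\<lambda>v. v" "\<lambda>v. \<Sum>b\<in>B. g b v *\<^sub>R b" B])
    show "linear (\<lambda>v. \<Sum>b\<in>B. g b v *\<^sub>R b)"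
      by (rule linearI)
         (simp_all add: linear_add[OF g(1)] linear_scale[OF g(1)] scaleR_left_distrib sum.distrib scaleR_sum_right)
    show "v \<in> span B"
      using that B(3) span_minimal[OF _ subspace_span] by blast
    show "x = (\<Sum>b\<in>B. g b x *\<^sub>R b)" if "x \<in> B" for x
    proof -
      have "(\<Sum>b\<in>B. g b x *\<^sub>R b) = (\<Sum>b\<in>B. if x = b then b else 0)"
        by (intro sum.cong refl) (simp add: g(2)[OF that])
      then show ?thesis using fin that by simp
    qed
  qed (simp add: linear_id[unfolded id_def])
  then show thesis
    by (intro that[OF fin B(1), of g]) (simp_all add: linear_linear g(1))
qed

locale stratified_algebra = graded_algebra +
  assumes stratified: "stratified br V N"
begin

text \<open>A bracket [x,y] with x in V_1 and y in V_j is the leading layer of the commutator of x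
  with a product whose leading layer is y. Finitely many such brackets span V_(j+1), and leading
  layers add under multiplication; so the number and size of the factors stay uniform over a
  ball.\<close>

lemma layer_generated:
  assumes "1 \<le> j" "j \<le> N"
  shows "\<forall>R. \<exists>m C. 0 \<le> C \<and> (\<forall>Z\<in>V j. norm Z \<le> R \<longrightarrow> (\<exists>g\<in>hprods m C. g \<in> tail j \<and> P j g = Z))"
  using assms
proof (induction j rule: dec_induct)
  case base
  show ?case
  proof
    fix R :: real
    show "\<exists>m C. 0 \<le> C \<and> (\<forall>Z\<in>V 1. norm Z \<le> R \<longrightarrow> (\<exists>g\<in>hprods m C. g \<in> tail 1 \<and> P 1 g = Z))"
    proof (intro exI conjI ballI impI)
      fix Z assume Z: "Z \<in> V 1" "norm Z \<le> R"
      then have "Z \<in> hprods 1 (max 0 R)" by (intro hprods_single) auto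
      with Z N_ge tail_1 show "\<exists>g\<in>hprods 1 (max 0 R). g \<in> tail 1 \<and> P 1 g = Z"
        by (intro bexI[of _ Z]) (auto simp: proj_V[of "Suc 0"])
    qed simp
  qed
next
  case (step j)
  then have j: "1 \<le> j" "Suc j \<le> N" by auto
  let ?S = "{br x y | x y. x \<in> V 1 \<and> y \<in> V j}"
  have span: "span ?S = V (Suc j)"
    using stratified j unfolding stratified_def by auto
  obtain B c where B: "finite B" "B \<subseteq> ?S" "\<And>b. b \<in> B \<Longrightarrow> bounded_linear (c b)"
    "\<And>v. v \<in> V (Suc j) \<Longrightarrow> v = (\<Sum>b\<in>B. c b v *\<^sub>R b)"
    using finite_span_coordinates[of ?S] unfolding span by blast
  \<comment> \<open>The scalar \<open>t\<close> is absorbed into \<open>y\<close>, so that one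
    commutator length serves all coefficients up to \<open>R\<close>.\<close>
  have one: "\<exists>m C. 0 \<le> C \<and> (\<forall>t. \<bar>t\<bar> \<le> R \<longrightarrow> (\<exists>g\<in>hprods m C. g \<in> tail (Suc j) \<and> P (Suc j) g = t *\<^sub>R b))"
    if b: "b \<in> ?S" for b and R :: real
  proof -
    from b obtain x y where xy: "b = br x y" "x \<in> V 1" "y \<in> V j" by blast
    obtain m C where mC: "0 \<le> C" "\<And>Z. Z \<in> V j \<Longrightarrow> norm Z \<le> R * norm y \<Longrightarrow> \<exists>g\<in>hprods m C. g \<in> tail j \<and> P j g = Z"
      using step.IH[OF Suc_leD[OF j(2)]] by blast
    let ?C = "max C (norm x)"
    have "\<exists>g\<in>hprods (1 + m + 1 + m) ?C. g \<in> tail (Suc j) \<and> P (Suc j) g = t *\<^sub>R b" if "\<bar>t\<bar> \<le> R" for t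
    proof -
      have "t *\<^sub>R y \<in> V j" using xy(3) j subspace_scale[OF V_subspace] by simp
      moreover have "norm (t *\<^sub>R y) \<le> R * norm y" using that by (simp add: mult_right_mono)
      ultimately obtain g where g: "g \<in> hprods m C" "g \<in> tail j" "P j g = t *\<^sub>R y" using mC(2) by blast
      have g': "g \<in> hprods m ?C" using hprods_mono[OF g(1) order_refl, of ?C] mC(1) by simp
      have x': "x \<in> hprods 1 ?C" by (rule hprods_single[OF xy(2)]) simp
      have "mul (mul (mul x g) (- x)) (- g) \<in> hprods (1 + m + 1 + m) ?C"
        by (intro hprods_mul hprods_uminus g' x')
      with proj_commutator[OF xy(2) g(2) j(1)] g(3) xy(1) show ?thesis
        by (intro bexI) (auto simp: br_simps)
    qed
    moreover have "0 \<le> ?C" using mC(1) by simp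
    ultimately show ?thesis by blast
  qed
  have many: "\<exists>m C. 0 \<le> C \<and> (\<forall>t. (\<forall>b\<in>B. \<bar>t b\<bar> \<le> R) \<longrightarrow>
      (\<exists>g\<in>hprods m C. g \<in> tail (Suc j) \<and> P (Suc j) g = (\<Sum>b\<in>B. t b *\<^sub>R b)))" for R :: real
    using B(1,2)
  proof (induction B)
    case empty
    show ?case
      by (intro exI[of _ 0]) (auto simp: hprods_def subspace_0[OF subspace_tail] proj_simps)
  next
    case (insert b B)
    then obtain m C where mC: "0 \<le> C" "\<And>t. (\<forall>b\<in>B. \<bar>t b\<bar> \<le> R) \<Longrightarrow>
      \<exists>g\<in>hprods m C. g \<in> tail (Suc j) \<and> P (Suc j) g = (\<Sum>b\<in>B. t b *\<^sub>R b)"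
      by auto
    obtain m' C' where mC': "0 \<le> C'" "\<And>t. \<bar>t\<bar> \<le> R \<Longrightarrow>
      \<exists>g\<in>hprods m' C'. g \<in> tail (Suc j) \<and> P (Suc j) g = t *\<^sub>R b"
      using one[of b R] insert.prems by blast
    have "\<exists>g\<in>hprods (m' + m) (max C C'). g \<in> tail (Suc j) \<and> P (Suc j) g = (\<Sum>b\<in>insert b B. t b *\<^sub>R b)"
      if t: "\<forall>b\<in>insert b B. \<bar>t b\<bar> \<le> R" for t
    proof -
      obtain g where g: "g \<in> hprods m C" "g \<in> tail (Suc j)" "P (Suc j) g = (\<Sum>b\<in>B. t b *\<^sub>R b)"
        using mC(2)[of t] t by blast
      obtain g' where g': "g' \<in> hprods m' C'" "g' \<in> tail (Suc j)" "P (Suc j) g' = t b *\<^sub>R b"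
        using mC'(2)[of "t b"] t by blast
      show ?thesis
      proof (intro bexI conjI)
        show "mul g' g \<in> hprods (m' + m) (max C C')"
          using hprods_mono[OF g(1), of m "max C C'"] hprods_mono[OF g'(1), of m' "max C C'"] mC(1) mC'(1)
          by (intro hprods_mul) auto
        show "mul g' g \<in> tail (Suc j)" by (intro tail_mul g g')
        show "P (Suc j) (mul g' g) = (\<Sum>b\<in>insert b B. t b *\<^sub>R b)"
          using proj_mul_tail[OF g'(2) g(2)] insert.hyps by (simp add: g(3) g'(3))
      qed
    qed
    moreover have "0 \<le> max C C'" using mC(1) by simp
    ultimately show ?case by blast
  qed
  show ?case
  proof
    fix R :: real
    have "\<exists>R'. \<forall>b\<in>B. \<forall>v. norm v \<le> R \<longrightarrow> \<bar>c b v\<bar> \<le> R'"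
    proof (intro exI ballI allI impI)
      fix b and v :: 'a assume b: "b \<in> B" and v: "norm v \<le> R"
      have R: "0 \<le> R" using v norm_ge_zero[of v] by linarith
      have "\<bar>c b v\<bar> \<le> onorm (c b) * norm v" using onorm[OF B(3)[OF b], of v] by simp
      also have "\<dots> \<le> onorm (c b) * R" using v onorm_pos_le[OF B(3)[OF b]] by (intro mult_left_mono)
      also have "\<dots> \<le> (\<Sum>b\<in>B. onorm (c b)) * R"
        using R b B(1) by (intro mult_right_mono member_le_sum) (auto intro: onorm_pos_le B(3))
      finally show "\<bar>c b v\<bar> \<le> (\<Sum>b\<in>B. onorm (c b)) * R" .
    qed
    then obtain R' where R': "\<And>b v. b \<in> B \<Longrightarrow> norm v \<le> R \<Longrightarrow> \<bar>c b v\<bar> \<le> R'" by blast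
    obtain m C where mC: "0 \<le> C" "\<And>t. (\<forall>b\<in>B. \<bar>t b\<bar> \<le> R') \<Longrightarrow>
      \<exists>g\<in>hprods m C. g \<in> tail (Suc j) \<and> P (Suc j) g = (\<Sum>b\<in>B. t b *\<^sub>R b)"
      using many[of R'] by blast
    have "\<exists>g\<in>hprods m C. g \<in> tail (Suc j) \<and> P (Suc j) g = Z" if "Z \<in> V (Suc j)" "norm Z \<le> R" for Z
      using mC(2)[of "\<lambda>b. c b Z"] R' that(2) B(4)[OF that(1)] by metis
    with mC(1) show "\<exists>m C. 0 \<le> C \<and> (\<forall>Z\<in>V (Suc j). norm Z \<le> R \<longrightarrow> (\<exists>g\<in>hprods m C. g \<in> tail (Suc j) \<and> P (Suc j) g = Z))"
      by blast
  qed
qed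

text \<open>Downward induction on tails: the leading layer of \<open>h\<close> is matched by a
  bounded product \<open>g\<close> of horizontal elements, and g^(-1) h lies in the next tail. Its
  norm is bounded by \<open>B'\<close>, which serves as the radius for the next stage.\<close>

lemma bounded_generation:
  obtains m C where "0 \<le> C" "\<And>h. norm h \<le> R \<Longrightarrow> h \<in> hprods m C"
proof -
  have "\<forall>R. \<exists>m C. 0 \<le> C \<and> (\<forall>h\<in>tail c. norm h \<le> R \<longrightarrow> h \<in> hprods m C)" if "1 \<le> c" for c
    using that
  proof (induction rule: tail_downward_induct)
    case (zero c)
    show ?case
      by (intro allI exI[of _ 0]) (use zero in \<open>auto dest: tail_zero simp: hprods_def\<close>)
  next
    case (step c)
    show ?case
    proof
      fix R :: real
      have bl: "bounded_linear (P c)" by (simp add: linear_linear linear_proj)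
      obtain m1 C1 where 1: "0 \<le> C1" "\<And>Z. Z \<in> V c \<Longrightarrow> norm Z \<le> onorm (P c) * R \<Longrightarrow> \<exists>g\<in>hprods m1 C1. g \<in> tail c \<and> P c g = Z"
        using layer_generated[OF step(1,2)] by blast
      obtain B where B: "0 \<le> B" "\<And>z. z \<in> hprods m1 C1 \<Longrightarrow> norm z \<le> B"
        using hprods_bounded[of m1 C1] by blast
      obtain B' where B': "0 \<le> B'" "\<And>x y. norm x \<le> max B R \<Longrightarrow> norm y \<le> max B R \<Longrightarrow> norm (mul x y) \<le> B'"
        using mul_bounded[of "max B R"] by blast
      obtain m2 C2 where 2: "0 \<le> C2" "\<And>h. h \<in> tail (Suc c) \<Longrightarrow> norm h \<le> B' \<Longrightarrow> h \<in> hprods m2 C2"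
        using step(3) by blast
      have "h \<in> hprods (m1 + m2) (max C1 C2)" if h: "h \<in> tail c" "norm h \<le> R" for h
      proof -
        have "norm (P c h) \<le> onorm (P c) * norm h" by (rule onorm[OF bl])
        also have "\<dots> \<le> onorm (P c) * R" using h(2) onorm_pos_le[OF bl] by (rule mult_left_mono)
        finally obtain g where g: "g \<in> hprods m1 C1" "g \<in> tail c" "P c g = P c h"
          using 1(2)[of "P c h"] proj_in[of c h] step(1,2) by auto
        have g': "- g \<in> tail c" by (rule subspace_neg[OF subspace_tail g(2)])
        have "mul (- g) h \<in> tail (Suc c)"
          using tail_mul[OF g' h(1)] proj_mul_tail[OF g' h(1) step(1)] g(3)
          by (auto simp: tail_def less_Suc_eq proj_simps)
        moreover have "norm (mul (- g) h) \<le> B'"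
          using B(2)[OF g(1)] h(2) by (intro B'(2)) auto
        ultimately have "mul (- g) h \<in> hprods m2 C2" by (rule 2(2))
        then have "mul g (mul (- g) h) \<in> hprods (m1 + m2) (max C1 C2)"
          using hprods_mono[OF g(1), of m1 "max C1 C2"] hprods_mono[of _ m2 C2 m2 "max C1 C2"] 1(1) 2(1)
          by (intro hprods_mul) auto
        then show ?thesis by simp
      qed
      moreover have "0 \<le> max C1 C2" using 1 by simp
      ultimately show "\<exists>m C. 0 \<le> C \<and> (\<forall>h\<in>tail c. norm h \<le> R \<longrightarrow> h \<in> hprods m C)" by blast
    qed
  qed
  from this[of 1] that tail_1 show thesis by (metis One_nat_def order_refl)
qed

end

section \<open>P-differentials\<close>

context graded_algebra
begin

lemma bounded_linear_proj: "bounded_linear (P i)"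
  by (simp add: linear_linear linear_proj)

lemma bounded_linear_Psi: "bounded_linear (Psi p)"
  by (simp add: linear_linear linear_Psi)

lemma continuous_on_proj [continuous_intros]: "continuous_on S f \<Longrightarrow> continuous_on S (\<lambda>z. P i (f z))"
  by (rule bounded_linear.continuous_on[OF bounded_linear_proj])

lemma continuous_on_Psi [continuous_intros]:
  "continuous_on S p \<Longrightarrow> continuous_on S w \<Longrightarrow> continuous_on S (\<lambda>z. Psi (p z) (w z))"
  unfolding Psi_def by (rule continuous_on_fcalc)

lemma proj_1_dil: "P 1 (dl r x) = r *\<^sub>R P 1 x"
  by (simp add: proj_dil)

lemma dil_first_order:
  obtains K where "0 < K" "\<And>r x. 0 \<le> r \<Longrightarrow> r \<le> 1 \<Longrightarrow> norm (dl r x - r *\<^sub>R P 1 x) \<le> K * r\<^sup>2 * norm x"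
proof -
  let ?S = "\<Sum>i=1..N. onorm (P i)"
  have "norm (dl r x - r *\<^sub>R P 1 x) \<le> (1 + ?S) * r\<^sup>2 * norm x" if r: "0 \<le> r" "r \<le> 1" for r x
  proof -
    have "dl r x = r *\<^sub>R P 1 x + (\<Sum>i=2..N. r ^ i *\<^sub>R P i x)"
      using N_ge sum.atLeast_Suc_atMost[of 1 N "\<lambda>i. r ^ i *\<^sub>R P i x"]
      by (simp add: dil_def numeral_2_eq_2)
    then have "norm (dl r x - r *\<^sub>R P 1 x) \<le> (\<Sum>i=2..N. norm (r ^ i *\<^sub>R P i x))"
      using norm_sum[of "\<lambda>i. r ^ i *\<^sub>R P i x" "{2..N}"] by simp
    also have "\<dots> \<le> (\<Sum>i=2..N. r\<^sup>2 * (onorm (P i) * norm x))"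
    proof (rule sum_mono)
      fix i assume "i \<in> {2..N}"
      then have "r ^ i \<le> r ^ 2" using r by (intro power_decreasing) auto
      then show "norm (r ^ i *\<^sub>R P i x) \<le> r\<^sup>2 * (onorm (P i) * norm x)"
        using r onorm[OF bounded_linear_proj, of i x] by (simp add: mult_mono)
    qed
    also have "\<dots> \<le> (\<Sum>i=1..N. r\<^sup>2 * (onorm (P i) * norm x))"
      using onorm_pos_le[OF bounded_linear_proj] by (intro sum_mono2) auto
    also have "\<dots> = ?S * r\<^sup>2 * norm x"
      unfolding sum_distrib_right by (intro sum.cong refl) (simp add: mult_ac)
    also have "\<dots> \<le> (1 + ?S) * r\<^sup>2 * norm x"
      by (intro mult_right_mono) auto
    finally show ?thesis .
  qed
  moreover have "0 \<le> ?S"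
    by (intro sum_nonneg onorm_pos_le[OF bounded_linear_proj])
  then have "0 < 1 + ?S" by linarith
  ultimately show thesis using that by blast
qed

end

context hom_group
begin

section \<open>Uniqueness of P-differentials\<close>

lemma homogeneous_small_eq_0:
  assumes hom: "\<And>r h. 0 < r \<Longrightarrow> q (dl r h) = r * q h"
    and nonneg: "\<And>h. 0 \<le> (q h :: real)"
    and small: "\<And>e. 0 < e \<Longrightarrow> \<exists>\<delta>>0. \<forall>h. h \<noteq> 0 \<longrightarrow> d h 0 < \<delta> \<longrightarrow> q h \<le> e * d h 0"
    and h: "h \<noteq> 0"
  shows "q h = 0"
proof -
  have D: "0 < d h 0" using h d_0_pos by simp
  have "q h \<le> 0 + e" if "0 < e" for e
  proof -
    obtain \<delta> where \<delta>: "0 < \<delta>" "\<forall>k. k \<noteq> 0 \<longrightarrow> d k 0 < \<delta> \<longrightarrow> q k \<le> (e / d h 0) * d k 0"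
      using small[of "e / d h 0"] \<open>0 < e\<close> D by auto
    define t where "t = \<delta> / (2 * d h 0)"
    have t: "0 < t" using \<delta>(1) D by (simp add: t_def)
    have "dl t h \<noteq> 0" using dil_inverse(1)[of t h] t h by auto
    moreover have "d (dl t h) 0 < \<delta>"
      unfolding d_dil_0[OF t] using \<delta>(1) D by (simp add: t_def)
    ultimately have "q (dl t h) \<le> (e / d h 0) * d (dl t h) 0"
      using \<delta>(2) by blast
    then have "t * q h \<le> t * e"
      unfolding d_dil_0[OF t] hom[OF t] using D by (simp add: mult.commute)
    then show ?thesis using t by simp
  qed
  then have "q h \<le> 0" by (rule field_le_epsilon)
  with nonneg[of h] show ?thesis by simp
qed

text \<open>Two homogeneous first order approximations of one map are o(d) apart, and dilating
  towards 0 forces them to agree. Keeping \<open>D\<close> abstract serves vector targets and graded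
  targets alike.\<close>

lemma homogeneous_approximation_unique:
  fixes D :: "'b \<Rightarrow> 'b \<Rightarrow> real"
  assumes D: "\<And>a b. 0 \<le> D a b" "\<And>a b c. D a b \<le> D c a + D c b"
    and hom: "\<And>r h. 0 < r \<Longrightarrow> D (L (dl r h)) (L' (dl r h)) = r * D (L h) (L' h)"
    and L: "\<And>e. 0 < e \<Longrightarrow> \<exists>\<delta>>0. \<forall>h. h \<noteq> 0 \<longrightarrow> d h 0 < \<delta> \<longrightarrow> D (w h) (L h) \<le> e * d h 0"
    and L': "\<And>e. 0 < e \<Longrightarrow> \<exists>\<delta>>0. \<forall>h. h \<noteq> 0 \<longrightarrow> d h 0 < \<delta> \<longrightarrow> D (w h) (L' h) \<le> e * d h 0"
    and h: "h \<noteq> 0"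
  shows "D (L h) (L' h) = 0"
proof (rule homogeneous_small_eq_0[of "\<lambda>h. D (L h) (L' h)"])
  fix e :: real assume "0 < e"
  then have e: "0 < e / 2" by simp
  obtain \<delta>1 where 1: "0 < \<delta>1" "\<And>h. h \<noteq> 0 \<Longrightarrow> d h 0 < \<delta>1 \<Longrightarrow> D (w h) (L h) \<le> e / 2 * d h 0"
    using L[OF e] by blast
  obtain \<delta>2 where 2: "0 < \<delta>2" "\<And>h. h \<noteq> 0 \<Longrightarrow> d h 0 < \<delta>2 \<Longrightarrow> D (w h) (L' h) \<le> e / 2 * d h 0"
    using L'[OF e] by blast
  have "D (L h) (L' h) \<le> e * d h 0" if "h \<noteq> 0" "d h 0 < min \<delta>1 \<delta>2" for h
    using 1(2)[of h] 2(2)[of h] that D(2)[of "L h" "L' h" "w h"] by (simp add: algebra_simps)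
  then show "\<exists>\<delta>>0. \<forall>h. h \<noteq> 0 \<longrightarrow> d h 0 < \<delta> \<longrightarrow> D (L h) (L' h) \<le> e * d h 0"
    using 1(1) 2(1) by (intro exI[of _ "min \<delta>1 \<delta>2"]) auto
qed (use h D(1) hom in auto)

lemma PdGW_iff:
  "PdGW br V N d W F x L \<longleftrightarrow> (\<forall>h. L h \<in> W) \<and> (\<forall>h k. L (mul h k) = L h + L k) \<and>
    (\<forall>r>0. \<forall>h. L (dl r h) = r *\<^sub>R L h) \<and>
    (\<forall>e>0. \<exists>\<delta>>0. \<forall>h. h \<noteq> 0 \<longrightarrow> d h 0 < \<delta> \<longrightarrow> norm (F (mul x h) - F x - L h) \<le> e * d h 0)"
  unfolding PdGW_def Pdiff_at_def quotient_tendsto_iff[OF zero_le_dist]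
  by (simp add: dist_norm)

lemma PdGW_unique:
  fixes L L' :: "'a \<Rightarrow> 'b::euclidean_space"
  assumes L: "PdGW br V N d W F x L" and L': "PdGW br V N d W F x L'"
  shows "L = L'"
proof
  fix h
  note 1 = L[unfolded PdGW_iff] and 2 = L'[unfolded PdGW_iff]
  show "L h = L' h"
  proof (cases "h = 0")
    case True
    have "L 0 = 0" "L' 0 = 0" using 1 2 by (metis add_cancel_left_left mul_0(1))+
    then show ?thesis using True by simp
  next
    case False
    have "dist (L h) (L' h) = 0"
    proof (rule homogeneous_approximation_unique[where D = dist and w = "\<lambda>h. F (mul x h) - F x",
          OF zero_le_dist dist_triangle3 _ _ _ False])
      show "dist (L (dl r h)) (L' (dl r h)) = r * dist (L h) (L' h)" if "0 < r" for r h
        using 1 2 that by (simp add: dist_norm scaleR_diff_right[symmetric])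
    qed (use 1 2 in \<open>simp_all add: dist_norm\<close>)
    then show ?thesis by simp
  qed
qed

lemma dfGW_eq: "PdGW br V N d W F x L \<Longrightarrow> dfGW br V N d W F x = L"
  unfolding dfGW_def by (rule the_equality) (auto intro: PdGW_unique)

lemma norm_close_imp_d_close:
  assumes "0 < e"
  obtains \<delta> where "0 < \<delta>" "\<And>y z. norm z \<le> C \<Longrightarrow> norm (y - z) < \<delta> \<Longrightarrow> d y z < e"
proof -
  obtain \<delta> where \<delta>: "0 < \<delta>"
    "\<And>x y x' y'. norm x \<le> C \<Longrightarrow> norm y \<le> C \<Longrightarrow> dist x' x < \<delta> \<Longrightarrow> dist y' y < \<delta> \<Longrightarrow> dist (d x' y') (d x y) < e"
    using uniformly_continuous_pair[OF d_continuous assms, of C] by blast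
  have "d y z < e" if "norm z \<le> C" "norm (y - z) < \<delta>" for y z
  proof -
    have "dist (d y z) (d z z) < e" using \<delta> that by (intro \<delta>(2)) (auto simp: dist_norm)
    then show ?thesis using d_eq_0[of z z] d_nonneg[of y z] by (simp add: dist_real_def)
  qed
  with \<delta>(1) that show thesis by blast
qed

end

locale hom_pair = G: hom_group brG VG NG d + T: hom_group brM WM NM \<rho>
  for brG :: "'a::euclidean_space \<Rightarrow> 'a \<Rightarrow> 'a" and VG NG d
    and brM :: "'b::euclidean_space \<Rightarrow> 'b \<Rightarrow> 'b" and WM NM \<rho>
begin

section \<open>Homomorphisms commuting with dilations\<close>

definition hhom :: "('a \<Rightarrow> 'b) \<Rightarrow> bool" where
  "hhom L \<longleftrightarrow> (\<forall>h k. L (G.mul h k) = T.mul (L h) (L k)) \<and> (\<forall>r>0. \<forall>h. L (G.dl r h) = T.dl r (L h))"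

lemma hhom_mul: "hhom L \<Longrightarrow> L (G.mul h k) = T.mul (L h) (L k)"
  and hhom_dil: "hhom L \<Longrightarrow> 0 < r \<Longrightarrow> L (G.dl r h) = T.dl r (L h)"
  by (auto simp: hhom_def)

lemma hhom_0: "hhom L \<Longrightarrow> L 0 = 0"
  using hhom_mul[of L 0 0] T.mul_cancel(1)[of "L 0" "L 0"] by simp

text \<open>With s^j = 2 the square of \<open>X\<close> is both 2X and the dilation of
  \<open>X\<close> by s. On the image, layer \<open>i\<close> is thus multiplied both by 2 and by
  s^i, which agree only for i = j.\<close>

lemma hhom_V:
  assumes L: "hhom L" and j: "j \<in> {1..NG}" and X: "X \<in> VG j" and i: "i \<noteq> j"
  shows "T.P i (L X) = 0"
proof (cases "i \<in> {1..NM}")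
  case True
  let ?s = "2 powr (1 / real j) :: real"
  have s: "?s ^ j = 2" using j by (simp add: powr_realpow[symmetric] powr_powr)
  have "G.mul X X = G.dl ?s X"
    using G.mul_scaleR_same[of 1 X 1] G.dil_V[OF j X, of ?s] s by simp
  then have "T.dl ?s (L X) = T.mul (L X) (L X)"
    using hhom_mul[OF L, of X X] hhom_dil[OF L, of ?s X] by simp
  also have "\<dots> = 2 *\<^sub>R L X" using T.mul_scaleR_same[of 1 "L X" 1] by simp
  finally have "T.P i (T.dl ?s (L X)) = T.P i (2 *\<^sub>R L X)" by simp
  then have "(?s ^ i - 2) *\<^sub>R T.P i (L X) = 0"
    by (simp add: T.proj_dil T.proj_simps scaleR_left_diff_distrib)
  moreover have "?s ^ i \<noteq> 2"
  proof
    assume "?s ^ i = 2"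
    then have "?s ^ i = ?s ^ j" using s by simp
    moreover have "1 < ?s" using j powr_less_mono[of 0 "1 / real j" 2] by simp
    ultimately show False using i by (simp add: power_inject_exp)
  qed
  ultimately show ?thesis by simp
qed (rule T.proj_out)

lemma hhom_V_eq:
  assumes L: "hhom L" and j: "j \<in> {1..NG}" and X: "X \<in> VG j"
  shows "L X = T.P j (L X)"
  by (rule T.proj_eqI) (use hhom_V[OF assms] T.proj_proj in auto)

lemma hhom_tail:
  assumes L: "hhom L"
  shows "1 \<le> c \<Longrightarrow> \<forall>k\<in>G.tail c. L k \<in> T.tail c"
proof (induction c rule: G.tail_downward_induct)
  case (zero c)
  then show ?case by (auto dest: G.tail_zero simp: hhom_0[OF L] subspace_0[OF T.subspace_tail])
next
  case (step c)
  show ?case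
  proof
    fix k assume k: "k \<in> G.tail c"
    have "L k = T.mul (L (G.P c k)) (L (G.mul (- G.P c k) k))" by (simp add: hhom_mul[OF L, symmetric])
    moreover have "L (G.P c k) \<in> T.tail c"
      using hhom_V[OF L _ G.proj_in[of c k]] step(1,2) by (auto simp: T.tail_def)
    moreover have "L (G.mul (- G.P c k) k) \<in> T.tail c"
      using step(3) G.mul_minus_proj_tail[OF k step(1)] T.tail_mono[of _ "Suc c" c] by simp
    ultimately show "L k \<in> T.tail c" using T.tail_mul by metis
  qed
qed

text \<open>In layer \<open>j\<close> one has X Y = (X + Y) k with k in the next tail. Since
  \<open>L\<close> preserves tails, projecting to layer \<open>j\<close> removes the image of
  k.\<close>

lemma hhom_layer_linear:
  assumes L: "hhom L" and j: "j \<in> {1..NG}"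
  shows "linear (\<lambda>h. L (G.P j h))"
proof (rule linearI)
  have add: "L (X + Y) = L X + L Y" if X: "X \<in> VG j" and Y: "Y \<in> VG j" for X Y
  proof -
    have XY: "X + Y \<in> VG j" using X Y G.V_subspace[OF j] by (simp add: subspace_add)
    note t = G.V_tail[OF j]
    let ?k = "G.mul (- (X + Y)) (G.mul X Y)"
    have mt: "G.mul X Y \<in> G.tail j" by (intro G.tail_mul t X Y)
    have mXY: "- (X + Y) \<in> G.tail j" by (rule subspace_neg[OF G.subspace_tail t[OF XY]])
    have "G.P j ?k = 0"
      using G.proj_mul_tail[OF mXY mt] G.proj_mul_tail[OF t[OF X] t[OF Y]] j by (simp add: G.proj_simps)
    then have k: "?k \<in> G.tail (Suc j)"
      using G.tail_mul[OF mXY mt] by (auto simp: G.tail_def less_Suc_eq)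
    have Lt: "L Z \<in> T.tail j" if "Z \<in> VG j" for Z
      using hhom_tail[OF L] j t[OF that] by auto
    have Lk: "L ?k \<in> T.tail (Suc j)" using hhom_tail[OF L, of "Suc j"] k by auto
    have "T.mul (L X) (L Y) = T.mul (L (X + Y)) (L ?k)"
      by (simp only: hhom_mul[OF L, symmetric] G.mul_cancel)
    then have "T.P j (T.mul (L X) (L Y)) = T.P j (T.mul (L (X + Y)) (L ?k))" by simp
    then have "T.P j (L X) + T.P j (L Y) = T.P j (L (X + Y)) + T.P j (L ?k)"
      using T.proj_mul_tail[OF Lt[OF X] Lt[OF Y]] T.proj_mul_tail[OF Lt[OF XY] T.tail_mono[OF Lk]] j by simp
    moreover have "T.P j (L ?k) = 0" using Lk by (simp add: T.tail_def)
    ultimately show ?thesis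
      using hhom_V_eq[OF L j X] hhom_V_eq[OF L j Y] hhom_V_eq[OF L j XY] by simp
  qed
  have pos: "L (r *\<^sub>R X) = r *\<^sub>R L X" if X: "X \<in> VG j" and r: "0 < r" for r X
  proof -
    let ?s = "r powr (1 / real j)"
    have s: "?s ^ j = r" using j r by (simp add: powr_realpow[symmetric] powr_powr)
    have "L (r *\<^sub>R X) = L (G.dl ?s X)" using G.dil_V[OF j X, of ?s] s by simp
    also have "\<dots> = T.dl ?s (L X)" using r by (intro hhom_dil[OF L]) simp
    finally have "T.P j (L (r *\<^sub>R X)) = r *\<^sub>R T.P j (L X)" using s by (simp add: T.proj_dil)
    then show ?thesis
      using hhom_V_eq[OF L j X] hhom_V_eq[OF L j, of "r *\<^sub>R X"] X
      by (simp add: subspace_scale[OF G.V_subspace[OF j]])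
  qed
  show "L (G.P j (x + y)) = L (G.P j x) + L (G.P j y)" for x y
    by (simp add: G.proj_simps add G.proj_in[OF j])
  show "L (G.P j (r *\<^sub>R x)) = r *\<^sub>R L (G.P j x)" for r x
  proof -
    let ?X = "G.P j x"
    have X: "?X \<in> VG j" "- ?X \<in> VG j" using G.proj_in[OF j] subspace_neg[OF G.V_subspace[OF j]] by auto
    have neg: "L (- ?X) = - L ?X"
      using add[OF X] hhom_0[OF L] by (simp add: eq_neg_iff_add_eq_0 add.commute)
    show ?thesis
    proof (cases r "0 :: real" rule: linorder_cases)
      case less
      then show ?thesis using pos[OF X(2), of "- r"] neg by (simp add: G.proj_simps)
    qed (auto simp: G.proj_simps hhom_0[OF L] pos[OF X(1)])
  qed
qed

text \<open>Continuity is derived from linearity on each layer: peeling off the lowest layer writes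
  \<open>L\<close> as a product, with the remaining argument in the next tail.\<close>

lemma hhom_continuous: "hhom L \<Longrightarrow> continuous_on UNIV L"
proof -
  assume L: "hhom L"
  have "continuous_on (G.tail c) L" if "1 \<le> c" for c
    using that
  proof (induction rule: G.tail_downward_induct)
    case (zero c)
    then have "G.tail c = {0}" using G.tail_zero subspace_0[OF G.subspace_tail] by auto
    then show ?case by simp
  next
    case (step c)
    have "continuous_on (G.tail c) (\<lambda>k. T.mul (L (G.P c k)) (L (G.mul (- G.P c k) k)))"
    proof (intro continuous_intros)
      show "continuous_on (G.tail c) (\<lambda>k. L (G.P c k))"
        using hhom_layer_linear[OF L, of c] step(1,2)
        by (intro linear_continuous_on) (simp add: linear_linear)
      show "continuous_on (G.tail c) (\<lambda>k. L (G.mul (- G.P c k) k))"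
        by (rule continuous_on_compose2[OF step(3)])
           (auto intro!: continuous_intros G.mul_minus_proj_tail step(1))
    qed
    then show ?case by (simp add: hhom_mul[OF L, symmetric])
  qed
  from this[of 1] show ?thesis using G.tail_1 by (metis One_nat_def UNIV_eq_I order_refl)
qed

section \<open>P-differentials into a graded group\<close>

lemma PdGM_iff:
  "PdGM brG VG NG d brM WM NM \<rho> f x L \<longleftrightarrow> hhom L \<and>
    (\<forall>e>0. \<exists>\<delta>>0. \<forall>h. h \<noteq> 0 \<longrightarrow> d h 0 < \<delta> \<longrightarrow> \<rho> (T.mul (- f x) (f (G.mul x h))) (L h) \<le> e * d h 0)"
  unfolding PdGM_def Pdiff_at_def hhom_def G.quotient_tendsto_iff[OF T.d_nonneg] by simp

lemma PdGM_unique: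
  assumes L: "PdGM brG VG NG d brM WM NM \<rho> f x L" and L': "PdGM brG VG NG d brM WM NM \<rho> f x L'"
  shows "L = L'"
proof
  fix h
  note 1 = L[unfolded PdGM_iff] and 2 = L'[unfolded PdGM_iff]
  show "L h = L' h"
  proof (cases "h = 0")
    case True
    then show ?thesis using 1 2 hhom_0 by metis
  next
    case False
    have "\<rho> (L h) (L' h) = 0"
    proof (rule G.homogeneous_approximation_unique[where D = \<rho> and w = "\<lambda>h. T.mul (- f x) (f (G.mul x h))",
          OF T.d_nonneg _ _ _ _ False])
      show "\<rho> a b \<le> \<rho> c a + \<rho> c b" for a b c using T.d_triangle[of a b c] T.d_sym[of a c] by simp
      show "\<rho> (L (G.dl r h)) (L' (G.dl r h)) = r * \<rho> (L h) (L' h)" if "0 < r" for r h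
        using 1 2 that by (simp add: hhom_dil T.d_dil)
    qed (use 1 2 in simp_all)
    then show ?thesis by (simp add: T.d_eq_0)
  qed
qed

lemma dfGM_eq: "PdGM brG VG NG d brM WM NM \<rho> f x L \<Longrightarrow> dfGM brG VG NG d brM WM NM \<rho> f x = L"
  unfolding dfGM_def by (rule the_equality) (auto intro: PdGM_unique)

lemma hhom_bounded:
  assumes "hhom L"
  obtains C where "0 \<le> C" "\<And>h. norm h \<le> R \<Longrightarrow> norm (L h) \<le> C"
  using norm_bounded_on_cball[OF hhom_continuous[OF assms]] by blast

text \<open>The layers \<open>i \<ge> 2\<close> of \<open>L h\<close> are of order \<open>(d h 0)\<^sup>i\<close>, so only the horizontal part contributes
  to first order.\<close>
lemma PdGM_expansion:
  assumes Pd: "PdGM brG VG NG d brM WM NM \<rho> f x L" and "0 < e"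
  shows "\<exists>\<delta>>0. \<forall>h. h \<noteq> 0 \<longrightarrow> d h 0 < \<delta> \<longrightarrow>
    norm (f (G.mul x h) - f x - T.Psi (f x) (T.P 1 (L h))) \<le> e * d h 0"
proof -
  note Pd' = Pd[unfolded PdGM_iff]
  have L: "hhom L" using Pd' by simp
  let ?p = "f x" and ?w = "\<lambda>h. T.mul (- f x) (f (G.mul x h))"
  obtain B where B: "0 < B" "\<And>v. d v 0 \<le> 1 \<Longrightarrow> norm v \<le> B"
    using G.d_bounded_imp_norm_bounded by blast
  obtain C where C: "0 \<le> C" "\<And>h. norm h \<le> B \<Longrightarrow> norm (L h) \<le> C"
    using hhom_bounded[OF L] by blast
  obtain K where K: "0 < K" "\<And>r x. 0 \<le> r \<Longrightarrow> r \<le> 1 \<Longrightarrow> norm (T.dl r x) \<le> K * r * norm x"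
    using T.dil_norm_bound by blast
  obtain K2 where K2: "0 < K2" "\<And>r x. 0 \<le> r \<Longrightarrow> r \<le> 1 \<Longrightarrow> norm (T.dl r x - r *\<^sub>R T.P 1 x) \<le> K2 * r\<^sup>2 * norm x"
    using T.dil_first_order by blast
  define p1 where "p1 = onorm (T.P 1)"
  define p2 where "p2 = onorm (T.Psi ?p)"
  have p: "0 \<le> p1" "0 \<le> p2"
    unfolding p1_def p2_def
    by (rule onorm_pos_le[OF T.bounded_linear_proj], rule onorm_pos_le[OF T.bounded_linear_Psi])
  \<comment> \<open>The total error is at most \<eta> (S - 1) r: \<open>K * (C + 1)\<close> comes
    from the nonlinearity of translation by \<open>f x\<close>, \<open>p2 * (K2 * (C + 1))\<close>
    from the layers above the first, \<open>p2 * p1\<close> from the remainder of the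
    P-differential. The extra 1 makes \<open>S\<close> positive.\<close>
  define S where "S = K * (C + 1) + p2 * (K2 * (C + 1)) + p2 * p1 + 1"
  have S: "0 < S" unfolding S_def using K(1) K2(1) C(1) p by (intro add_nonneg_pos add_nonneg_nonneg mult_nonneg_nonneg) auto
  define \<eta> where "\<eta> = min 1 (e / S)"
  have \<eta>: "0 < \<eta>" "\<eta> \<le> 1" "\<eta> * S \<le> e"
    using S \<open>0 < e\<close> by (auto simp: \<eta>_def min_def field_simps)
  obtain \<eta>1 where \<eta>1: "0 < \<eta>1" "\<And>y z. norm z \<le> C \<Longrightarrow> \<rho> y z < \<eta>1 \<Longrightarrow> norm (y - z) < \<eta>"
    using T.d_close_imp_norm_close[OF \<eta>(1), of C] by blast
  obtain \<delta>1 where \<delta>1: "0 < \<delta>1" "\<And>h. h \<noteq> 0 \<Longrightarrow> d h 0 < \<delta>1 \<Longrightarrow> \<rho> (?w h) (L h) \<le> \<eta>1 / 2 * d h 0"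
    using Pd' \<eta>1(1) by (meson half_gt_zero)
  obtain \<delta>2 where \<delta>2: "0 < \<delta>2" "\<And>w. norm w < \<delta>2 \<Longrightarrow> norm (T.mul ?p w - ?p - T.Psi ?p w) \<le> \<eta> * norm w"
    using T.mul_has_derivative[of ?p, unfolded has_derivative_at_alt] \<eta>(1) by (auto simp: linear_0[OF T.linear_Psi])
  \<comment> \<open>The bound r \<le> \<eta> turns the r^2 of the higher layers into \<eta> r; the
    quotient by \<open>K * (C + 1)\<close> keeps the increment where translation by
    \<open>f x\<close> is approximated by its differential.\<close>
  define \<delta> where "\<delta> = min (min \<delta>1 \<eta>) (\<delta>2 / (K * (C + 1)))"
  have KC: "0 < K * (C + 1)" using K(1) C(1) by simp
  have \<delta>: "0 < \<delta>" using \<delta>1(1) \<delta>2(1) \<eta>(1) KC by (simp add: \<delta>_def)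
  have "norm (f (G.mul x h) - ?p - T.Psi ?p (T.P 1 (L h))) \<le> e * d h 0" if h: "h \<noteq> 0" "d h 0 < \<delta>" for h
  proof -
    define r where "r = d h 0"
    have r: "0 < r" "r < \<delta>1" "r \<le> 1" "r \<le> \<eta>" "K * r * (C + 1) < \<delta>2"
    proof -
      show "0 < r" using h(1) G.d_0_pos by (simp add: r_def)
      show "r < \<delta>1" "r \<le> \<eta>" "r \<le> 1" using h(2) \<eta>(2) by (auto simp: r_def \<delta>_def)
      have "r < \<delta>2 / (K * (C + 1))" using h(2) by (simp add: r_def \<delta>_def)
      then show "K * r * (C + 1) < \<delta>2" using KC by (simp add: pos_less_divide_eq mult_ac)
    qed
    define h' where "h' = G.dl (1 / r) h"
    have hh': "h = G.dl r h'" using r by (simp add: h'_def G.dil_inverse)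
    have "d h' 0 = 1" using r by (simp add: h'_def G.d_dil_0) (simp add: r_def)
    then have Lh': "norm (L h') \<le> C" by (intro C(2) B(2)) simp
    have Lh: "L h = T.dl r (L h')" using hh' hhom_dil[OF L r(1)] by simp
    define y where "y = T.dl (1 / r) (?w h)"
    have w: "?w h = T.dl r y" using r by (simp add: y_def T.dil_inverse)
    have "r * \<rho> y (L h') \<le> \<eta>1 / 2 * r"
      using \<delta>1(2)[OF h(1)] r unfolding w Lh r_def[symmetric] by (simp add: T.d_dil)
    then have "\<rho> y (L h') < \<eta>1" using r(1) \<eta>1(1) by (simp add: mult.commute)
    then have yL: "norm (y - L h') < \<eta>" by (rule \<eta>1(2)[OF Lh'])
    have y: "norm y \<le> C + 1" using yL Lh' \<eta>(2) norm_triangle_sub[of y "L h'"] by simp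
    have nw: "norm (?w h) \<le> K * r * (C + 1)"
    proof -
      have "norm (T.dl r y) \<le> K * r * norm y" using r by (intro K(2)) auto
      also have "\<dots> \<le> K * r * (C + 1)" using y K(1) r by (intro mult_left_mono) auto
      finally show ?thesis unfolding w .
    qed
    have "norm (T.mul ?p (?w h) - ?p - T.Psi ?p (?w h)) \<le> \<eta> * norm (?w h)"
      using nw r(5) by (intro \<delta>2(2)) simp
    also have "\<dots> \<le> \<eta> * (K * r * (C + 1))" using nw \<eta>(1) by (intro mult_left_mono) auto
    finally have e1: "norm (T.mul ?p (?w h) - ?p - T.Psi ?p (?w h)) \<le> \<eta> * (K * r * (C + 1))" .
    have "norm (T.Psi ?p (?w h) - T.Psi ?p (T.P 1 (L h))) \<le> p2 * norm (?w h - T.P 1 (L h))"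
      unfolding p2_def linear_diff[OF T.linear_Psi, symmetric] by (rule onorm[OF T.bounded_linear_Psi])
    also have "\<dots> \<le> p2 * (K2 * (\<eta> * r) * (C + 1) + r * (p1 * \<eta>))"
    proof (rule mult_left_mono[OF _ p(2)])
      have "?w h - T.P 1 (L h) = (T.dl r y - r *\<^sub>R T.P 1 y) + r *\<^sub>R T.P 1 (y - L h')"
        unfolding w Lh T.proj_1_dil by (simp add: T.proj_simps scaleR_diff_right)
      then have "norm (?w h - T.P 1 (L h)) \<le> norm (T.dl r y - r *\<^sub>R T.P 1 y) + norm (r *\<^sub>R T.P 1 (y - L h'))"
        by (metis norm_triangle_ineq)
      moreover have "norm (T.dl r y - r *\<^sub>R T.P 1 y) \<le> K2 * (\<eta> * r) * (C + 1)"
      proof -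
        have "norm (T.dl r y - r *\<^sub>R T.P 1 y) \<le> K2 * r\<^sup>2 * norm y" using r by (intro K2(2)) auto
        also have "\<dots> \<le> K2 * (\<eta> * r) * (C + 1)"
          using r K2(1) y \<eta>(1) by (intro mult_mono) (auto simp: power2_eq_square)
        finally show ?thesis .
      qed
      moreover have "norm (r *\<^sub>R T.P 1 (y - L h')) \<le> r * (p1 * \<eta>)"
      proof -
        have "norm (T.P 1 (y - L h')) \<le> p1 * norm (y - L h')"
          unfolding p1_def by (rule onorm[OF T.bounded_linear_proj])
        also have "\<dots> \<le> p1 * \<eta>" using yL p(1) by (intro mult_left_mono) auto
        finally show ?thesis using r(1) by simp
      qed
      ultimately show "norm (?w h - T.P 1 (L h)) \<le> K2 * (\<eta> * r) * (C + 1) + r * (p1 * \<eta>)" by linarith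
    qed
    finally have e2: "norm (T.Psi ?p (?w h) - T.Psi ?p (T.P 1 (L h))) \<le> p2 * (K2 * (\<eta> * r) * (C + 1) + r * (p1 * \<eta>))" .
    have "norm (f (G.mul x h) - ?p - T.Psi ?p (T.P 1 (L h)))
      \<le> norm (T.mul ?p (?w h) - ?p - T.Psi ?p (?w h)) + norm (T.Psi ?p (?w h) - T.Psi ?p (T.P 1 (L h)))"
      using norm_triangle_ineq[of "T.mul ?p (?w h) - ?p - T.Psi ?p (?w h)" "T.Psi ?p (?w h) - T.Psi ?p (T.P 1 (L h))"]
      by simp
    also have "\<dots> \<le> \<eta> * (K * r * (C + 1)) + p2 * (K2 * (\<eta> * r) * (C + 1) + r * (p1 * \<eta>))"
      using e1 e2 by linarith
    also have "\<dots> = (\<eta> * (S - 1)) * r" by (simp add: S_def algebra_simps)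
    also have "\<dots> \<le> e * r"
      using \<eta> r(1) by (intro mult_right_mono) (auto simp: algebra_simps)
    finally show ?thesis by (simp add: r_def)
  qed
  with \<delta> show ?thesis by blast
qed

text \<open>The differential of \<open>f\<close> in coordinates is the horizontal vector at
  \<open>f x\<close> of the left invariant field \<open>T.P 1 (L h)\<close>. It is additive in h
  because the projection to the first layer is a homomorphism.\<close>

lemma PdGM_imp_PdGW:
  assumes Pd: "PdGM brG VG NG d brM WM NM \<rho> f x L" and j: "j \<in> {1..NM}"
  shows "PdGW brG VG NG d (WM j) (\<lambda>x. T.P j (f x)) x (\<lambda>h. T.P j (T.Psi (f x) (T.P 1 (L h))))"
  unfolding G.PdGW_iff
proof (intro conjI allI impI)
  have L: "hhom L" using Pd by (simp add: PdGM_iff)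
  show "T.P j (T.Psi (f x) (T.P 1 (L h))) \<in> WM j" for h by (rule T.proj_in[OF j])
  show "T.P j (T.Psi (f x) (T.P 1 (L (G.mul h k))))
      = T.P j (T.Psi (f x) (T.P 1 (L h))) + T.P j (T.Psi (f x) (T.P 1 (L k)))" for h k
    by (simp only: hhom_mul[OF L] T.proj_1_mul linear_add[OF T.linear_Psi] linear_add[OF T.linear_proj])
  show "T.P j (T.Psi (f x) (T.P 1 (L (G.dl r h)))) = r *\<^sub>R T.P j (T.Psi (f x) (T.P 1 (L h)))"
    if "0 < r" for r h
    by (simp only: hhom_dil[OF L that] T.proj_1_dil linear_scale[OF T.linear_Psi] linear_scale[OF T.linear_proj])
  fix e :: real assume "0 < e"
  let ?o = "onorm (T.P j) + 1"
  have o: "0 < ?o" using onorm_pos_le[OF T.bounded_linear_proj, of j] by linarith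
  then have "0 < e / ?o" using \<open>0 < e\<close> by simp
  from PdGM_expansion[OF Pd this] obtain \<delta> where \<delta>: "0 < \<delta>" "\<And>h. h \<noteq> 0 \<Longrightarrow> d h 0 < \<delta> \<Longrightarrow>
    norm (f (G.mul x h) - f x - T.Psi (f x) (T.P 1 (L h))) \<le> e / ?o * d h 0" by blast
  have "norm (T.P j (f (G.mul x h)) - T.P j (f x) - T.P j (T.Psi (f x) (T.P 1 (L h)))) \<le> e * d h 0"
    if "h \<noteq> 0" "d h 0 < \<delta>" for h
  proof -
    let ?v = "f (G.mul x h) - f x - T.Psi (f x) (T.P 1 (L h))"
    have "norm (T.P j ?v) \<le> onorm (T.P j) * norm ?v" by (rule onorm[OF T.bounded_linear_proj])
    also have "\<dots> \<le> ?o * norm ?v" by (intro mult_right_mono) auto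
    also have "\<dots> \<le> ?o * (e / ?o * d h 0)" using \<delta>(2)[OF that] o by (intro mult_left_mono) auto
    also have "\<dots> = e * d h 0" using o by simp
    finally show ?thesis by (simp add: T.proj_simps)
  qed
  with \<delta>(1) show "\<exists>\<delta>>0. \<forall>h. h \<noteq> 0 \<longrightarrow> d h 0 < \<delta> \<longrightarrow>
    norm (T.P j (f (G.mul x h)) - T.P j (f x) - T.P j (T.Psi (f x) (T.P 1 (L h)))) \<le> e * d h 0" by blast
qed

text \<open>Continuity of \<open>f\<close> enters the continuity of each dF_j, whose formula
  contains the base point through \<open>Psi (f x)\<close>.\<close>

lemma PdGM_isCont:
  assumes Pd: "PdGM brG VG NG d brM WM NM \<rho> f x L"
  shows "isCont f x"
  unfolding continuous_at_eps_delta
proof (intro allI impI)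
  fix e :: real assume "0 < e"
  have L: "hhom L" using Pd by (simp add: PdGM_iff)
  obtain \<delta>1 where \<delta>1: "0 < \<delta>1" "\<And>h. h \<noteq> 0 \<Longrightarrow> d h 0 < \<delta>1 \<Longrightarrow>
    norm (f (G.mul x h) - f x - T.Psi (f x) (T.P 1 (L h))) \<le> 1 * d h 0"
    using PdGM_expansion[OF Pd zero_less_one] by blast
  obtain s1 where s1: "0 < s1" "\<And>v. norm v < s1 \<Longrightarrow> d v 0 < min \<delta>1 (e / 2)"
    using G.norm_small_imp_d_small[of "min \<delta>1 (e / 2)"] \<delta>1(1) \<open>0 < e\<close> by auto
  have "continuous_on UNIV (\<lambda>h. T.Psi (f x) (T.P 1 (L h)))"
    by (intro continuous_intros hhom_continuous[OF L])
  then obtain s2 where s2: "0 < s2" "\<And>h. dist h 0 < s2 \<Longrightarrow> dist (T.Psi (f x) (T.P 1 (L h))) (T.Psi (f x) (T.P 1 (L 0))) < e / 2"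
    using \<open>0 < e\<close> unfolding continuous_on_iff by (metis UNIV_I half_gt_zero)
  have "continuous_on UNIV (\<lambda>y. G.mul (- x) y)" by (intro continuous_intros)
  then obtain \<delta> where \<delta>: "0 < \<delta>" "\<And>y. dist y x < \<delta> \<Longrightarrow> dist (G.mul (- x) y) (G.mul (- x) x) < min s1 s2"
    using s1(1) s2(1) unfolding continuous_on_iff by (metis UNIV_I min_less_iff_conj)
  have "dist (f y) (f x) < e" if "dist y x < \<delta>" for y
  proof (cases "y = x")
    case False
    define h where "h = G.mul (- x) y"
    have y: "y = G.mul x h" by (simp add: h_def)
    have h: "h \<noteq> 0" using False y by auto
    have n: "norm h < s1" "norm h < s2" using \<delta>(2)[OF that] by (simp_all add: h_def)
    have 1: "norm (f y - f x - T.Psi (f x) (T.P 1 (L h))) < e / 2"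
      using \<delta>1(2)[OF h] s1(2)[OF n(1)] y by auto
    have "norm (T.Psi (f x) (T.P 1 (L h))) < e / 2"
      using s2(2)[of h] n(2) by (simp add: hhom_0[OF L] T.proj_simps linear_0[OF T.linear_Psi])
    with 1 norm_triangle_ineq[of "f y - f x - T.Psi (f x) (T.P 1 (L h))" "T.Psi (f x) (T.P 1 (L h))"]
    show ?thesis by (simp add: dist_norm)
  qed (use \<open>0 < e\<close> in simp)
  with \<delta>(1) show "\<exists>\<delta>>0. \<forall>y. dist y x < \<delta> \<longrightarrow> dist (f y) (f x) < e" by blast
qed

end

section \<open>Equivalence with the first order system\<close>

lemma cont_op_add:
  assumes "cont_op \<Omega> D A" "cont_op \<Omega> E A"
  shows "cont_op \<Omega> (\<lambda>x h. D x h + E x h) A"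
  unfolding cont_op_def
proof (intro ballI allI impI)
  fix x and e :: real assume x: "x \<in> \<Omega>" and "0 < e"
  then obtain \<delta>1 \<delta>2 where \<delta>: "0 < \<delta>1" "0 < \<delta>2"
    "\<And>y h. y \<in> \<Omega> \<Longrightarrow> dist y x < \<delta>1 \<Longrightarrow> h \<in> A \<Longrightarrow> norm h \<le> 1 \<Longrightarrow> dist (D y h) (D x h) < e / 2"
    "\<And>y h. y \<in> \<Omega> \<Longrightarrow> dist y x < \<delta>2 \<Longrightarrow> h \<in> A \<Longrightarrow> norm h \<le> 1 \<Longrightarrow> dist (E y h) (E x h) < e / 2"
    using assms unfolding cont_op_def by (metis half_gt_zero)
  have "dist (D y h + E y h) (D x h + E x h) < e"
    if "y \<in> \<Omega>" "dist y x < min \<delta>1 \<delta>2" "h \<in> A" "norm h \<le> 1" for y h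
    using \<delta>(3)[of y h] \<delta>(4)[of y h] that dist_triangle_add[of "D y h" "E y h" "D x h" "E x h"] by simp
  then show "\<exists>\<delta>>0. \<forall>y\<in>\<Omega>. dist y x < \<delta> \<longrightarrow> (\<forall>h\<in>A. norm h \<le> 1 \<longrightarrow> dist (D y h + E y h) (D x h + E x h) < e)"
    using \<delta>(1,2) by (intro exI[of _ "min \<delta>1 \<delta>2"]) auto
qed

lemma cont_op_sum:
  assumes "finite I" "\<And>k. k \<in> I \<Longrightarrow> cont_op \<Omega> (D k) A"
  shows "cont_op \<Omega> (\<lambda>x h. \<Sum>k\<in>I. D k x h) A"
  using assms
proof (induction I)
  case empty
  then show ?case by (auto simp: cont_op_def intro: exI[of _ 1])
qed (simp add: cont_op_add)

lemma cont_op_cong: "(\<And>x h. x \<in> \<Omega> \<Longrightarrow> h \<in> A \<Longrightarrow> D x h = E x h) \<Longrightarrow> cont_op \<Omega> D A \<longleftrightarrow> cont_op \<Omega> E A"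
  unfolding cont_op_def by (metis (no_types, lifting))

lemma cont_op_subset: "cont_op \<Omega> D A \<Longrightarrow> B \<subseteq> A \<Longrightarrow> cont_op \<Omega> D B"
  unfolding cont_op_def by (meson subsetD)

lemma (in graded_algebra) hdiff_at_has_vector_derivative:
  assumes "hdiff_at br V N f x D" "X \<in> V 1"
  shows "((\<lambda>t. f (mul x (t *\<^sub>R X))) has_vector_derivative D X) (at 0)"
proof -
  have D: "((\<lambda>X. f (mul x X)) has_derivative D) (at 0 within V 1)"
    using assms(1) by (simp add: hdiff_at_def)
  have "((\<lambda>t::real. t *\<^sub>R X) has_derivative (\<lambda>t. t *\<^sub>R X)) (at 0)"
    by (auto intro!: derivative_eq_intros)
  moreover have "((\<lambda>X. f (mul x X)) has_derivative D) (at (0 *\<^sub>R X) within range (\<lambda>t. t *\<^sub>R X))"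
    using D assms(2) subspace_scale[OF V1_subspace] by (auto intro: has_derivative_subset)
  ultimately have "((\<lambda>X. f (mul x X)) \<circ> (\<lambda>t. t *\<^sub>R X) has_derivative D \<circ> (\<lambda>t. t *\<^sub>R X)) (at 0)"
    by (rule diff_chain_within)
  moreover have "D (t *\<^sub>R X) = t *\<^sub>R D X" for t
    using D has_derivative_linear linear_scale by blast
  ultimately show ?thesis
    by (simp add: has_vector_derivative_def comp_def)
qed

text \<open>\<open>dH\<close> is an arbitrary choice among the derivatives within
  \<open>V 1\<close>, which are compared on \<open>V 1\<close> only; there the derivative along
  lines fixes the value.\<close>

lemma (in graded_algebra) dH_eq:
  assumes "hdiff_at br V N f x D" "X \<in> V 1"
  shows "dH br V N f x X = D X"
proof -
  have "hdiff_at br V N f x (dH br V N f x)"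
    unfolding dH_def by (rule someI[of "hdiff_at br V N f x", OF assms(1)])
  from hdiff_at_has_vector_derivative[OF this assms(2)] hdiff_at_has_vector_derivative[OF assms]
  show ?thesis by (rule vector_derivative_unique_at)
qed

text \<open>On the first layer dilation is scalar multiplication, so \<open>d\<close> scales like
  the norm and the compact unit sphere gives the constant.\<close>

lemma (in hom_group) d_V1_bound:
  obtains K where "0 < K" "\<And>X. X \<in> V 1 \<Longrightarrow> d X 0 \<le> K * norm X"
proof -
  have "compact ((\<lambda>X. d X 0) ` sphere 0 1)"
    by (intro compact_continuous_image compact_sphere continuous_intros)
  then obtain K where K: "\<And>X. norm X = 1 \<Longrightarrow> norm (d X 0) \<le> K"
    using compact_imp_bounded bounded_iff by (metis image_eqI mem_sphere_0)
  have "d X 0 \<le> max 1 K * norm X" if X: "X \<in> V 1" for X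
  proof (cases "X = 0")
    case False
    then have n: "0 < norm X" by simp
    have "(1 / norm X) *\<^sub>R X \<in> V 1" using X subspace_scale[OF V1_subspace] by blast
    then have "X = dl (norm X) ((1 / norm X) *\<^sub>R X)"
      using n N_ge dil_V[of 1] by simp
    then have "d X 0 = norm X * d ((1 / norm X) *\<^sub>R X) 0" using d_dil_0[OF n] by metis
    moreover have "d ((1 / norm X) *\<^sub>R X) 0 \<le> K" using K[of "(1 / norm X) *\<^sub>R X"] n by simp
    ultimately show ?thesis using n by (simp add: mult.commute mult_left_mono)
  qed (use d_eq_0[of 0 0] in simp)
  moreover have "0 < max 1 K" by simp
  ultimately show thesis using that by blast
qed

context hom_pair
begin

abbreviation Fc :: "('a \<Rightarrow> 'b) \<Rightarrow> nat \<Rightarrow> 'a \<Rightarrow> 'b" where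
  "Fc f j \<equiv> (\<lambda>x. T.P j (f x))"

abbreviation dF :: "('a \<Rightarrow> 'b) \<Rightarrow> nat \<Rightarrow> 'a \<Rightarrow> 'a \<Rightarrow> 'b" where
  "dF f j \<equiv> dfGW brG VG NG d (WM j) (Fc f j)"

definition first_order_system :: "'a set \<Rightarrow> ('a \<Rightarrow> 'b) \<Rightarrow> bool" where
  "first_order_system \<Omega> f \<longleftrightarrow> (\<forall>j\<in>{1..NM}. cPdGW brG VG NG d (WM j) \<Omega> (Fc f j)) \<and>
     (\<forall>x\<in>\<Omega>. \<exists>L. PdGM brG VG NG d brM WM NM \<rho> f x L \<and> (\<forall>h. T.P 1 (L h) = dF f 1 x h)) \<and>
     (\<forall>x\<in>\<Omega>. \<forall>h. \<forall>j\<in>{2..NM}. dF f j x h = (\<Sum>n=2..NM. ((-1) ^ n / fact n) *\<^sub>R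
        T.P j (iter_br brM (n - 1) (f x) (\<Sum>k=1..NM. dF f k x h))))"

lemma dF_eq:
  assumes "PdGM brG VG NG d brM WM NM \<rho> f x L" "j \<in> {1..NM}"
  shows "dF f j x = (\<lambda>h. T.P j (T.Psi (f x) (T.P 1 (L h))))"
  by (rule G.dfGW_eq[OF PdGM_imp_PdGW[OF assms]])

lemma system_iff_Phi:
  "(\<forall>j\<in>{2..NM}. T.P j v = (\<Sum>n=2..NM. ((-1) ^ n / fact n) *\<^sub>R T.P j (iter_br brM (n - 1) p v)))
    \<longleftrightarrow> T.Phi p v \<in> WM 1"
proof -
  have "T.Phi p v \<in> WM 1 \<longleftrightarrow> (\<forall>j\<in>{2..NM}. T.P j (T.Phi p v) = 0)"
  proof -
    have "T.Phi p v \<in> WM 1 \<longleftrightarrow> (\<forall>j. j \<noteq> 1 \<longrightarrow> T.P j (T.Phi p v) = 0)"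
      using T.V_iff[of 1 "T.Phi p v"] T.N_ge by simp
    also have "\<dots> \<longleftrightarrow> (\<forall>j\<in>{2..NM}. T.P j (T.Phi p v) = 0)"
    proof (intro iffI ballI allI impI)
      fix j :: nat assume *: "\<forall>j\<in>{2..NM}. T.P j (T.Phi p v) = 0" "j \<noteq> 1"
      show "T.P j (T.Phi p v) = 0"
        using * T.proj_out[of j] by (cases "j \<in> {2..NM}") auto
    qed auto
    finally show ?thesis .
  qed
  then show ?thesis
    by (simp add: T.Phi_iter_br T.proj_simps)
qed

lemma cPdGM_imp_system:
  assumes c: "cPdGM brG VG NG d brM WM NM \<rho> \<Omega> f"
  shows "first_order_system \<Omega> f"
proof -
  define L where "L = dfGM brG VG NG d brM WM NM \<rho> f"
  have Pd: "PdGM brG VG NG d brM WM NM \<rho> f x (L x)" if "x \<in> \<Omega>" for x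
    using c that dfGM_eq unfolding cPdGM_def L_def by metis
  have cont: "cont_op \<Omega> L UNIV" using c by (simp add: cPdGM_def L_def)
  note dF = dF_eq[OF Pd]
  have sum_dF: "(\<Sum>k=1..NM. dF f k x h) = T.Psi (f x) (T.P 1 (L x h))" if "x \<in> \<Omega>" for x h
  proof -
    have "(\<Sum>k=1..NM. dF f k x h) = (\<Sum>k=1..NM. T.P k (T.Psi (f x) (T.P 1 (L x h))))"
      by (intro sum.cong refl) (simp only: dF[OF that])
    then show ?thesis by (simp only: T.sum_proj)
  qed
  show ?thesis
    unfolding first_order_system_def
  proof (intro conjI ballI)
    fix j assume j: "j \<in> {1..NM}"
    show "cPdGW brG VG NG d (WM j) \<Omega> (Fc f j)"
      unfolding cPdGW_def
    proof (intro conjI ballI)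
      show "\<exists>L. PdGW brG VG NG d (WM j) (Fc f j) x L" if "x \<in> \<Omega>" for x
        using PdGM_imp_PdGW[OF Pd[OF that] j] by blast
      have "cont_op \<Omega> (\<lambda>x h. T.P j (T.Psi (f x) (T.P 1 (L x h)))) UNIV"
        unfolding cont_op_def
      proof (intro ballI allI impI)
        fix x and e :: real assume x: "x \<in> \<Omega>" and "0 < e"
        have Lx: "hhom (L x)" using Pd[OF x] by (simp add: PdGM_iff)
        obtain C where C: "0 \<le> C" "\<And>h. norm h \<le> 1 \<Longrightarrow> norm (L x h) \<le> C"
          using hhom_bounded[OF Lx, of 1] by blast
        \<comment> \<open>The differential is a jointly continuous function of \<open>f x\<close>
          and \<open>L x h\<close>. The common radius \<open>max C (norm (f x))\<close> bounds both
          arguments for norm h \<le> 1, so the modulus is uniform in h.\<close>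
        have "continuous_on UNIV (\<lambda>z. T.P j (T.Psi (fst z) (T.P 1 (snd z))))"
          by (intro continuous_intros)
        from uniformly_continuous_pair[OF this \<open>0 < e\<close>, of "max C (norm (f x))"]
        obtain \<delta> where \<delta>: "0 < \<delta>" "\<And>p w p' w'. norm p \<le> max C (norm (f x)) \<Longrightarrow> norm w \<le> max C (norm (f x)) \<Longrightarrow>
          dist p' p < \<delta> \<Longrightarrow> dist w' w < \<delta> \<Longrightarrow>
          dist (T.P j (T.Psi p' (T.P 1 w'))) (T.P j (T.Psi p (T.P 1 w))) < e" by metis
        obtain \<delta>1 where \<delta>1: "0 < \<delta>1" "\<And>y. dist y x < \<delta>1 \<Longrightarrow> dist (f y) (f x) < \<delta>"
          using PdGM_isCont[OF Pd[OF x]] \<delta>(1) unfolding continuous_at_eps_delta by blast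
        obtain \<delta>2 where \<delta>2: "0 < \<delta>2" "\<And>y h. y \<in> \<Omega> \<Longrightarrow> dist y x < \<delta>2 \<Longrightarrow> norm h \<le> 1 \<Longrightarrow> dist (L y h) (L x h) < \<delta>"
          using cont x \<delta>(1) unfolding cont_op_def by (metis UNIV_I)
        have "dist (T.P j (T.Psi (f y) (T.P 1 (L y h)))) (T.P j (T.Psi (f x) (T.P 1 (L x h)))) < e"
          if "y \<in> \<Omega>" "dist y x < min \<delta>1 \<delta>2" "norm h \<le> 1" for y h
          using that C(2)[OF that(3)] by (intro \<delta>(2) \<delta>1(2) \<delta>2(2)) auto
        then show "\<exists>\<delta>>0. \<forall>y\<in>\<Omega>. dist y x < \<delta> \<longrightarrow> (\<forall>h\<in>UNIV. norm h \<le> 1 \<longrightarrow>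
            dist (T.P j (T.Psi (f y) (T.P 1 (L y h)))) (T.P j (T.Psi (f x) (T.P 1 (L x h)))) < e)"
          using \<delta>1(1) \<delta>2(1) by (intro exI[of _ "min \<delta>1 \<delta>2"]) auto
      qed
      moreover have "cont_op \<Omega> (dF f j) UNIV = cont_op \<Omega> (\<lambda>x h. T.P j (T.Psi (f x) (T.P 1 (L x h)))) UNIV"
        by (rule cont_op_cong) (simp only: dF[OF _ j])
      ultimately show "cont_op \<Omega> (dF f j) UNIV" by simp
    qed
  next
    fix x assume x: "x \<in> \<Omega>"
    have 1: "1 \<in> {1..NM}" using T.N_ge by simp
    have "T.P 1 (L x h) = dF f 1 x h" for h
      unfolding dF[OF x 1] T.proj_1_Psi by (simp add: T.proj_proj)
    with Pd[OF x] show "\<exists>L. PdGM brG VG NG d brM WM NM \<rho> f x L \<and> (\<forall>h. T.P 1 (L h) = dF f 1 x h)" by blast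
  next
    fix x assume x: "x \<in> \<Omega>"
    show "\<forall>h. \<forall>j\<in>{2..NM}. dF f j x h = (\<Sum>n=2..NM. ((-1) ^ n / fact n) *\<^sub>R
        T.P j (iter_br brM (n - 1) (f x) (\<Sum>k=1..NM. dF f k x h)))"
    proof
      fix h
      have "T.Phi (f x) (T.Psi (f x) (T.P 1 (L x h))) \<in> WM 1"
        using T.N_ge by (simp add: T.Phi_Psi T.proj_in)
      then show "\<forall>j\<in>{2..NM}. dF f j x h = (\<Sum>n=2..NM. ((-1) ^ n / fact n) *\<^sub>R
        T.P j (iter_br brM (n - 1) (f x) (\<Sum>k=1..NM. dF f k x h)))"
        unfolding system_iff_Phi[symmetric] sum_dF[OF x] using dF[OF x] by simp
    qed
  qed
qed

text \<open>On \<open>VG 1\<close> the distance is bounded by a multiple of the norm, so an error of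
  order \<open>d\<close> becomes one of the order of the norm. Linearity is supplied by
  \<open>additive_hom\<close>.\<close>

lemma PdGW_hdiff:
  assumes "PdGW brG VG NG d W F x L"
  shows "hdiff_at brG VG NG F x L"
  unfolding hdiff_at_def has_derivative_within_alt
proof (intro conjI allI impI)
  note Pd = assms[unfolded G.PdGW_iff]
  have lin: "linear L" using Pd by (intro G.additive_hom(1)) auto
  then show "bounded_linear L" by (simp add: linear_linear)
  fix e :: real assume "0 < e"
  obtain K where K: "0 < K" "\<And>X. X \<in> VG 1 \<Longrightarrow> d X 0 \<le> K * norm X"
    using G.d_V1_bound by blast
  have "0 < e / K" using \<open>0 < e\<close> K(1) by simp
  then obtain \<delta> where \<delta>: "0 < \<delta>" "\<And>h. h \<noteq> 0 \<Longrightarrow> d h 0 < \<delta> \<Longrightarrow> norm (F (G.mul x h) - F x - L h) \<le> e / K * d h 0"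
    using Pd by meson
  have "norm (F (G.mul x X) - F (G.mul x 0) - L (X - 0)) \<le> e * norm (X - 0)"
    if X: "X \<in> VG 1" "norm (X - 0) < \<delta> / K" for X
  proof (cases "X = 0")
    case False
    have "d X 0 \<le> K * norm X" by (rule K(2)[OF X(1)])
    also have "\<dots> < \<delta>" using X(2) K(1) by (simp add: pos_less_divide_eq mult.commute)
    finally have "norm (F (G.mul x X) - F x - L X) \<le> e / K * d X 0" by (rule \<delta>(2)[OF False])
    also have "\<dots> \<le> e / K * (K * norm X)" using K \<open>0 < e\<close> X(1) by (intro mult_left_mono) auto
    also have "\<dots> = e * norm X" using K(1) by simp
    finally show ?thesis by simp
  qed (simp add: linear_0[OF lin])
  then show "\<exists>\<delta>>0. \<forall>X\<in>VG 1. norm (X - 0) < \<delta> \<longrightarrow>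
      norm (F (G.mul x X) - F (G.mul x 0) - L (X - 0)) \<le> e * norm (X - 0)"
    using \<delta>(1) K(1) by (intro exI[of _ "\<delta> / K"]) auto
qed

lemma system_imp_contact:
  assumes s: "first_order_system \<Omega> f"
  shows "chdiff brG VG NG \<Omega> f" and "contact brG VG NG brM WM NM \<Omega> f"
proof -
  have Pd: "PdGW brG VG NG d (WM j) (Fc f j) x (dF f j x)" if "x \<in> \<Omega>" "j \<in> {1..NM}" for x j
  proof -
    have "\<exists>L. PdGW brG VG NG d (WM j) (Fc f j) x L"
      using s that by (auto simp: first_order_system_def cPdGW_def)
    then obtain L where L: "PdGW brG VG NG d (WM j) (Fc f j) x L" ..
    then show ?thesis using G.dfGW_eq[OF L] by simp
  qed
  define D where "D x h = (\<Sum>k=1..NM. dF f k x h)" for x h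
  have hd: "hdiff_at brG VG NG f x (D x)" if x: "x \<in> \<Omega>" for x
  proof -
    have "((\<lambda>X. \<Sum>k=1..NM. T.P k (f (G.mul x X))) has_derivative D x) (at 0 within VG 1)"
      unfolding D_def[abs_def]
      by (intro has_derivative_sum PdGW_hdiff[OF Pd[OF x], unfolded hdiff_at_def])
    then show ?thesis by (simp only: hdiff_at_def T.sum_proj)
  qed
  have dH: "dH brG VG NG f x X = D x X" if "x \<in> \<Omega>" "X \<in> VG 1" for x X
    by (rule G.dH_eq[OF hd[OF that(1)] that(2)])
  show "chdiff brG VG NG \<Omega> f"
    unfolding chdiff_def
  proof (intro conjI ballI)
    show "\<exists>D. hdiff_at brG VG NG f x D" if "x \<in> \<Omega>" for x using hd[OF that] by blast
    have "cont_op \<Omega> (dF f k) UNIV" if "k \<in> {1..NM}" for k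
      using s that by (auto simp: first_order_system_def cPdGW_def)
    then have "cont_op \<Omega> D UNIV"
      unfolding D_def[abs_def] by (intro cont_op_sum) auto
    then have "cont_op \<Omega> D (VG 1)" by (rule cont_op_subset) simp
    moreover have "cont_op \<Omega> (dH brG VG NG f) (VG 1) \<longleftrightarrow> cont_op \<Omega> D (VG 1)"
      by (rule cont_op_cong[OF dH])
    ultimately show "cont_op \<Omega> (dH brG VG NG f) (VG 1)" by blast
  qed
  show "contact brG VG NG brM WM NM \<Omega> f"
    unfolding contact_def
  proof (intro ballI)
    fix x X assume x: "x \<in> \<Omega>" and X: "X \<in> VG 1"
    \<comment> \<open>Each dF_j takes values in the layer \<open>WM j\<close>, so projecting the sum
      recovers the single differential.\<close>
    have "T.P j (D x X) = dF f j x X" if j: "j \<in> {1..NM}" for j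
    proof -
      have "T.P j (D x X) = (\<Sum>k=1..NM. T.P j (dF f k x X))" by (simp add: D_def T.proj_simps)
      also have "\<dots> = (\<Sum>k=1..NM. if j = k then dF f k x X else 0)"
        using Pd[OF x] by (intro sum.cong refl T.proj_V) (auto simp: G.PdGW_iff)
      also have "\<dots> = dF f j x X" using j by simp
      finally show ?thesis .
    qed
    moreover have "\<forall>j\<in>{2..NM}. dF f j x X = (\<Sum>n=2..NM. ((-1) ^ n / fact n) *\<^sub>R
        T.P j (iter_br brM (n - 1) (f x) (D x X)))"
      using s x unfolding first_order_system_def D_def by blast
    ultimately have "T.Phi (f x) (D x X) \<in> WM 1"
      unfolding system_iff_Phi[symmetric] by simp
    then show "dH brG VG NG f x X \<in> horiz brM NM (WM 1) (f x)"
      unfolding T.horiz_iff dH[OF x X] .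
  qed
qed

end

section \<open>From contact maps to P-differentiability\<close>

lemma norm_app_le: "norm (app T v) \<le> norm T * norm v"
  by transfer (rule norm_blinfun)

context graded_algebra
begin

lemma Phi_dil: "Phi (dl r p) (dl r v) = dl r (Phi p v)"
  unfolding Phi_def
  by (rule fcalc_intertwine[symmetric, where M = "dl r" and T = "br p" and S = "br (dl r p)"])
     (simp_all add: linear_dil dil_br)

text \<open>Evaluating \<open>M z\<close> at (0, 1) yields deg z up to sign, and \<open>deg\<close>
  is linear and injective in finite dimension. This carries smallness of \<open>M z\<close> back to
  \<open>z\<close>.\<close>

lemma M_bounded_below:
  obtains b where "0 < b" "\<And>z. b * norm z \<le> norm (M z)"
proof -
  have "inj deg" using deg_inj by (simp add: linear_inj_iff_eq_0 linear_deg)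
  then obtain b where b: "0 < b" "\<And>z. b * norm z \<le> norm (deg z)"
    using linear_inj_bounded_below_pos[OF linear_deg] by blast
  have "b * norm z \<le> norm (M z)" for z
  proof -
    have "norm (deg z) = norm (app (M z) (0, 1))" by (simp add: norm_Pair br_simps)
    also have "\<dots> \<le> norm (M z)" using norm_app_le[of "M z" "(0, 1)"] by (simp add: norm_Pair)
    finally show ?thesis using b(2)[of z] by linarith
  qed
  with b(1) that show thesis by blast
qed

lemma nlog_small:
  assumes "0 < e" obtains \<delta> where "0 < \<delta>" "\<And>n. norm n < \<delta> \<Longrightarrow> norm (nlog n) < e"
proof -
  have "continuous_on UNIV nlog"
    unfolding nlog_def[abs_def] fcalc_def times_funpow by (intro continuous_intros)
  moreover have "nlog 0 = 0"
    using nlog_exp[OF subspace_0[OF J_subspace]] by simp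
  ultimately show thesis
    using assms that unfolding continuous_on_iff by (metis UNIV_I dist_0_norm dist_commute)
qed

text \<open>Stability of left logarithmic derivatives: \<open>P s = exp (M (u s)) exp (- s M w)\<close> has a small
  derivative relative to its size, so it stays close to \<open>1\<close>.\<close>

lemma log_derivative_stability:
  assumes "0 < e"
  obtains \<eta> where "0 < \<eta>"
    "\<And>u a w. (\<And>s. s \<in> {0..1} \<Longrightarrow> \<exists>v. (u has_vector_derivative v) (at s) \<and> Phi (u s) v = a s) \<Longrightarrow>
      u 0 = 0 \<Longrightarrow> norm w \<le> C \<Longrightarrow> (\<And>s. s \<in> {0..1} \<Longrightarrow> norm (a s - w) \<le> \<eta>) \<Longrightarrow> norm (u 1 - w) < e"
proof -
  have bl: "bounded_linear M" by (simp add: linear_linear linear_M)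
  define b where "b = onorm M + 1"
  have b: "0 < b" "norm (M x) \<le> b * norm x" for x
  proof -
    show "0 < b" unfolding b_def using onorm_pos_le[OF bl] by linarith
    have "norm (M x) \<le> onorm M * norm x" by (rule onorm[OF bl])
    also have "\<dots> \<le> b * norm x" unfolding b_def by (intro mult_right_mono) auto
    finally show "norm (M x) \<le> b * norm x" .
  qed
  define E where "E = exp (b * \<bar>C\<bar>)"
  have E: "0 < E" by (simp add: E_def)
  obtain c where c: "0 < c" "\<And>z. c * norm z \<le> norm (M z)" using M_bounded_below by blast
  obtain \<delta>m where \<delta>m: "0 < \<delta>m" "\<And>x y x' y'. norm x \<le> \<bar>C\<bar> \<Longrightarrow> norm y \<le> \<bar>C\<bar> \<Longrightarrow>
      dist x' x < \<delta>m \<Longrightarrow> dist y' y < \<delta>m \<Longrightarrow> dist (mul x' y') (mul x y) < e"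
    using uniformly_continuous_pair[OF continuous_mul_pair assms, of "\<bar>C\<bar>"] by blast
  obtain \<delta>n where \<delta>n: "0 < \<delta>n" "\<And>n. norm n < \<delta>n \<Longrightarrow> norm (nlog n) < c * \<delta>m"
    using nlog_small[of "c * \<delta>m"] c(1) \<delta>m(1) by auto
  \<comment> \<open>\<open>E\<close> bounds the exponentials of s M w and of its negative for s in
    [0,1], and \<open>b * \<eta>\<close> bounds \<open>M (a s - w)\<close>. The choice gives
    \<kappa> = min (1/2) (\<delta>n/4): the first entry closes the estimate for m, the second brings
    \<open>p 1\<close> into the range of \<open>nlog_small\<close>.\<close>
  define \<eta> where "\<eta> = min (1 / 2) (\<delta>n / 4) / (E * E * b)"
  have \<eta>: "0 < \<eta>" unfolding \<eta>_def using E b(1) \<delta>n(1) by simp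
  define \<kappa> where "\<kappa> = E * (b * \<eta>) * E"
  have "\<kappa> = min (1 / 2) (\<delta>n / 4)" using E b(1) by (simp add: \<kappa>_def \<eta>_def)
  then have \<kappa>: "\<kappa> \<le> 1 / 2" "2 * \<kappa> < \<delta>n" using \<delta>n(1) by auto
  have "norm (u 1 - w) < e"
    if u: "\<And>s. s \<in> {0..1} \<Longrightarrow> \<exists>v. (u has_vector_derivative v) (at s) \<and> Phi (u s) v = a s"
      and u0: "u 0 = 0" and w: "norm w \<le> C" and a: "\<And>s. s \<in> {0..1} \<Longrightarrow> norm (a s - w) \<le> \<eta>" for u a w
  proof -
    define A where "A = - M w"
    define p where "p s = exp (M (u s)) * exp (s *\<^sub>R A)" for s
    define D where "D s = p s * (exp (- (s *\<^sub>R A)) * M (a s - w) * exp (s *\<^sub>R A))" for s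
    have p': "(p has_vector_derivative D s) (at s)" if s: "s \<in> {0..1}" for s
    proof -
      obtain v where v: "(u has_vector_derivative v) (at s)" "Phi (u s) v = a s" using u[OF s] by blast
      have "(p has_vector_derivative exp (M (u s)) * (exp (s *\<^sub>R A) * A)
          + exp (M (u s)) * M (Phi (u s) v) * exp (s *\<^sub>R A)) (at s)"
        unfolding p_def[abs_def]
        by (intro has_vector_derivative_mult exp_M_has_vector_derivative v(1)
            exp_scaleR_has_vector_derivative_right)
      moreover have "exp (M (u s)) * (exp (s *\<^sub>R A) * A) + exp (M (u s)) * M (Phi (u s) v) * exp (s *\<^sub>R A)
          = exp (M (u s)) * M (a s - w) * exp (s *\<^sub>R A)"
        unfolding v(2) exp_times_scaleR_commute
        by (simp add: A_def M_simps algebra_simps)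
      moreover have "exp (M (u s)) * M (a s - w) * exp (s *\<^sub>R A) = D s"
      proof -
        have "exp (s *\<^sub>R A) * (exp (- (s *\<^sub>R A)) * y) = y" for y
          using exp_minus_inverse[of "s *\<^sub>R A"] by (simp add: mult.assoc[symmetric])
        then show ?thesis by (simp add: D_def p_def mult.assoc)
      qed
      ultimately show ?thesis by simp
    qed
    have Dn: "norm (D s) \<le> norm (p s) * \<kappa>" if s: "s \<in> {0..1}" for s
    proof -
      have "norm (s *\<^sub>R A) \<le> 1 * (b * \<bar>C\<bar>)"
      proof -
        have "norm A \<le> b * \<bar>C\<bar>"
        proof -
          have "norm (M w) \<le> b * norm w" by (rule b(2))
          also have "\<dots> \<le> b * \<bar>C\<bar>" using w b(1) by (intro mult_left_mono) auto
          finally show ?thesis by (simp add: A_def)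
        qed
        then show ?thesis using s unfolding norm_scaleR by (intro mult_mono) auto
      qed
      then have ne: "norm (exp (s *\<^sub>R A)) \<le> E" "norm (exp (- (s *\<^sub>R A))) \<le> E"
        unfolding E_def using norm_exp[of "s *\<^sub>R A"] norm_exp[of "- (s *\<^sub>R A)"]
        by (auto elim!: order_trans simp: norm_minus_cancel)
      have nm: "norm (M (a s - w)) \<le> b * \<eta>"
        by (rule order_trans[OF b(2) mult_left_mono[OF a[OF s] less_imp_le[OF b(1)]]])
      have "norm (exp (- (s *\<^sub>R A)) * M (a s - w) * exp (s *\<^sub>R A))
          \<le> norm (exp (- (s *\<^sub>R A))) * norm (M (a s - w)) * norm (exp (s *\<^sub>R A))"
        by (rule order_trans[OF norm_mult_ineq mult_right_mono[OF norm_mult_ineq norm_ge_zero]])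
      also have "\<dots> \<le> \<kappa>"
        unfolding \<kappa>_def using ne nm E b(1) \<eta> by (intro mult_mono) auto
      finally have "norm (exp (- (s *\<^sub>R A)) * M (a s - w) * exp (s *\<^sub>R A)) \<le> \<kappa>" .
      then show ?thesis
        unfolding D_def by (rule order_trans[OF norm_mult_ineq mult_left_mono[OF _ norm_ge_zero]])
    qed
    \<comment> \<open>The maximum m of \<open>norm (p s - 1)\<close> replaces an integral
      inequality: the mean value bound gives m \<le> (m + 1) \<kappa>, hence m \<le> 2 \<kappa>
      because \<kappa> \<le> 1/2.\<close>
    have "continuous_on {0..1} p"
      using p' by (meson continuous_at_imp_continuous_on has_vector_derivative_continuous)
    then have "continuous_on {0..1} (\<lambda>s. norm (p s - 1))" by (intro continuous_intros)
    then obtain s0 where s0: "s0 \<in> {0..1}" "\<And>s. s \<in> {0..1} \<Longrightarrow> norm (p s - 1) \<le> norm (p s0 - 1)"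
      using continuous_attains_sup[of "{0..1::real}" "\<lambda>s. norm (p s - 1)"] by auto
    define m where "m = norm (p s0 - 1)"
    have \<kappa>0: "0 \<le> \<kappa>" unfolding \<kappa>_def using E b(1) \<eta> by simp
    have pn: "norm (p s) * \<kappa> \<le> (m + 1) * \<kappa>" if "s \<in> {0..1}" for s
    proof -
      have "norm (p s) \<le> norm (p s - 1) + 1" using norm_triangle_sub[of "p s" 1] by simp
      with s0(2)[OF that] have "norm (p s) \<le> m + 1" by (simp add: m_def)
      then show ?thesis using \<kappa>0 by (rule mult_right_mono)
    qed
    have "norm (p s0 - p 0) \<le> (m + 1) * \<kappa> * norm (s0 - 0)"
    proof (rule differentiable_bound[of "{0..1}" p "\<lambda>s t. t *\<^sub>R D s"])
      show "(p has_derivative (\<lambda>t. t *\<^sub>R D s)) (at s within {0..1})" if "s \<in> {0..1}" for s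
        using p'[OF that] by (auto simp: has_vector_derivative_def intro: has_derivative_at_withinI)
      show "onorm (\<lambda>t. t *\<^sub>R D s) \<le> (m + 1) * \<kappa>" if "s \<in> {0..1}" for s
      proof (rule onorm_le)
        fix t :: real
        have "norm (D s) \<le> (m + 1) * \<kappa>" using Dn[OF that] pn[OF that] by linarith
        then have "norm t * norm (D s) \<le> norm t * ((m + 1) * \<kappa>)" by (intro mult_left_mono) auto
        then show "norm (t *\<^sub>R D s) \<le> (m + 1) * \<kappa> * norm t"
          by (simp only: norm_scaleR real_norm_def mult.commute[of _ "\<bar>t\<bar>"])
      qed
    qed (use s0(1) in auto)
    also have "\<dots> \<le> (m + 1) * \<kappa> * 1"
      using s0(1) \<kappa>0 by (intro mult_left_mono) (auto simp: m_def)
    finally have "m \<le> (m + 1) * \<kappa>"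
      by (simp add: m_def p_def u0 linear_0[OF linear_M])
    moreover have "m * \<kappa> \<le> m * (1 / 2)" using \<kappa>(1) by (intro mult_left_mono) (auto simp: m_def)
    ultimately have "m \<le> 2 * \<kappa>" by (simp add: algebra_simps)
    then have p1: "norm (p 1 - 1) < \<delta>n" using s0(2)[of 1] \<kappa>(2) by (simp add: m_def)
    \<comment> \<open>The logarithm of \<open>p 1\<close> is the group quotient of
      \<open>u 1\<close> by \<open>w\<close>; once it is small, multiplying back by the bounded
      \<open>w\<close> compares the two points in norm.\<close>
    define z where "z = mul (u 1) (- w)"
    have "p 1 = exp (M z)" by (simp add: p_def z_def exp_M_bch A_def M_simps)
    then have "M z = nlog (p 1 - 1)" by (simp add: nlog_exp M_filt)
    then have "c * norm z < c * \<delta>m" using \<delta>n(2)[OF p1] c(2)[of z] by simp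
    then have "dist z 0 < \<delta>m" using c(1) by simp
    then have "dist (mul z w) (mul 0 w) < e"
      using w \<delta>m(1) by (intro \<delta>m(2)) auto
    then show ?thesis by (simp add: z_def mul_assoc dist_norm)
  qed
  with \<eta> that show thesis by blast
qed

end

locale contact_map = hom_pair +
  fixes \<Omega> :: "'a set" and f :: "'a \<Rightarrow> 'b"
  assumes strat: "stratified_algebra brG VG NG"
    and open_\<Omega>: "open \<Omega>"
    and chdiff: "chdiff brG VG NG \<Omega> f"
    and contact: "contact brG VG NG brM WM NM \<Omega> f"
begin

section \<open>Difference quotients of a contact map\<close>

definition A :: "'a \<Rightarrow> 'a \<Rightarrow> 'b" where
  "A x X = T.P 1 (dH brG VG NG f x X)"

text \<open>The Pansu difference quotient. The base point \<open>x\<close> stays a variable because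
  it moves with every factor of a product.\<close>

definition Q :: "'a \<Rightarrow> real \<Rightarrow> 'a \<Rightarrow> 'b" where
  "Q x r h = T.dl (1 / r) (T.mul (- f x) (f (G.mul x (G.dl r h))))"

lemma hdiff: "x \<in> \<Omega> \<Longrightarrow> hdiff_at brG VG NG f x (dH brG VG NG f x)"
  using chdiff unfolding chdiff_def dH_def by (metis someI_ex)

lemma linear_dH: "x \<in> \<Omega> \<Longrightarrow> linear (dH brG VG NG f x)"
  using hdiff[of x] unfolding hdiff_at_def by (rule has_derivative_linear)

lemma linear_A: "x \<in> \<Omega> \<Longrightarrow> linear (A x)"
  unfolding A_def[abs_def]
  using linear_compose[OF linear_dH T.linear_proj] by (simp add: comp_def)

lemma A_in: "A x X \<in> WM 1"
  unfolding A_def using T.N_ge by (intro T.proj_in) simp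

text \<open>Contactness puts \<open>Phi (f x)\<close> of the differential into the first layer, and
  \<open>Phi\<close> does not change the first layer component; so the left invariant representative
  is a mere projection.\<close>

lemma Phi_dH: "x \<in> \<Omega> \<Longrightarrow> X \<in> VG 1 \<Longrightarrow> T.Phi (f x) (dH brG VG NG f x X) = A x X"
proof -
  assume x: "x \<in> \<Omega>" and X: "X \<in> VG 1"
  have *: "T.Phi (f x) (dH brG VG NG f x X) \<in> WM 1"
    using contact x X unfolding contact_def T.horiz_iff by blast
  have "T.Phi (f x) (dH brG VG NG f x X) = T.P 1 (T.Phi (f x) (dH brG VG NG f x X))"
    using T.proj_V[OF _ *, of 1] T.N_ge by simp
  then show ?thesis by (simp only: T.proj_1_Phi A_def)
qed

text \<open>h-differentiability speaks of the parameter 0 only. Since x (sX) (tX) = x ((s+t)X),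
  using it at the moving point x (sX) gives the derivative at s.\<close>

lemma curve_derivative:
  assumes X: "X \<in> VG 1" and y: "G.mul x (s *\<^sub>R X) \<in> \<Omega>"
  shows "((\<lambda>s. f (G.mul x (s *\<^sub>R X))) has_vector_derivative dH brG VG NG f (G.mul x (s *\<^sub>R X)) X) (at s)"
proof -
  let ?g = "\<lambda>t. f (G.mul (G.mul x (s *\<^sub>R X)) (t *\<^sub>R X))" and ?v = "dH brG VG NG f (G.mul x (s *\<^sub>R X)) X"
  have "(?g has_vector_derivative ?v) (at (s - s))"
    using G.hdiff_at_has_vector_derivative[OF hdiff[OF y] X] by simp
  moreover have "((\<lambda>t. t - s) has_vector_derivative 1) (at s)"
    by (auto intro!: derivative_eq_intros simp: has_vector_derivative_def)
  ultimately have "(?g \<circ> (\<lambda>t. t - s) has_vector_derivative 1 *\<^sub>R ?v) (at s)"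
    by (intro vector_diff_chain_at)
  then show ?thesis
    by (simp add: comp_def G.mul_assoc G.mul_scaleR_same)
qed

text \<open>Left translation by the inverse of \<open>f x\<close> leaves the left logarithmic
  derivative unchanged, and dilation by 1/r undoes the factor r in the first layer. What remains is
  \<open>A\<close> at the moving point.\<close>

lemma Q_curve:
  assumes X: "X \<in> VG 1" and r: "0 < r" and y: "G.mul x (s *\<^sub>R (r *\<^sub>R X)) \<in> \<Omega>"
  shows "\<exists>v. ((\<lambda>s. Q x r (s *\<^sub>R X)) has_vector_derivative v) (at s) \<and>
    T.Phi (Q x r (s *\<^sub>R X)) v = A (G.mul x (s *\<^sub>R (r *\<^sub>R X))) X"
proof -
  let ?y = "G.mul x (s *\<^sub>R (r *\<^sub>R X))" and ?\<gamma> = "\<lambda>s. f (G.mul x (s *\<^sub>R (r *\<^sub>R X)))"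
  have rX: "r *\<^sub>R X \<in> VG 1" using X subspace_scale[OF G.V1_subspace] by blast
  have Q: "Q x r (s *\<^sub>R X) = T.dl (1 / r) (T.mul (- f x) (?\<gamma> s))" for s
  proof -
    have "s *\<^sub>R X \<in> VG 1" using X subspace_scale[OF G.V1_subspace] by blast
    then have "G.dl r (s *\<^sub>R X) = s *\<^sub>R (r *\<^sub>R X)" using G.dil_V[of 1] G.N_ge by simp
    then show ?thesis by (simp add: Q_def)
  qed
  have \<gamma>: "(?\<gamma> has_vector_derivative dH brG VG NG f ?y (r *\<^sub>R X)) (at s)"
    by (rule curve_derivative[OF rX y])
  then have "?\<gamma> differentiable (at s)" by (rule differentiableI_vector)
  then have "(\<lambda>s. T.mul (- f x) (?\<gamma> s)) differentiable (at s)"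
    by (intro T.differentiable_mul) auto
  then obtain \<beta> where \<beta>: "((\<lambda>s. T.mul (- f x) (?\<gamma> s)) has_vector_derivative \<beta>) (at s)"
    using vector_derivative_works by blast
  have "T.Phi (T.mul (- f x) (?\<gamma> s)) \<beta> = r *\<^sub>R A ?y X"
    using T.Phi_left_translate[OF \<gamma> \<beta>] Phi_dH[OF y rX] linear_scale[OF linear_A[OF y]] by simp
  then have "T.Phi (Q x r (s *\<^sub>R X)) (T.dl (1 / r) \<beta>) = T.dl (1 / r) (r *\<^sub>R A ?y X)"
    unfolding Q by (simp add: T.Phi_dil)
  also have "\<dots> = A ?y X"
    using T.dil_V[OF _ A_in, of "1 / r" ?y X] r T.N_ge by (simp add: linear_scale[OF T.linear_dil])
  finally have "T.Phi (Q x r (s *\<^sub>R X)) (T.dl (1 / r) \<beta>) = A ?y X" .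
  moreover have "((\<lambda>s. Q x r (s *\<^sub>R X)) has_vector_derivative T.dl (1 / r) \<beta>) (at s)"
    unfolding Q
    by (rule bounded_linear.has_vector_derivative[OF _ \<beta>]) (simp add: linear_linear T.linear_dil)
  ultimately show ?thesis by blast
qed

lemma A_uniform:
  assumes x0: "x0 \<in> \<Omega>" and "0 < e"
  shows "\<exists>\<delta>>0. \<forall>y. dist y x0 < \<delta> \<longrightarrow> y \<in> \<Omega> \<and> (\<forall>X\<in>VG 1. norm X \<le> C \<longrightarrow> norm (A y X - A x0 X) \<le> e)"
proof -
  \<comment> \<open>\<open>cont_op\<close> tests operators on the unit ball; vectors of norm up to
    \<open>C\<close> are rescaled by 1/c, and \<open>o1\<close> pays for the projection to the first
    layer.\<close>
  define c where "c = \<bar>C\<bar> + 1"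
  define o1 where "o1 = onorm (T.P 1) + 1"
  have c: "0 < c" by (simp add: c_def)
  have o1: "0 < o1" unfolding o1_def using onorm_pos_le[OF T.bounded_linear_proj, of 1] by linarith
  have "0 < e / (o1 * c)" using c o1 \<open>0 < e\<close> by simp
  then obtain \<delta>1 where \<delta>1: "0 < \<delta>1" "\<And>y X. y \<in> \<Omega> \<Longrightarrow> dist y x0 < \<delta>1 \<Longrightarrow> X \<in> VG 1 \<Longrightarrow> norm X \<le> 1 \<Longrightarrow>
      dist (dH brG VG NG f y X) (dH brG VG NG f x0 X) < e / (o1 * c)"
    using chdiff x0 unfolding chdiff_def cont_op_def by metis
  obtain \<delta>2 where \<delta>2: "0 < \<delta>2" "ball x0 \<delta>2 \<subseteq> \<Omega>" using open_\<Omega> x0 open_contains_ball by blast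
  have "norm (A y X - A x0 X) \<le> e" if y: "y \<in> \<Omega>" "dist y x0 < \<delta>1" and X: "X \<in> VG 1" "norm X \<le> C" for y X
  proof -
    define X' where "X' = (1 / c) *\<^sub>R X"
    have X': "X' \<in> VG 1" "norm X' \<le> 1" "X = c *\<^sub>R X'"
      using X c subspace_scale[OF G.V1_subspace] by (auto simp: X'_def c_def divide_le_eq)
    have "A y X - A x0 X = c *\<^sub>R T.P 1 (dH brG VG NG f y X' - dH brG VG NG f x0 X')"
      unfolding X'(3) linear_scale[OF linear_A[OF y(1)]] linear_scale[OF linear_A[OF x0]]
      by (simp add: A_def T.proj_simps scaleR_diff_right)
    then have "norm (A y X - A x0 X) = c * norm (T.P 1 (dH brG VG NG f y X' - dH brG VG NG f x0 X'))"
      using c by simp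
    also have "\<dots> \<le> c * (o1 * norm (dH brG VG NG f y X' - dH brG VG NG f x0 X'))"
    proof (rule mult_left_mono)
      let ?v = "dH brG VG NG f y X' - dH brG VG NG f x0 X'"
      have "norm (T.P 1 ?v) \<le> onorm (T.P 1) * norm ?v" by (rule onorm[OF T.bounded_linear_proj])
      also have "\<dots> \<le> o1 * norm ?v" unfolding o1_def by (intro mult_right_mono) auto
      finally show "norm (T.P 1 ?v) \<le> o1 * norm ?v" .
    qed (use c in simp)
    also have "\<dots> \<le> c * (o1 * (e / (o1 * c)))"
      using \<delta>1(2)[OF y X'(1,2)] c o1 by (intro mult_left_mono) (auto simp: dist_norm)
    also have "\<dots> = e" using c o1 by simp
    finally show ?thesis .
  qed
  then show ?thesis
    using \<delta>1(1) \<delta>2 by (intro exI[of _ "min \<delta>1 \<delta>2"]) (auto simp: dist_commute subset_iff)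
qed

lemma A_bounded:
  assumes "x \<in> \<Omega>" obtains C' where "0 \<le> C'" "\<And>X. norm X \<le> C \<Longrightarrow> norm (A x X) \<le> C'"
  using norm_bounded_on_cball[OF linear_continuous_on[of "A x"]] linear_A[OF assms]
  by (auto simp: linear_linear)

lemma translate_near:
  assumes "0 < e"
  shows "\<exists>\<delta>>0. \<forall>x r X. dist x x0 < \<delta> \<longrightarrow> 0 < r \<longrightarrow> r < \<delta> \<longrightarrow> norm X \<le> C \<longrightarrow> dist (G.mul x (r *\<^sub>R X)) x0 < e"
proof -
  obtain \<delta> where \<delta>: "0 < \<delta>" "\<And>x y x' y'. norm x \<le> norm x0 \<Longrightarrow> norm y \<le> norm x0 \<Longrightarrow>
      dist x' x < \<delta> \<Longrightarrow> dist y' y < \<delta> \<Longrightarrow> dist (G.mul x' y') (G.mul x y) < e"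
    using uniformly_continuous_pair[OF G.continuous_mul_pair assms, of "norm x0"] by blast
  define c where "c = \<bar>C\<bar> + 1"
  have c: "1 \<le> c" by (simp add: c_def)
  have "dist (G.mul x (r *\<^sub>R X)) x0 < e" if "dist x x0 < \<delta> / c" "0 < r" "r < \<delta> / c" "norm X \<le> C" for x r X
  proof -
    have "norm (r *\<^sub>R X) \<le> r * c" using that by (simp add: c_def)
    also have "\<dots> < \<delta>" using that(3) c by (simp add: pos_less_divide_eq)
    finally have "dist (r *\<^sub>R X) 0 < \<delta>" by simp
    moreover have "\<delta> / c \<le> \<delta>" using c \<delta>(1) by (simp add: divide_le_eq mult_le_cancel_left1)
    ultimately have "dist (G.mul x (r *\<^sub>R X)) (G.mul x0 0) < e"
      using that(1) by (intro \<delta>(2)) auto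
    then show ?thesis by simp
  qed
  then show ?thesis using c \<delta>(1) by (intro exI[of _ "\<delta> / c"]) auto
qed

lemma Q_horizontal:
  assumes x0: "x0 \<in> \<Omega>" and "0 < e"
  shows "\<exists>\<delta>>0. \<forall>x r X. dist x x0 < \<delta> \<longrightarrow> 0 < r \<longrightarrow> r < \<delta> \<longrightarrow> X \<in> VG 1 \<longrightarrow> norm X \<le> C \<longrightarrow>
    norm (Q x r X - A x0 X) < e"
proof -
  obtain C' where C': "0 \<le> C'" "\<And>X. norm X \<le> C \<Longrightarrow> norm (A x0 X) \<le> C'"
    using A_bounded[OF x0, of C] by blast
  obtain \<eta> where \<eta>: "0 < \<eta>"
    "\<And>u a w. (\<And>s. s \<in> {0..1} \<Longrightarrow> \<exists>v. (u has_vector_derivative v) (at s) \<and> T.Phi (u s) v = a s) \<Longrightarrow>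
      u 0 = 0 \<Longrightarrow> norm w \<le> C' \<Longrightarrow> (\<And>s. s \<in> {0..1} \<Longrightarrow> norm (a s - w) \<le> \<eta>) \<Longrightarrow> norm (u 1 - w) < e"
    using T.log_derivative_stability[OF \<open>0 < e\<close>, of C'] by blast
  obtain \<delta>1 where \<delta>1: "0 < \<delta>1"
    "\<And>y. dist y x0 < \<delta>1 \<Longrightarrow> y \<in> \<Omega> \<and> (\<forall>X\<in>VG 1. norm X \<le> C \<longrightarrow> norm (A y X - A x0 X) \<le> \<eta>)"
    using A_uniform[OF x0 \<eta>(1), of C] by blast
  obtain \<delta> where \<delta>: "0 < \<delta>"
    "\<And>x r X. dist x x0 < \<delta> \<Longrightarrow> 0 < r \<Longrightarrow> r < \<delta> \<Longrightarrow> norm X \<le> C \<Longrightarrow> dist (G.mul x (r *\<^sub>R X)) x0 < \<delta>1"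
    using translate_near[OF \<delta>1(1), of x0 C] by blast
  have "norm (Q x r X - A x0 X) < e"
    if x: "dist x x0 < \<delta>" and r: "0 < r" "r < \<delta>" and X: "X \<in> VG 1" "norm X \<le> C" for x r X
  proof -
    have near: "dist (G.mul x (s *\<^sub>R (r *\<^sub>R X))) x0 < \<delta>1" if s: "s \<in> {0..1}" for s
    proof -
      have "norm (s *\<^sub>R X) \<le> 1 * C" using s X(2) unfolding norm_scaleR by (intro mult_mono) auto
      then have "dist (G.mul x (r *\<^sub>R (s *\<^sub>R X))) x0 < \<delta>1" by (intro \<delta>(2)[OF x r]) simp
      then show ?thesis by (simp add: mult.commute)
    qed
    have "norm (Q x r (1 *\<^sub>R X) - A x0 X) < e"
    proof (rule \<eta>(2)[where u = "\<lambda>s. Q x r (s *\<^sub>R X)" and a = "\<lambda>s. A (G.mul x (s *\<^sub>R (r *\<^sub>R X))) X"])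
      show "\<exists>v. ((\<lambda>s. Q x r (s *\<^sub>R X)) has_vector_derivative v) (at s) \<and>
          T.Phi (Q x r (s *\<^sub>R X)) v = A (G.mul x (s *\<^sub>R (r *\<^sub>R X))) X" if "s \<in> {0..1}" for s
        using \<delta>1(2)[OF near[OF that]] by (intro Q_curve X(1) r(1)) simp
      show "norm (A (G.mul x (s *\<^sub>R (r *\<^sub>R X))) X - A x0 X) \<le> \<eta>" if "s \<in> {0..1}" for s
        using \<delta>1(2)[OF near[OF that]] X by blast
    qed (use C'(2)[OF X(2)] in \<open>auto simp: Q_def\<close>)
    then show ?thesis by simp
  qed
  with \<delta>(1) show ?thesis by blast
qed

lemma Q_mul: "0 < r \<Longrightarrow> Q x r (G.mul h k) = T.mul (Q x r h) (Q (G.mul x (G.dl r h)) r k)"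
  by (simp add: Q_def T.dil_mul[symmetric] T.mul_assoc G.mul_assoc G.dil_mul)

text \<open>By the cocycle rule \<open>Q_mul\<close> the remaining factors are measured from the
  shifted point x (rX). The induction hypothesis applies there because it covers all base points
  near x0, while the limit keeps the operator \<open>A x0\<close>.\<close>

lemma Q_hprod:
  assumes x0: "x0 \<in> \<Omega>"
  shows "0 < e \<Longrightarrow> \<exists>\<delta>>0. \<forall>x r xs. dist x x0 < \<delta> \<longrightarrow> 0 < r \<longrightarrow> r < \<delta> \<longrightarrow> length xs = m \<longrightarrow>
    (\<forall>X\<in>set xs. X \<in> VG 1 \<and> norm X \<le> C) \<longrightarrow> norm (Q x r (G.hprod xs) - T.hprod (map (A x0) xs)) < e"
proof (induction m arbitrary: e)
  case 0
  then show ?case by (auto simp: Q_def intro!: exI[of _ 1])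
next
  case (Suc m)
  obtain C' where C': "0 \<le> C'" "\<And>X. norm X \<le> C \<Longrightarrow> norm (A x0 X) \<le> C'"
    using A_bounded[OF x0, of C] by blast
  obtain B where B: "0 \<le> B" "\<And>z. z \<in> T.hprods m C' \<Longrightarrow> norm z \<le> B"
    using T.hprods_bounded[of m C'] by blast
  obtain \<delta>0 where \<delta>0: "0 < \<delta>0" "\<And>x y x' y'. norm x \<le> max B C' \<Longrightarrow> norm y \<le> max B C' \<Longrightarrow>
      dist x' x < \<delta>0 \<Longrightarrow> dist y' y < \<delta>0 \<Longrightarrow> dist (T.mul x' y') (T.mul x y) < e"
    using uniformly_continuous_pair[OF T.continuous_mul_pair Suc.prems, of "max B C'"] by blast
  obtain \<delta>1 where \<delta>1: "0 < \<delta>1" "\<And>x r xs. dist x x0 < \<delta>1 \<Longrightarrow> 0 < r \<Longrightarrow> r < \<delta>1 \<Longrightarrow> length xs = m \<Longrightarrow>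
    (\<forall>X\<in>set xs. X \<in> VG 1 \<and> norm X \<le> C) \<Longrightarrow> norm (Q x r (G.hprod xs) - T.hprod (map (A x0) xs)) < \<delta>0"
    using Suc.IH[OF \<delta>0(1)] by blast
  obtain \<delta>2 where \<delta>2: "0 < \<delta>2" "\<And>x r X. dist x x0 < \<delta>2 \<Longrightarrow> 0 < r \<Longrightarrow> r < \<delta>2 \<Longrightarrow> X \<in> VG 1 \<Longrightarrow>
    norm X \<le> C \<Longrightarrow> norm (Q x r X - A x0 X) < \<delta>0"
    using Q_horizontal[OF x0 \<delta>0(1), of C] by blast
  obtain \<delta>3 where \<delta>3: "0 < \<delta>3"
    "\<And>x r X. dist x x0 < \<delta>3 \<Longrightarrow> 0 < r \<Longrightarrow> r < \<delta>3 \<Longrightarrow> norm X \<le> C \<Longrightarrow> dist (G.mul x (r *\<^sub>R X)) x0 < \<delta>1"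
    using translate_near[OF \<delta>1(1), of x0 C] by blast
  define \<delta> where "\<delta> = min \<delta>1 (min \<delta>2 \<delta>3)"
  have "norm (Q x r (G.hprod xs) - T.hprod (map (A x0) xs)) < e"
    if x: "dist x x0 < \<delta>" and r: "0 < r" "r < \<delta>" and len: "length xs = Suc m"
      and xs: "\<forall>X\<in>set xs. X \<in> VG 1 \<and> norm X \<le> C" for x r xs
  proof -
    obtain X ys where Xy: "xs = X # ys" "length ys = m" using len by (cases xs) auto
    have X: "X \<in> VG 1" "norm X \<le> C" and ys: "\<forall>X\<in>set ys. X \<in> VG 1 \<and> norm X \<le> C"
      using xs Xy by auto
    have "G.dl r X = r *\<^sub>R X" using G.dil_V[of 1 X] X(1) G.N_ge by simp
    then have Q: "Q x r (G.hprod xs) = T.mul (Q x r X) (Q (G.mul x (r *\<^sub>R X)) r (G.hprod ys))"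
      using Q_mul[OF r(1), of x X "G.hprod ys"] by (simp add: Xy)
    have d1: "dist (Q x r X) (A x0 X) < \<delta>0"
      unfolding dist_norm using x r X by (intro \<delta>2(2)) (auto simp: \<delta>_def)
    have near: "dist (G.mul x (r *\<^sub>R X)) x0 < \<delta>1" using x r X(2) by (intro \<delta>3(2)) (auto simp: \<delta>_def)
    have d2: "dist (Q (G.mul x (r *\<^sub>R X)) r (G.hprod ys)) (T.hprod (map (A x0) ys)) < \<delta>0"
      unfolding dist_norm using r Xy(2) ys near by (intro \<delta>1(2)) (auto simp: \<delta>_def)
    have "T.hprod (map (A x0) ys) \<in> T.hprods m C'"
      unfolding T.hprods_def using Xy(2) ys C'(2) A_in by (intro CollectI exI[of _ "map (A x0) ys"]) auto
    then have "norm (T.hprod (map (A x0) ys)) \<le> max B C'" using B(2) by (simp add: le_max_iff_disj)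
    moreover have "norm (A x0 X) \<le> max B C'" using C'(2)[OF X(2)] by simp
    ultimately have "dist (Q x r (G.hprod xs)) (T.mul (A x0 X) (T.hprod (map (A x0) ys))) < e"
      unfolding Q using d1 d2 by (intro \<delta>0(2))
    then show ?thesis by (simp add: Xy dist_norm)
  qed
  moreover have "0 < \<delta>" using \<delta>1(1) \<delta>2(1) \<delta>3(1) by (simp add: \<delta>_def)
  ultimately show ?case by blast
qed

text \<open>A limit depends on \<open>h\<close> alone and not on a factorisation into horizontal
  elements; factorisations serve to compute it.\<close>

definition L :: "'a \<Rightarrow> 'a \<Rightarrow> 'b" where
  "L x h = Lim (at_right 0) (\<lambda>r. Q x r h)"

lemma Q_tendsto_hprod:
  assumes x: "x \<in> \<Omega>" and xs: "set xs \<subseteq> VG 1"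
  shows "((\<lambda>r. Q x r (G.hprod xs)) \<longlongrightarrow> T.hprod (map (A x) xs)) (at_right 0)"
  unfolding tendsto_iff
proof (intro allI impI)
  fix e :: real assume "0 < e"
  have C: "\<forall>X\<in>set xs. X \<in> VG 1 \<and> norm X \<le> sum_list (map norm xs)"
    using xs by (auto intro!: member_le_sum_list)
  obtain \<delta> where "0 < \<delta>" "\<And>r. 0 < r \<Longrightarrow> r < \<delta> \<Longrightarrow> norm (Q x r (G.hprod xs) - T.hprod (map (A x) xs)) < e"
    using Q_hprod[OF x \<open>0 < e\<close>, of "length xs" "sum_list (map norm xs)"] C by (metis dist_self)
  then show "\<forall>\<^sub>F r in at_right 0. dist (Q x r (G.hprod xs)) (T.hprod (map (A x) xs)) < e"
    unfolding eventually_at_right_field dist_norm by blast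
qed

lemma L_hprod: "x \<in> \<Omega> \<Longrightarrow> set xs \<subseteq> VG 1 \<Longrightarrow> L x (G.hprod xs) = T.hprod (map (A x) xs)"
  unfolding L_def by (rule tendsto_Lim[OF _ Q_tendsto_hprod]) simp_all

lemma ex_hprod: "\<exists>xs. h = G.hprod xs \<and> set xs \<subseteq> VG 1"
proof -
  obtain m C where "h \<in> G.hprods m C"
    using stratified_algebra.bounded_generation[OF strat, of "norm h"] by blast
  then show ?thesis unfolding G.hprods_def by blast
qed

lemma Q_tendsto: "x \<in> \<Omega> \<Longrightarrow> ((\<lambda>r. Q x r h) \<longlongrightarrow> L x h) (at_right 0)"
  using ex_hprod[of h] Q_tendsto_hprod L_hprod by metis

text \<open>Any factorisation computes \<open>L\<close>: concatenated factorisations give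
  multiplicativity, and rescaling each horizontal factor by r gives compatibility with
  dilations.\<close>

lemma hhom_L:
  assumes x: "x \<in> \<Omega>"
  shows "hhom (L x)"
  unfolding hhom_def
proof (intro conjI allI impI)
  fix h k
  obtain xs ys where "h = G.hprod xs" "set xs \<subseteq> VG 1" "k = G.hprod ys" "set ys \<subseteq> VG 1"
    using ex_hprod by metis
  then show "L x (G.mul h k) = T.mul (L x h) (L x k)"
    using L_hprod[OF x, of "xs @ ys"] by (simp add: L_hprod[OF x] G.hprod_append T.hprod_append)
next
  fix r :: real and h assume r: "0 < r"
  obtain xs where xs: "h = G.hprod xs" "set xs \<subseteq> VG 1" using ex_hprod by metis
  have G: "G.dl r (G.hprod ys) = G.hprod (map ((*\<^sub>R) r) ys)" if "set ys \<subseteq> VG 1" for ys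
    using that G.N_ge by (induction ys) (simp_all add: G.dil_mul G.dil_V[of 1, simplified])
  have T: "T.dl r (T.hprod (map (A x) ys)) = T.hprod (map (A x) (map ((*\<^sub>R) r) ys))" for ys
    using T.N_ge T.dil_V[OF _ A_in, of r x]
    by (induction ys) (simp_all add: T.dil_mul linear_scale[OF linear_A[OF x]])
  have "set (map ((*\<^sub>R) r) xs) \<subseteq> VG 1" using xs(2) subspace_scale[OF G.V1_subspace] by auto
  then show "L x (G.dl r h) = T.dl r (L x h)"
    using xs(2) by (simp only: xs(1) G T L_hprod[OF x])
qed

text \<open>\<open>bounded_generation\<close> supplies one length \<open>m\<close> and one bound
  \<open>C\<close> for all h of the ball, which makes the convergence for products uniform in
  h.\<close>

lemma Q_uniform:
  assumes x0: "x0 \<in> \<Omega>" and "0 < e"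
  shows "\<exists>\<delta>>0. \<forall>x r h. dist x x0 < \<delta> \<longrightarrow> 0 < r \<longrightarrow> r < \<delta> \<longrightarrow> norm h \<le> R \<longrightarrow> norm (Q x r h - L x0 h) < e"
proof -
  obtain m C where mC: "\<And>h. norm h \<le> R \<Longrightarrow> h \<in> G.hprods m C"
    using stratified_algebra.bounded_generation[OF strat, of R] by blast
  obtain \<delta> where \<delta>: "0 < \<delta>" "\<And>x r xs. dist x x0 < \<delta> \<Longrightarrow> 0 < r \<Longrightarrow> r < \<delta> \<Longrightarrow> length xs = m \<Longrightarrow>
    (\<forall>X\<in>set xs. X \<in> VG 1 \<and> norm X \<le> C) \<Longrightarrow> norm (Q x r (G.hprod xs) - T.hprod (map (A x0) xs)) < e"
    using Q_hprod[OF x0 \<open>0 < e\<close>, of m C] by blast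
  have "norm (Q x r h - L x0 h) < e" if h: "dist x x0 < \<delta>" "0 < r" "r < \<delta>" "norm h \<le> R" for x r h
  proof -
    obtain xs where xs: "h = G.hprod xs" "length xs = m" "\<forall>X\<in>set xs. X \<in> VG 1 \<and> norm X \<le> C"
      using mC[OF h(4)] unfolding G.hprods_def by blast
    then have "L x0 h = T.hprod (map (A x0) xs)" using L_hprod[OF x0, of xs] by auto
    with \<delta>(2)[OF h(1-3) xs(2,3)] xs(1) show ?thesis by simp
  qed
  with \<delta>(1) show ?thesis by blast
qed

lemma PdGM_L:
  assumes x: "x \<in> \<Omega>"
  shows "PdGM brG VG NG d brM WM NM \<rho> f x (L x)"
  unfolding PdGM_iff
proof (intro conjI allI impI)
  show Lx: "hhom (L x)" by (rule hhom_L[OF x])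
  fix e :: real assume "0 < e"
  obtain B where B: "0 < B" "\<And>v. d v 0 \<le> 1 \<Longrightarrow> norm v \<le> B"
    using G.d_bounded_imp_norm_bounded by blast
  obtain C where C: "0 \<le> C" "\<And>h. norm h \<le> B \<Longrightarrow> norm (L x h) \<le> C"
    using hhom_bounded[OF Lx, of B] by blast
  obtain \<eta> where \<eta>: "0 < \<eta>" "\<And>y z. norm z \<le> C \<Longrightarrow> norm (y - z) < \<eta> \<Longrightarrow> \<rho> y z < e"
    using T.norm_close_imp_d_close[OF \<open>0 < e\<close>, of C] by blast
  obtain \<delta> where \<delta>: "0 < \<delta>" "\<And>r h. 0 < r \<Longrightarrow> r < \<delta> \<Longrightarrow> norm h \<le> B \<Longrightarrow> norm (Q x r h - L x h) < \<eta>"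
    using Q_uniform[OF x \<eta>(1), of B] by (metis dist_self)
  have "\<rho> (T.mul (- f x) (f (G.mul x h))) (L x h) \<le> e * d h 0" if h: "h \<noteq> 0" "d h 0 < \<delta>" for h
  proof -
    define r where "r = d h 0"
    have r: "0 < r" "r < \<delta>" using h G.d_0_pos by (auto simp: r_def)
    \<comment> \<open>Dilation normalises \<open>h\<close> to distance 1, hence to a bounded set;
      homogeneity of \<rho> then turns closeness of the quotient into the error
      \<open>e * d h 0\<close>.\<close>
    define h' where "h' = G.dl (1 / r) h"
    have hh': "h = G.dl r h'" using r by (simp add: h'_def G.dil_inverse)
    have "d h' 0 = 1" using r by (simp add: h'_def G.d_dil_0) (simp add: r_def)
    then have h': "norm h' \<le> B" by (intro B(2)) simp
    have "\<rho> (Q x r h') (L x h') < e" by (rule \<eta>(2)[OF C(2)[OF h'] \<delta>(2)[OF r h']])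
    moreover have "T.mul (- f x) (f (G.mul x h)) = T.dl r (Q x r h')"
      using r unfolding hh' Q_def by (simp add: T.dil_inverse)
    moreover have "L x h = T.dl r (L x h')" using hh' hhom_dil[OF Lx r(1)] by simp
    ultimately show ?thesis
      using r by (simp add: T.d_dil r_def[symmetric] mult.commute)
  qed
  with \<delta>(1) show "\<exists>\<delta>>0. \<forall>h. h \<noteq> 0 \<longrightarrow> d h 0 < \<delta> \<longrightarrow>
      \<rho> (T.mul (- f x) (f (G.mul x h))) (L x h) \<le> e * d h 0" by blast
qed

lemma contact_imp_cPdGM: "cPdGM brG VG NG d brM WM NM \<rho> \<Omega> f"
  unfolding cPdGM_def
proof (intro conjI ballI)
  show "\<exists>L. PdGM brG VG NG d brM WM NM \<rho> f x L" if "x \<in> \<Omega>" for x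
    using PdGM_L[OF that] by blast
  have "cont_op \<Omega> L UNIV"
    unfolding cont_op_def
  proof (intro ballI allI impI)
    fix x and e :: real assume x: "x \<in> \<Omega>" and "0 < e"
    then obtain \<delta> where \<delta>: "0 < \<delta>" "\<And>y r h. dist y x < \<delta> \<Longrightarrow> 0 < r \<Longrightarrow> r < \<delta> \<Longrightarrow> norm h \<le> 1 \<Longrightarrow>
      norm (Q y r h - L x h) < e / 2"
      using Q_uniform[OF x, of "e / 2" 1] by auto
    \<comment> \<open>For small r the quotient based at y is near \<open>L x h\<close>, not only
      near its own limit; letting r tend to 0 compares the two differentials. The bound e / 2
      absorbs the loss of strictness.\<close>
    have "dist (L y h) (L x h) < e" if y: "y \<in> \<Omega>" "dist y x < \<delta>" and h: "norm h \<le> 1" for y h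
    proof -
      have "((\<lambda>r. norm (Q y r h - L x h)) \<longlongrightarrow> norm (L y h - L x h)) (at_right 0)"
        by (intro tendsto_intros Q_tendsto y(1))
      moreover have "\<forall>\<^sub>F r in at_right 0. norm (Q y r h - L x h) \<le> e / 2"
        unfolding eventually_at_right_field using \<delta>(1) \<delta>(2)[OF y(2) _ _ h] less_imp_le by blast
      ultimately have "norm (L y h - L x h) \<le> e / 2"
        by (rule tendsto_upperbound) simp
      then show ?thesis using \<open>0 < e\<close> by (simp add: dist_norm)
    qed
    with \<delta>(1) show "\<exists>\<delta>>0. \<forall>y\<in>\<Omega>. dist y x < \<delta> \<longrightarrow> (\<forall>h\<in>UNIV. norm h \<le> 1 \<longrightarrow> dist (L y h) (L x h) < e)"
      by blast
  qed
  moreover have "cont_op \<Omega> (dfGM brG VG NG d brM WM NM \<rho> f) UNIV \<longleftrightarrow> cont_op \<Omega> L UNIV"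
    by (rule cont_op_cong) (simp only: dfGM_eq[OF PdGM_L])
  ultimately show "cont_op \<Omega> (dfGM brG VG NG d brM WM NM \<rho> f) UNIV" by blast
qed

end

theorem theorem1p1:
  fixes brG :: "'a::euclidean_space \<Rightarrow> 'a \<Rightarrow> 'a" and VG :: "nat \<Rightarrow> 'a set" and \<iota> :: nat
    and brM :: "'b::euclidean_space \<Rightarrow> 'b \<Rightarrow> 'b" and WM :: "nat \<Rightarrow> 'b set" and \<upsilon> :: nat
    and d :: "'a \<Rightarrow> 'a \<Rightarrow> real" and \<rho> :: "'b \<Rightarrow> 'b \<Rightarrow> real"
    and \<Omega> :: "'a set" and f :: "'a \<Rightarrow> 'b"
  assumes "stratified brG VG \<iota>" and "graded brM WM \<upsilon>"
    and "hom_dist brG VG \<iota> d" and "hom_dist brM WM \<upsilon> \<rho>"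
    and "open \<Omega>"
  shows "let F = (\<lambda>j x. proj WM \<upsilon> j (f x));
             dF = (\<lambda>j. dfGW brG VG \<iota> d (WM j) (F j));
             i1 = cPdGM brG VG \<iota> d brM WM \<upsilon> \<rho> \<Omega> f;
             i2 = ((\<forall>j\<in>{1..\<upsilon>}. cPdGW brG VG \<iota> d (WM j) \<Omega> (F j)) \<and>
                   (\<forall>x\<in>\<Omega>. \<exists>L. PdGM brG VG \<iota> d brM WM \<upsilon> \<rho> f x L \<and>
                        (\<forall>h. proj WM \<upsilon> 1 (L h) = dF 1 x h)) \<and>
                   (\<forall>x\<in>\<Omega>. \<forall>h. \<forall>j\<in>{2..\<upsilon>}.
                        dF j x h = (\<Sum>n=2..\<upsilon>. ((-1) ^ n / fact n) *\<^sub>R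
                           proj WM \<upsilon> j (iter_br brM (n - 1) (f x) (\<Sum>k=1..\<upsilon>. dF k x h)))));
             i3 = (chdiff brG VG \<iota> \<Omega> f \<and> contact brG VG \<iota> brM WM \<upsilon> \<Omega> f)
         in (i1 \<longleftrightarrow> i2) \<and> (i2 \<longleftrightarrow> i3)"
proof -
  interpret G: stratified_algebra brG VG \<iota>
    using assms(1) by unfold_locales (simp_all add: stratified_def)
  interpret hom_pair brG VG \<iota> d brM WM \<upsilon> \<rho>
    using assms(1-4) by unfold_locales (simp_all add: stratified_def)
  have "cPdGM brG VG \<iota> d brM WM \<upsilon> \<rho> \<Omega> f"
    if "chdiff brG VG \<iota> \<Omega> f" "contact brG VG \<iota> brM WM \<upsilon> \<Omega> f"
  proof -
    interpret contact_map brG VG \<iota> d brM WM \<upsilon> \<rho> \<Omega> f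
      by unfold_locales (use that assms(5) G.stratified_algebra_axioms in auto)
    show ?thesis by (rule contact_imp_cPdGM)
  qed
  then show ?thesis
    using cPdGM_imp_system[of \<Omega> f] system_imp_contact[of \<Omega> f]
    unfolding first_order_system_def Let_def by blast
qed

end
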